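(* Let $X$ be a compact complex manifold. If $X$ satisfies the Schweitzer qualitative property, then $X$ satisfies the $\partial\overline\partial$-Lemma.
   Context: For a compact complex manifold $X$ of complex dimension $n$, let $(\wedge^{\bullet,\bullet}X,\partial,\overline\partial)$ be the double complex of smooth complex-valued differential forms, bigraded by type $(p,q)$. Define the Bott-Chern and Aeppli cohomologies (bigraded, taken in each bidegree $(p,q)$, and finite-dimensional) by $$ H^{\bullet,\bullet}_{BC}(X)=\frac{\ker\partial\cap\ker\overline\partial}{\mathrm{im}\,\partial\overline\partial},\qquad H^{\bullet,\bullet}_{A}(X)=\frac{\ker\partial\overline\partial}{\mathrm{im}\,\partial+\mathrm{im}\,\overline\partial}. $$ $X$ is said to satisfy the Schweitzer qualitative property if the natural pairing $$ H^{\bullet,\bullet}_{BC}(X)\times H^{\bullet,\bullet}_{BC}(X)\to\mathbb{C},\qquad ([\alpha],[\beta])\mapsto\int_X\alpha\wedge\beta, $$ induced by the wedge product and by the pairing with the fundamental class $[X]$, is non-degenerate. (Here the integral picks out the component of $\alpha\wedge\beta$ of bidegree $(n,n)$.) $X$ is said to satisfy the $\partial\overline\partial$-Lemma if the natural map $H^{\bullet,\bullet}_{BC}(X)\to H^{\bullet,\bullet}_{A}(X)$ induced by the identity on forms is injective. *)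

theory Defs
  imports
    "HOL-Analysis.Analysis"
    "HOL-Combinatorics.Permutations"
    "HOL-Library.Function_Algebras"
begin

section \<open>Smooth and holomorphic maps\<close>

text \<open>Both notions are used for open sets \<open>S\<close> only.\<close>

primrec Ck_on :: "nat \<Rightarrow> 'v::real_normed_vector set \<Rightarrow> ('v \<Rightarrow> 'w::real_normed_vector) \<Rightarrow> bool" where
  "Ck_on 0 S f \<longleftrightarrow> continuous_on S f"
| "Ck_on (Suc k) S f \<longleftrightarrow>
     (\<forall>x\<in>S. f differentiable (at x)) \<and> (\<forall>v. Ck_on k S (\<lambda>x. frechet_derivative f (at x) v))"

definition smooth_on :: "'v::real_normed_vector set \<Rightarrow> ('v \<Rightarrow> 'w::real_normed_vector) \<Rightarrow> bool" where
  "smooth_on S f \<longleftrightarrow> (\<forall>k. Ck_on k S f)"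

text \<open>A smooth map satisfying the Cauchy--Riemann equations, i.e. with complex-linear
  differential.\<close>

definition holomorphic_map_on ::
    "(complex ^ 'n) set \<Rightarrow> (complex ^ 'n \<Rightarrow> complex ^ 'n::finite) \<Rightarrow> bool" where
  "holomorphic_map_on S f \<longleftrightarrow> smooth_on S f \<and>
     (\<forall>z\<in>S. \<forall>a v. frechet_derivative f (at z) (a *s v) = a *s frechet_derivative f (at z) v)"


section \<open>Complex manifolds\<close>

text \<open>A chart is a pair of its domain and its coordinate map; the values of the coordinate map
  outside the domain are irrelevant. The complex dimension is \<open>CARD('n)\<close>.\<close>

type_synonym ('a, 'n) chart = "'a set \<times> ('a \<Rightarrow> complex ^ 'n)"

definition chart_range :: "('a, 'n::finite) chart \<Rightarrow> (complex ^ 'n) set" where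
  "chart_range c = snd c ` fst c"

definition chart_inv :: "('a, 'n::finite) chart \<Rightarrow> complex ^ 'n \<Rightarrow> 'a" where
  "chart_inv c = inv_into (fst c) (snd c)"

definition overlap :: "('a, 'n::finite) chart \<Rightarrow> ('a, 'n) chart \<Rightarrow> (complex ^ 'n) set" where
  "overlap c c' = snd c ` (fst c \<inter> fst c')"

definition transition ::
    "('a, 'n::finite) chart \<Rightarrow> ('a, 'n) chart \<Rightarrow> complex ^ 'n \<Rightarrow> complex ^ 'n" where
  "transition c c' = snd c' \<circ> chart_inv c"

definition holomorphic_atlas :: "'a topology \<Rightarrow> ('a, 'n::finite) chart set \<Rightarrow> bool" where
  "holomorphic_atlas X A \<longleftrightarrow>
     (\<forall>c\<in>A. openin X (fst c) \<and> open (chart_range c) \<and>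
        homeomorphic_map (subtopology X (fst c)) (top_of_set (chart_range c)) (snd c)) \<and>
     (\<Union>c\<in>A. fst c) = topspace X \<and>
     (\<forall>c\<in>A. \<forall>c'\<in>A. holomorphic_map_on (overlap c c') (transition c c'))"

text \<open>Second countability is automatic for a compact space with such an atlas. The atlas need not
  be maximal.\<close>

definition compact_complex_manifold :: "'a topology \<Rightarrow> ('a, 'n::finite) chart set \<Rightarrow> bool" where
  "compact_complex_manifold X A \<longleftrightarrow>
     Hausdorff_space X \<and> compact_space X \<and> holomorphic_atlas X A"


section \<open>Exterior algebra of \<open>\<complex>\<^sup>n\<close>\<close>

text \<open>A complex-valued alternating \<open>k\<close>-form on (the real vector space) \<open>\<complex>\<^sup>n\<close> is a function of
  \<open>k\<close> vectors, passed as the values at \<open>0, \<dots>, k - 1\<close> of a sequence of vectors; the later values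
  are ignored.\<close>

type_synonym 'n covector = "(nat \<Rightarrow> complex ^ 'n) \<Rightarrow> complex"

text \<open>\<open>\<theta>\<^sub>0 \<and> \<dots> \<and> \<theta>\<^bsub>k-1\<^esub>\<close>, normalised as the determinant of the \<open>\<theta>\<^sub>i (v\<^sub>j)\<close>.\<close>

definition wedge_functionals ::
    "nat \<Rightarrow> (nat \<Rightarrow> complex ^ 'n::finite \<Rightarrow> complex) \<Rightarrow> 'n covector" where
  "wedge_functionals k \<theta> v =
     (\<Sum>\<sigma> | \<sigma> permutes {..<k}. of_int (sign \<sigma>) * (\<Prod>i<k. \<theta> i (v (\<sigma> i))))"

text \<open>\<open>dz\<^sub>I \<and> d\<zeta>\<^sub>J\<close>, where \<open>\<zeta>\<close> is the conjugate of \<open>z\<close>, for multi-indices \<open>I\<close> and \<open>J\<close>.\<close>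

definition dz_dzbar :: "'n::finite list \<Rightarrow> 'n list \<Rightarrow> 'n covector" where
  "dz_dzbar I J = wedge_functionals (length I + length J)
     (\<lambda>i w. if i < length I then w $ (I ! i) else cnj (w $ (J ! (i - length I))))"

definition is_pq_covector :: "nat \<Rightarrow> nat \<Rightarrow> 'n::finite covector \<Rightarrow> bool" where
  "is_pq_covector p q \<eta> \<longleftrightarrow>
     (\<exists>f. \<eta> = (\<lambda>v. \<Sum>I | length I = p. \<Sum>J | length J = q. f I J * dz_dzbar I J v))"

definition wedge_covectors ::
    "nat \<Rightarrow> nat \<Rightarrow> 'n::finite covector \<Rightarrow> 'n covector \<Rightarrow> 'n covector" where
  "wedge_covectors k l \<alpha> \<beta> v =
     (\<Sum>\<sigma> | \<sigma> permutes {..<k + l}.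
        of_int (sign \<sigma>) * \<alpha> (\<lambda>i. v (\<sigma> i)) * \<beta> (\<lambda>i. v (\<sigma> (k + i)))) / (fact k * fact l)"

text \<open>The real basis \<open>e\<^sub>1, \<i> e\<^sub>1, \<dots>, e\<^sub>n, \<i> e\<^sub>n\<close> of \<open>\<complex>\<^sup>n\<close>, which is positive for the complex
  orientation. Permuting the \<open>e\<^sub>j\<close> is an even permutation of the basis, so the value of a top-degree
  form on it does not depend on the chosen enumeration of the coordinates.\<close>

definition coord_list :: "'n::finite list" where
  "coord_list = (SOME xs. distinct xs \<and> set xs = UNIV)"

definition real_frame :: "nat \<Rightarrow> complex ^ 'n::finite" where
  "real_frame j = axis (coord_list ! (j div 2)) (if even j then 1 else \<i>)"


section \<open>The double complex of smooth forms\<close>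

text \<open>The complex-linear and the conjugate-linear part of the differential of a function \<open>f\<close>:
  the values on \<open>w\<close> of \<open>\<Sum>\<^sub>j (\<partial>f/\<partial>z\<^sub>j) dz\<^sub>j\<close> and of \<open>\<Sum>\<^sub>j (\<partial>f/\<partial>\<zeta>\<^sub>j) d\<zeta>\<^sub>j\<close>.\<close>

definition D10 ::
    "(complex ^ 'n::finite \<Rightarrow> complex) \<Rightarrow> complex ^ 'n \<Rightarrow> complex ^ 'n \<Rightarrow> complex" where
  "D10 f z w =
     (frechet_derivative f (at z) w - \<i> * frechet_derivative f (at z) (\<i> *s w)) / 2"

definition D01 ::
    "(complex ^ 'n::finite \<Rightarrow> complex) \<Rightarrow> complex ^ 'n \<Rightarrow> complex ^ 'n \<Rightarrow> complex" where
  "D01 f z w =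
     (frechet_derivative f (at z) w + \<i> * frechet_derivative f (at z) (\<i> *s w)) / 2"

definition omit :: "nat \<Rightarrow> (nat \<Rightarrow> 'v) \<Rightarrow> nat \<Rightarrow> 'v" where
  "omit i v j = (if j < i then v j else v (Suc j))"

text \<open>A form on the manifold is given by its local expressions in the charts of the atlas. It is set
  to \<open>0\<close> where these are meaningless, so that equal forms are equal functions.\<close>

type_synonym ('a, 'n) form = "('a, 'n) chart \<Rightarrow> complex ^ 'n \<Rightarrow> 'n covector"

definition forms :: "('a, 'n::finite) chart set \<Rightarrow> nat \<Rightarrow> nat \<Rightarrow> ('a, 'n) form set" where
  "forms A p q = {\<omega>.
     (\<forall>c\<in>A. \<forall>z\<in>chart_range c. is_pq_covector p q (\<omega> c z)) \<and>
     (\<forall>c\<in>A. \<forall>v. smooth_on (chart_range c) (\<lambda>z. \<omega> c z v)) \<and>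
     (\<forall>c\<in>A. \<forall>c'\<in>A. \<forall>z\<in>overlap c c'. \<forall>v.
        \<omega> c z v =
        \<omega> c' (transition c c' z) (\<lambda>i. frechet_derivative (transition c c') (at z) (v i))) \<and>
     (\<forall>c z. c \<notin> A \<or> z \<notin> chart_range c \<longrightarrow> \<omega> c z = 0)}"

text \<open>In coordinates, for \<open>\<omega> = \<Sum> f\<^sub>I\<^sub>J dz\<^sub>I \<and> d\<zeta>\<^sub>J\<close> of total degree \<open>k\<close>, these are
  \<open>\<partial>\<omega> = \<Sum> \<partial>f\<^sub>I\<^sub>J \<and> dz\<^sub>I \<and> d\<zeta>\<^sub>J\<close> and its conjugate counterpart: a wedge product with a functional on the
  left is an alternating sum over the vector inserted into that functional.\<close>

definition del :: "('a, 'n::finite) chart set \<Rightarrow> nat \<Rightarrow> ('a, 'n) form \<Rightarrow> ('a, 'n) form" where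
  "del A k \<omega> c z v =
     (if c \<in> A \<and> z \<in> chart_range c
      then \<Sum>i\<le>k. (- 1) ^ i * D10 (\<lambda>y. \<omega> c y (omit i v)) z (v i) else 0)"

definition delbar :: "('a, 'n::finite) chart set \<Rightarrow> nat \<Rightarrow> ('a, 'n) form \<Rightarrow> ('a, 'n) form" where
  "delbar A k \<omega> c z v =
     (if c \<in> A \<and> z \<in> chart_range c
      then \<Sum>i\<le>k. (- 1) ^ i * D01 (\<lambda>y. \<omega> c y (omit i v)) z (v i) else 0)"

definition wedge :: "nat \<Rightarrow> nat \<Rightarrow> ('a, 'n::finite) form \<Rightarrow> ('a, 'n) form \<Rightarrow> ('a, 'n) form" where
  "wedge k l \<alpha> \<beta> c z = wedge_covectors k l (\<alpha> c z) (\<beta> c z)"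


section \<open>Integration of top-degree forms\<close>

definition partition_of_unity ::
    "'a topology \<Rightarrow> ('a, 'n::finite) chart set \<Rightarrow> ('a, 'n) chart set \<Rightarrow>
     (('a, 'n) chart \<Rightarrow> 'a \<Rightarrow> real) \<Rightarrow> bool" where
  "partition_of_unity X A C \<rho> \<longleftrightarrow>
     finite C \<and> C \<subseteq> A \<and>
     (\<forall>c\<in>C. \<forall>c'\<in>A. smooth_on (chart_range c') (\<rho> c \<circ> chart_inv c')) \<and>
     (\<forall>c\<in>C. \<forall>x\<in>topspace X. 0 \<le> \<rho> c x) \<and>
     (\<forall>c\<in>C. X closure_of {x \<in> topspace X. \<rho> c x \<noteq> 0} \<subseteq> fst c) \<and>
     (\<forall>x\<in>topspace X. (\<Sum>c\<in>C. \<rho> c x) = 1)"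

text \<open>On a compact manifold a partition of unity exists, and the integral does not depend on the one
  chosen here. The Lebesgue measure \<open>lborel\<close> on \<open>complex ^ 'n\<close> is \<open>dx\<^sub>1 dy\<^sub>1 \<dots> dx\<^sub>n dy\<^sub>n\<close>.\<close>

definition form_integral ::
    "'a topology \<Rightarrow> ('a, 'n::finite) chart set \<Rightarrow> ('a, 'n) form \<Rightarrow> complex" where
  "form_integral X A \<omega> =
     (let (C, \<rho>) = (SOME (C, \<rho>). partition_of_unity X A C \<rho>) in
        \<Sum>c\<in>C. (LINT z:chart_range c|lborel. \<rho> c (chart_inv c z) *\<^sub>R \<omega> c z real_frame))"


section \<open>Bott--Chern and Aeppli cohomology\<close>

definition im_del :: "('a, 'n::finite) chart set \<Rightarrow> nat \<Rightarrow> nat \<Rightarrow> ('a, 'n) form set" where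
  "im_del A p q = (if p = 0 then {0} else del A (p - 1 + q) ` forms A (p - 1) q)"

definition im_delbar :: "('a, 'n::finite) chart set \<Rightarrow> nat \<Rightarrow> nat \<Rightarrow> ('a, 'n) form set" where
  "im_delbar A p q = (if q = 0 then {0} else delbar A (p + (q - 1)) ` forms A p (q - 1))"

definition im_del_delbar :: "('a, 'n::finite) chart set \<Rightarrow> nat \<Rightarrow> nat \<Rightarrow> ('a, 'n) form set" where
  "im_del_delbar A p q =
     (if p = 0 \<or> q = 0 then {0}
      else (\<lambda>\<gamma>. del A (p - 1 + q) (delbar A (p - 1 + (q - 1)) \<gamma>)) ` forms A (p - 1) (q - 1))"

definition bc_class ::
    "('a, 'n::finite) chart set \<Rightarrow> nat \<Rightarrow> nat \<Rightarrow> ('a, 'n) form \<Rightarrow> ('a, 'n) form set" where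
  "bc_class A p q \<alpha> = {\<alpha> + \<beta> | \<beta>. \<beta> \<in> im_del_delbar A p q}"

definition bott_chern ::
    "('a, 'n::finite) chart set \<Rightarrow> nat \<Rightarrow> nat \<Rightarrow> ('a, 'n) form set set" where
  "bott_chern A p q =
     bc_class A p q ` {\<alpha> \<in> forms A p q. del A (p + q) \<alpha> = 0 \<and> delbar A (p + q) \<alpha> = 0}"

definition aeppli_class ::
    "('a, 'n::finite) chart set \<Rightarrow> nat \<Rightarrow> nat \<Rightarrow> ('a, 'n) form \<Rightarrow> ('a, 'n) form set" where
  "aeppli_class A p q \<alpha> =
     {\<alpha> + (\<beta> + \<gamma>) | \<beta> \<gamma>. \<beta> \<in> im_del A p q \<and> \<gamma> \<in> im_delbar A p q}"

definition aeppli ::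
    "('a, 'n::finite) chart set \<Rightarrow> nat \<Rightarrow> nat \<Rightarrow> ('a, 'n) form set set" where
  "aeppli A p q =
     aeppli_class A p q ` {\<alpha> \<in> forms A p q. del A (p + q + 1) (delbar A (p + q) \<alpha>) = 0}"

text \<open>The maps induced on classes take the common value (\<open>the_elem\<close>) over all representatives.\<close>

definition bc_to_aeppli ::
    "('a, 'n::finite) chart set \<Rightarrow> nat \<Rightarrow> nat \<Rightarrow> ('a, 'n) form set \<Rightarrow> ('a, 'n) form set" where
  "bc_to_aeppli A p q a = the_elem (aeppli_class A p q ` a)"

definition bc_pairing_pq ::
    "'a topology \<Rightarrow> ('a, 'n::finite) chart set \<Rightarrow> nat \<Rightarrow> nat \<Rightarrow>
     ('a, 'n) form set \<Rightarrow> ('a, 'n) form set \<Rightarrow> complex" where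
  "bc_pairing_pq X A p q a b =
     (let n = CARD('n) in
        the_elem ((\<lambda>(\<alpha>, \<beta>). form_integral X A (wedge (p + q) ((n - p) + (n - q)) \<alpha> \<beta>)) ` (a \<times> b)))"

text \<open>Elements of the total space are families of homogeneous components. There are only finitely
  many non-zero ones, since \<open>bott_chern A p q\<close> is trivial for \<open>p > n\<close> or \<open>q > n\<close>.\<close>

definition bott_chern_total ::
    "('a, 'n::finite) chart set \<Rightarrow> (nat \<Rightarrow> nat \<Rightarrow> ('a, 'n) form set) set" where
  "bott_chern_total A = {a. \<forall>p q. a p q \<in> bott_chern A p q}"

definition bott_chern_zero ::
    "('a, 'n::finite) chart set \<Rightarrow> nat \<Rightarrow> nat \<Rightarrow> ('a, 'n) form set" where
  "bott_chern_zero A p q = bc_class A p q 0"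

text \<open>The \<open>(n,n)\<close>-component of \<open>\<alpha> \<and> \<beta>\<close> is the sum of the \<open>\<alpha>\<^bsup>p,q\<^esup> \<and> \<beta>\<^bsup>n-p,n-q\<^esup>\<close>.\<close>

definition bc_pairing ::
    "'a topology \<Rightarrow> ('a, 'n::finite) chart set \<Rightarrow>
     (nat \<Rightarrow> nat \<Rightarrow> ('a, 'n) form set) \<Rightarrow> (nat \<Rightarrow> nat \<Rightarrow> ('a, 'n) form set) \<Rightarrow> complex" where
  "bc_pairing X A a b =
     (let n = CARD('n) in
        \<Sum>p\<le>n. \<Sum>q\<le>n. bc_pairing_pq X A p q (a p q) (b (n - p) (n - q)))"

definition schweitzer_qualitative :: "'a topology \<Rightarrow> ('a, 'n::finite) chart set \<Rightarrow> bool" where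
  "schweitzer_qualitative X A \<longleftrightarrow>
     (\<forall>a\<in>bott_chern_total A.
        (\<forall>b\<in>bott_chern_total A. bc_pairing X A a b = 0) \<longrightarrow> a = bott_chern_zero A) \<and>
     (\<forall>b\<in>bott_chern_total A.
        (\<forall>a\<in>bott_chern_total A. bc_pairing X A a b = 0) \<longrightarrow> b = bott_chern_zero A)"

definition del_delbar_lemma :: "('a, 'n::finite) chart set \<Rightarrow> bool" where
  "del_delbar_lemma A \<longleftrightarrow>
     (\<forall>p q. bc_to_aeppli A p q \<in> bott_chern A p q \<rightarrow> aeppli A p q \<and>
            inj_on (bc_to_aeppli A p q) (bott_chern A p q))"

end

theory Submission
  imports Defs "HOL-Library.Numeral_Type"
begin

text \<open>Let \<open>\<alpha>\<close> be a Bott--Chern cocycle whose Aeppli class vanishes, say \<open>\<alpha> = \<partial>\<beta> + \<partial>'\<gamma>\<close>, where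
  \<open>\<partial>'\<close> is the conjugate of \<open>\<partial>\<close>. For every Bott--Chern cocycle \<open>\<alpha>'\<close> of complementary type,
  \<open>\<alpha> \<and> \<alpha>' = \<partial>(\<beta> \<and> \<alpha>') + \<partial>'(\<gamma> \<and> \<alpha>')\<close> integrates to zero by Stokes' theorem, so that
  \<open>\<alpha>\<close> is in the kernel of the pairing and its Bott--Chern class vanishes.

  Stokes' theorem is proved for \<open>\<partial>\<close> and \<open>\<partial>'\<close> separately. With a partition of unity \<open>\<rho>\<^sub>c\<close>,
  the integral of \<open>\<partial>\<eta>\<close> is the sum over the charts \<open>c\<close> of \<open>\<integral> \<partial>(\<rho>\<^sub>c \<eta>) - \<integral> \<partial>\<rho>\<^sub>c \<and> \<eta>\<close>.
  The first integrals vanish by the translation invariance of Lebesgue measure; the second ones add up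
  to the integral of \<open>\<partial>1 \<and> \<eta> = 0\<close>, by change of variables. For the latter, the real Jacobian of a
  holomorphic map has to be positive.

  Alternating forms are treated as antisymmetrizations over all permutations of the arguments, and
  forms of type \<open>(p,q)\<close> as those on which a complex scalar \<open>a\<close> acts on the arguments through the factor
  \<open>a\<^sup>p\<close> times the \<open>q\<close>-th power of the conjugate of \<open>a\<close>; this makes the behaviour of
  \<open>\<partial>\<close> on types and under holomorphic maps a formal matter.\<close>

section \<open>Smooth functions\<close>

text \<open>The terms \<open>\<partial>\<rho>\<^sub>c \<and> \<eta>\<close> are integrated in
  different charts, so they cannot be added as they stand. A second factor
  \<open>1 = \<Sum>\<^sub>d \<rho>\<^sub>d\<close> cuts each of them into pieces with compact
  support in an overlap; a piece is carried to the chart \<open>d\<close>, and there the sum over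
  \<open>c\<close> is taken under the integral. Treating \<partial> and \<partial>' separately suits
  the two primitives, which have different types: with the full differential one would first have to
  argue that the unwanted half vanishes by type. The pairing of classes is a \<open>the_elem\<close>
  over all pairs of representatives, so the integral must vanish for every pair at once. It does:
  adding an element of the image of \<partial>\<partial>' to
  \<open>\<partial>\<beta> + \<partial>'\<gamma>\<close> leaves a form of the same shape, and every
  representative of the other class is again closed for both operators.\<close>

lemma frechet_derivative_cong_open:
  assumes "open S" "x \<in> S" "\<And>y. y \<in> S \<Longrightarrow> f y = g y"
  shows "frechet_derivative f (at x) = frechet_derivative g (at x)"
    and "f differentiable (at x) \<longleftrightarrow> g differentiable (at x)"
proof -
  have *: "(f has_derivative D) (at x) \<longleftrightarrow> (g has_derivative D) (at x)" for D
    by (rule iffI; erule has_derivative_transform_within_open[OF _ assms(1,2)]) (simp_all add: assms(3))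
  show "frechet_derivative f (at x) = frechet_derivative g (at x)"
    by (simp add: frechet_derivative_def *)
  show "f differentiable (at x) \<longleftrightarrow> g differentiable (at x)"
    by (simp add: differentiable_def *)
qed

section \<open>Calculus of maps of class C^k\<close>

lemma Ck_on_cong:
  assumes "open S" "\<And>x. x \<in> S \<Longrightarrow> f x = g x"
  shows "Ck_on k S f \<longleftrightarrow> Ck_on k S g"
  using assms(2)
proof (induction k arbitrary: f g)
  case 0
  then show ?case by (simp cong: continuous_on_cong)
next
  case (Suc k)
  have d: "frechet_derivative f (at x) = frechet_derivative g (at x)"
    "f differentiable (at x) \<longleftrightarrow> g differentiable (at x)" if "x \<in> S" for x
    using frechet_derivative_cong_open[OF assms(1) that Suc.prems] by auto
  have "Ck_on k S (\<lambda>x. frechet_derivative f (at x) v) = Ck_on k S (\<lambda>x. frechet_derivative g (at x) v)" for v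
    by (rule Suc.IH) (simp add: d)
  then show ?case by (simp add: d)
qed

lemma Ck_on_Suc_imp: "Ck_on (Suc k) S f \<Longrightarrow> Ck_on k S f"
proof (induction k arbitrary: f)
  case 0
  then show ?case
    by (auto intro!: continuous_at_imp_continuous_on differentiable_imp_continuous_within)
next
  case (Suc k)
  then show ?case by (metis Ck_on.simps(2))
qed

lemma Ck_on_le: "Ck_on l S f \<Longrightarrow> k \<le> l \<Longrightarrow> Ck_on k S f"
  by (induction l) (auto simp del: Ck_on.simps simp: le_Suc_eq intro: Ck_on_Suc_imp)

text \<open>Derivatives are taken in the full filter \<open>at x\<close>, never within a set, so
  each clause of \<open>Ck_on\<close> can be checked on a neighbourhood. This is how functions
  extended by zero are shown to be smooth.\<close>

lemma Ck_on_locally: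
  assumes "\<And>x. x \<in> S \<Longrightarrow> \<exists>U. open U \<and> x \<in> U \<and> Ck_on k U f"
  shows "Ck_on k S f"
  using assms
proof (induction k arbitrary: f)
  case 0
  then show ?case
    by (auto intro!: continuous_at_imp_continuous_on) (metis continuous_on_eq_continuous_at)
next
  case (Suc k)
  have "f differentiable at x" if "x \<in> S" for x
    using Suc.prems[OF that] by auto
  moreover have "Ck_on k S (\<lambda>x. frechet_derivative f (at x) v)" for v
    by (rule Suc.IH) (use Suc.prems in fastforce)
  ultimately show ?case by simp
qed

lemma frechet_derivative_eq:
  "(f has_derivative D) (at x) \<Longrightarrow> frechet_derivative f (at x) = D"
  by (metis frechet_derivative_at)

text \<open>Inductions go through this rule: it accepts any formula \<open>D\<close> for the
  derivative, which agrees with \<open>frechet_derivative\<close> on all of the open set and may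
  therefore replace it under \<open>Ck_on\<close>.\<close>

lemma Ck_on_SucI:
  assumes "open S"
    and "\<And>x. x \<in> S \<Longrightarrow> (f has_derivative D x) (at x)"
    and "\<And>v. Ck_on k S (\<lambda>x. D x v)"
  shows "Ck_on (Suc k) S f"
proof -
  have "Ck_on k S (\<lambda>x. frechet_derivative f (at x) v)" for v
    using Ck_on_cong[OF assms(1), of "\<lambda>x. frechet_derivative f (at x) v" "\<lambda>x. D x v"]
      frechet_derivative_eq[OF assms(2)] assms(3) by simp
  with assms(2) show ?thesis by (auto simp: differentiable_def)
qed

lemma Ck_on_has_derivative:
  "Ck_on (Suc k) S f \<Longrightarrow> x \<in> S \<Longrightarrow> (f has_derivative frechet_derivative f (at x)) (at x)"
  by (simp add: frechet_derivative_works)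

lemma Ck_on_frechet_derivative:
  "Ck_on (Suc k) S f \<Longrightarrow> Ck_on k S (\<lambda>x. frechet_derivative f (at x) v)"
  by simp

lemma Ck_on_const: "open S \<Longrightarrow> Ck_on k S (\<lambda>x. c)"
proof (induction k arbitrary: c)
  case (Suc k)
  show ?case by (rule Ck_on_SucI[OF Suc.prems, where D="\<lambda>_ _. 0"]) (use Suc in auto)
qed simp

lemma Ck_on_add:
  assumes "open S" "Ck_on k S f" "Ck_on k S g"
  shows "Ck_on k S (\<lambda>x. f x + g x)"
  using assms(2,3)
proof (induction k arbitrary: f g)
  case (Suc k)
  show ?case
    by (rule Ck_on_SucI[OF assms(1) has_derivative_add[OF Ck_on_has_derivative Ck_on_has_derivative]])
      (use Suc in \<open>auto\<close>)
qed (auto intro: continuous_intros)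

lemma Ck_on_sum:
  assumes "open S" "\<And>i. i \<in> I \<Longrightarrow> Ck_on k S (f i)"
  shows "Ck_on k S (\<lambda>x. \<Sum>i\<in>I. f i x)"
  using assms(2)
  by (induction I rule: infinite_finite_induct) (auto intro: Ck_on_const Ck_on_add assms(1))

lemma Ck_on_bounded_linear:
  assumes "open S" "bounded_linear h" "Ck_on k S f"
  shows "Ck_on k S (\<lambda>x. h (f x))"
  using assms(3)
proof (induction k arbitrary: f)
  case 0
  then show ?case using bounded_linear.continuous_on[OF assms(2)] by simp
next
  case (Suc k)
  show ?case
    by (rule Ck_on_SucI[OF assms(1) bounded_linear.has_derivative[OF assms(2) Ck_on_has_derivative]])
      (use Suc in \<open>auto\<close>)
qed

lemma Ck_on_linear:
  assumes "open S" "bounded_linear h"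
  shows "Ck_on k S h"
proof (cases k)
  case (Suc l)
  show ?thesis unfolding Suc
    by (rule Ck_on_SucI[OF assms(1) bounded_linear_imp_has_derivative[OF assms(2)]])
      (simp add: Ck_on_const assms(1))
qed (simp add: assms linear_continuous_on)

lemma Ck_on_bilinear:
  assumes "open S" "bounded_bilinear pr" "Ck_on k S f" "Ck_on k S g"
  shows "Ck_on k S (\<lambda>x. pr (f x) (g x))"
  using assms(3,4)
proof (induction k arbitrary: f g)
  case 0
  then show ?case using bounded_bilinear.continuous_on[OF assms(2)] by simp
next
  case (Suc k)
  have "Ck_on k S (\<lambda>x. pr (f x) (frechet_derivative g (at x) v))"
    "Ck_on k S (\<lambda>x. pr (frechet_derivative f (at x) v) (g x))" for v
    using Suc.prems by (auto simp del: Ck_on.simps intro!: Suc.IH Ck_on_frechet_derivative dest: Ck_on_Suc_imp)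
  then have "Ck_on k S (\<lambda>x. pr (f x) (frechet_derivative g (at x) v) + pr (frechet_derivative f (at x) v) (g x))" for v
    by (rule Ck_on_add[OF assms(1)])
  moreover have "((\<lambda>x. pr (f x) (g x)) has_derivative
      (\<lambda>v. pr (f x) (frechet_derivative g (at x) v) + pr (frechet_derivative f (at x) v) (g x))) (at x)"
    if "x \<in> S" for x
    by (rule bounded_bilinear.FDERIV[OF assms(2) Ck_on_has_derivative[OF Suc.prems(1) that]
        Ck_on_has_derivative[OF Suc.prems(2) that]])
  ultimately show ?case by (intro Ck_on_SucI[OF assms(1)])
qed

lemma Ck_on_mult:
  fixes f g :: "'a::real_normed_vector \<Rightarrow> 'b::real_normed_algebra"
  assumes "open S" "Ck_on k S f" "Ck_on k S g"
  shows "Ck_on k S (\<lambda>x. f x * g x)"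
  by (rule Ck_on_bilinear[OF assms(1) bounded_bilinear_mult assms(2,3)])

lemmas Ck_on_scaleR = Ck_on_bilinear[OF _ bounded_bilinear_scaleR]
lemmas Ck_on_inner_left = Ck_on_bounded_linear[OF _ bounded_linear_inner_left]
lemmas Ck_on_minus = Ck_on_bounded_linear[OF _ bounded_linear_minus[OF bounded_linear_ident]]

lemma Ck_on_prod:
  fixes f :: "'i \<Rightarrow> 'a::real_normed_vector \<Rightarrow> 'b::real_normed_field"
  assumes "open S" "\<And>i. i \<in> I \<Longrightarrow> Ck_on k S (f i)"
  shows "Ck_on k S (\<lambda>x. \<Prod>i\<in>I. f i x)"
  using assms(2)
  by (induction I rule: infinite_finite_induct) (auto intro: Ck_on_const Ck_on_mult assms(1))

lemma linear_Basis_expansion: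
  fixes D :: "'a::euclidean_space \<Rightarrow> 'b::real_vector"
  assumes "linear D"
  shows "D v = (\<Sum>b\<in>Basis. (v \<bullet> b) *\<^sub>R D b)"
  using linear_sum[OF assms, of "\<lambda>b. (v \<bullet> b) *\<^sub>R b" Basis]
  by (simp add: linear_cmul[OF assms] euclidean_representation)

text \<open>\<open>Ck_on\<close> differentiates in fixed directions, but the chain rule
  differentiates \<open>f\<close> in a direction that moves with \<open>x\<close>. Expanding that
  direction in \<open>Basis\<close> leaves fixed directions with C^k coefficients; hence the
  Euclidean domain of \<open>f\<close>.\<close>

lemma Ck_on_compose:
  fixes f :: "'b::euclidean_space \<Rightarrow> 'c::real_normed_vector"
  assumes "open S" "open T" "Ck_on k T f" "Ck_on k S g" "g ` S \<subseteq> T"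
  shows "Ck_on k S (\<lambda>x. f (g x))"
  using assms(3,4)
proof (induction k arbitrary: f)
  case 0
  then show ?case using continuous_on_compose2[of T f S g] assms(5) by simp
next
  case (Suc k)
  let ?D = "\<lambda>x v. frechet_derivative f (at (g x)) (frechet_derivative g (at x) v)"
  have 1: "((\<lambda>x. f (g x)) has_derivative ?D x) (at x)" if "x \<in> S" for x
    using that assms(5)
    by (intro has_derivative_compose[where g=f, OF Ck_on_has_derivative[OF Suc.prems(2)] Ck_on_has_derivative[OF Suc.prems(1)]]) auto
  have lin: "linear (frechet_derivative f (at (g x)))" if "x \<in> S" for x
    using Suc.prems that assms(5) by (auto intro!: linear_frechet_derivative)
  have 2: "?D x v = (\<Sum>b\<in>Basis. (frechet_derivative g (at x) v \<bullet> b) *\<^sub>R frechet_derivative f (at (g x)) b)"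
    if "x \<in> S" for x v
    by (rule linear_Basis_expansion[OF lin[OF that]])
  have 3: "Ck_on k S (\<lambda>x. frechet_derivative f (at (g x)) b)" for b
    by (rule Suc.IH[OF Ck_on_frechet_derivative[OF Suc.prems(1)] Ck_on_Suc_imp[OF Suc.prems(2)]])
  have "Ck_on k S (\<lambda>x. \<Sum>b\<in>Basis. (frechet_derivative g (at x) v \<bullet> b) *\<^sub>R frechet_derivative f (at (g x)) b)" for v
    by (intro Ck_on_sum assms(1) Ck_on_scaleR Ck_on_inner_left Ck_on_frechet_derivative[OF Suc.prems(2)] 3)
  then have "Ck_on k S (\<lambda>x. ?D x v)" for v
    using Ck_on_cong[OF assms(1) 2] by simp
  then show ?case by (intro Ck_on_SucI[OF assms(1) 1])
qed

text \<open>The derivative of \<open>inverse\<close> is polynomial in \<open>inverse\<close>, so the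
  induction hypothesis for the function itself suffices.\<close>

lemma Ck_on_inverse:
  "Ck_on k (- {0}) (inverse :: real \<Rightarrow> real)"
proof (induction k)
  case 0
  then show ?case by (auto intro!: continuous_intros)
next
  case (Suc k)
  have "Ck_on k (- {0}) (\<lambda>x::real. - (inverse x * v * inverse x))" for v
    by (intro Ck_on_minus Ck_on_mult Suc Ck_on_const)
      auto
  then show ?case
    by (intro Ck_on_SucI[OF _ has_derivative_inverse']) auto
qed

lemma smooth_onD: "smooth_on S f \<Longrightarrow> Ck_on k S f"
  by (simp add: smooth_on_def)

lemma smooth_on_differentiable: "smooth_on S f \<Longrightarrow> x \<in> S \<Longrightarrow> f differentiable (at x)"
  using smooth_onD[of S f 1] by simp

lemma smooth_on_has_derivative:
  "smooth_on S f \<Longrightarrow> x \<in> S \<Longrightarrow> (f has_derivative frechet_derivative f (at x)) (at x)"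
  using smooth_on_differentiable frechet_derivative_works by blast

lemma smooth_on_frechet_derivative:
  "smooth_on S f \<Longrightarrow> smooth_on S (\<lambda>x. frechet_derivative f (at x) v)"
  unfolding smooth_on_def using Ck_on_frechet_derivative by blast

lemma smooth_on_imp_continuous_on: "smooth_on S f \<Longrightarrow> continuous_on S f"
  using smooth_onD[of S f 0] by simp

lemma smooth_on_cong: "open S \<Longrightarrow> (\<And>x. x \<in> S \<Longrightarrow> f x = g x) \<Longrightarrow> smooth_on S f \<longleftrightarrow> smooth_on S g"
  unfolding smooth_on_def using Ck_on_cong by blast

lemma smooth_on_locally:
  "(\<And>x. x \<in> S \<Longrightarrow> \<exists>U. open U \<and> x \<in> U \<and> smooth_on U f) \<Longrightarrow> smooth_on S f"
  unfolding smooth_on_def by (intro allI Ck_on_locally) blast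

lemma smooth_on_const: "open S \<Longrightarrow> smooth_on S (\<lambda>x. c)"
  by (simp add: smooth_on_def Ck_on_const)

lemma smooth_on_add: "open S \<Longrightarrow> smooth_on S f \<Longrightarrow> smooth_on S g \<Longrightarrow> smooth_on S (\<lambda>x. f x + g x)"
  by (simp add: smooth_on_def Ck_on_add)

lemma smooth_on_sum:
  "open S \<Longrightarrow> (\<And>i. i \<in> I \<Longrightarrow> smooth_on S (f i)) \<Longrightarrow> smooth_on S (\<lambda>x. \<Sum>i\<in>I. f i x)"
  by (simp add: smooth_on_def Ck_on_sum)

lemma smooth_on_bounded_linear:
  "open S \<Longrightarrow> bounded_linear h \<Longrightarrow> smooth_on S f \<Longrightarrow> smooth_on S (\<lambda>x. h (f x))"
  by (simp add: smooth_on_def Ck_on_bounded_linear)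

lemma smooth_on_bilinear:
  "open S \<Longrightarrow> bounded_bilinear pr \<Longrightarrow> smooth_on S f \<Longrightarrow> smooth_on S g \<Longrightarrow> smooth_on S (\<lambda>x. pr (f x) (g x))"
  by (simp add: smooth_on_def Ck_on_bilinear)

lemma smooth_on_mult:
  fixes f g :: "'a::real_normed_vector \<Rightarrow> 'b::real_normed_algebra"
  shows "open S \<Longrightarrow> smooth_on S f \<Longrightarrow> smooth_on S g \<Longrightarrow> smooth_on S (\<lambda>x. f x * g x)"
  by (simp add: smooth_on_def Ck_on_mult)

lemmas smooth_on_inner = smooth_on_bilinear[OF _ bounded_bilinear_inner]
lemmas smooth_on_minus = smooth_on_bounded_linear[OF _ bounded_linear_minus[OF bounded_linear_ident]]

lemma smooth_on_compose:
  fixes f :: "'b::euclidean_space \<Rightarrow> 'c::real_normed_vector"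
  shows "open S \<Longrightarrow> open T \<Longrightarrow> smooth_on T f \<Longrightarrow> smooth_on S g \<Longrightarrow> g ` S \<subseteq> T \<Longrightarrow>
    smooth_on S (\<lambda>x. f (g x))"
  unfolding smooth_on_def using Ck_on_compose by blast

lemma smooth_on_divide:
  fixes f g :: "'a::real_normed_vector \<Rightarrow> real"
  assumes "open S" "smooth_on S f" "smooth_on S g" "\<And>x. x \<in> S \<Longrightarrow> g x \<noteq> 0"
  shows "smooth_on S (\<lambda>x. f x / g x)"
proof -
  have "smooth_on S (\<lambda>x. inverse (g x))"
    by (rule smooth_on_compose[where T="- {0}" and f=inverse and g=g])
      (use assms Ck_on_inverse in \<open>auto simp: smooth_on_def\<close>)
  with assms have "smooth_on S (\<lambda>x. f x * inverse (g x))"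
    by (intro smooth_on_mult)
  then show ?thesis by (simp add: divide_inverse)
qed

subsection \<open>A bump function\<close>

text \<open>The case \<open>m = 0\<close> is the function of interest. The powers of
  \<open>t\<close> make the family closed under differentiation, so that its smoothness is one
  induction for all \<open>m\<close> together.\<close>

definition bump_profile :: "nat \<Rightarrow> real \<Rightarrow> real" where
  "bump_profile m t = (if t > 0 then exp (- (1 / t)) / t ^ m else 0)"

lemma bump_profile_tendsto: "((bump_profile m) \<longlongrightarrow> 0) (at 0)"
proof -
  have "((\<lambda>x::real. x ^ m / exp x) \<longlongrightarrow> 0) at_top"
    by (rule tendsto_power_div_exp_0)
  then have "((\<lambda>t::real. (inverse t) ^ m / exp (inverse t)) \<longlongrightarrow> 0) (at_right 0)"
    by (rule filterlim_compose[OF _ filterlim_inverse_at_top_right])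
  then have r: "(bump_profile m \<longlongrightarrow> 0) (at_right 0)"
    by (rule Lim_transform_eventually)
      (auto simp: eventually_at_right_less bump_profile_def field_simps exp_minus eventually_at_topological
        intro!: eventually_at_rightI[of _ 1])
  have l: "(bump_profile m \<longlongrightarrow> 0) (at_left 0)"
    by (rule Lim_transform_eventually[OF tendsto_const])
      (auto simp: bump_profile_def intro!: eventually_at_leftI[of "-1"])
  show ?thesis using l r by (simp add: filterlim_split_at)
qed

lemma bump_profile_deriv:
  "(bump_profile m has_real_derivative bump_profile (m + 2) t - real m * bump_profile (m + 1) t) (at t)"
proof -
  consider "t > 0" | "t < 0" | "t = 0" by linarith
  then show ?thesis
  proof cases
    case 1
    have "((\<lambda>t. exp (- (1 / t)) / t ^ m) has_real_derivative
        bump_profile (m + 2) t - real m * bump_profile (m + 1) t) (at t)"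
      using 1 by (auto intro!: derivative_eq_intros simp: bump_profile_def divide_simps power2_eq_square)
        (cases m; auto simp: algebra_simps power2_eq_square)
    then show ?thesis
      by (rule has_field_derivative_transform_within_open[where S="{0<..}"]) (use 1 in \<open>auto simp: bump_profile_def\<close>)
  next
    case 2
    have "((\<lambda>t. 0) has_real_derivative 0) (at t)" by simp
    then have "(bump_profile m has_real_derivative 0) (at t)"
      by (rule has_field_derivative_transform_within_open[where S="{..<0}"]) (use 2 in \<open>auto simp: bump_profile_def\<close>)
    with 2 show ?thesis by (simp add: bump_profile_def)
  next
    case 3
    \<comment> \<open>The difference quotient at 0 is the next member of the family, whose limit at
      0 is known.\<close>
    have "bump_profile m t / t = bump_profile (m + 1) t" if "t \<noteq> 0" for t
      using that by (simp add: bump_profile_def)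
    then have "((\<lambda>t. bump_profile m t / t) \<longlongrightarrow> 0) (at 0)"
      using bump_profile_tendsto[of "m + 1"]
      by (subst tendsto_cong[where g="bump_profile (m + 1)"]) (auto simp: eventually_at_filter)
    with 3 show ?thesis by (simp add: has_field_derivative_iff bump_profile_def)
  qed
qed

lemma Ck_on_bump_profile: "Ck_on k UNIV (bump_profile m)"
proof (induction k arbitrary: m)
  case 0
  then show ?case
    by (auto intro!: continuous_at_imp_continuous_on DERIV_isCont[OF bump_profile_deriv])
next
  case (Suc k)
  have "Ck_on k UNIV (\<lambda>t. (bump_profile (m + 2) t + (- real m) * bump_profile (m + 1) t) * v)" for v
    by (intro Ck_on_mult Ck_on_add Ck_on_const Suc open_UNIV)
  then show ?case
    by (intro Ck_on_SucI[OF open_UNIV bump_profile_deriv[unfolded has_field_derivative_def]])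
       (simp)
qed

text \<open>The squared distance is used because it is smooth at the centre \<open>a\<close> as
  well.\<close>

definition bump :: "'v::euclidean_space \<Rightarrow> real \<Rightarrow> 'v \<Rightarrow> real" where
  "bump a r z = bump_profile 0 (r\<^sup>2 - (z - a) \<bullet> (z - a))"

lemma smooth_on_bump: "smooth_on UNIV (bump a r)"
proof -
  have 1: "smooth_on UNIV (\<lambda>z. z - a)"
    using smooth_on_add[OF open_UNIV _ smooth_on_const[OF open_UNIV, of "-a"], of "\<lambda>z. z"]
    by (simp add: smooth_on_def Ck_on_linear bounded_linear_ident)
  have "smooth_on UNIV (\<lambda>z. r\<^sup>2 + - ((z - a) \<bullet> (z - a)))"
    by (intro smooth_on_add smooth_on_const open_UNIV smooth_on_minus
        smooth_on_inner 1)
  then have "smooth_on UNIV (\<lambda>z. bump_profile 0 (r\<^sup>2 + - ((z - a) \<bullet> (z - a))))"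
    by (intro smooth_on_compose[where T=UNIV and f="bump_profile 0" and g="\<lambda>z. r\<^sup>2 + - ((z - a) \<bullet> (z - a))"])
      (simp_all add: smooth_on_def Ck_on_bump_profile)
  then show ?thesis by (simp add: bump_def[abs_def])
qed

lemma bump_nonneg: "0 \<le> bump a r z"
  by (simp add: bump_def bump_profile_def)

lemma bump_nonzero_iff: "r > 0 \<Longrightarrow> bump a r z \<noteq> 0 \<longleftrightarrow> z \<in> ball a r"
  using norm_lt_square[of "z - a" r]
  by (auto simp: bump_def bump_profile_def dist_norm norm_minus_commute)

subsection \<open>Symmetry of second derivatives\<close>

text \<open>The mean value theorem twice: along \<open>a\<close> for the increment of
  \<open>f\<close> in direction \<open>b\<close>, then along \<open>b\<close> for the derivative of
  \<open>f\<close> in direction \<open>a\<close>.\<close>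

lemma second_difference_real:
  fixes f :: "'a::real_normed_vector \<Rightarrow> real"
  assumes S: "open S" "Ck_on 2 S f"
    and h: "h > 0" and sub: "\<And>s t. 0 \<le> s \<Longrightarrow> s \<le> h \<Longrightarrow> 0 \<le> t \<Longrightarrow> t \<le> h \<Longrightarrow> z + s *\<^sub>R a + t *\<^sub>R b \<in> S"
  shows "\<exists>s t. 0 \<le> s \<and> s \<le> h \<and> 0 \<le> t \<and> t \<le> h \<and>
    f (z + h *\<^sub>R a + h *\<^sub>R b) - f (z + h *\<^sub>R a) - f (z + h *\<^sub>R b) + f z =
    h * h * frechet_derivative (\<lambda>y. frechet_derivative f (at y) a) (at (z + s *\<^sub>R a + t *\<^sub>R b)) b"
proof -
  let ?D = "\<lambda>y. frechet_derivative f (at y)"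
  let ?g = "\<lambda>s. f (z + s *\<^sub>R a + h *\<^sub>R b) - f (z + s *\<^sub>R a)"
  have C: "Ck_on (Suc (Suc 0)) S f" using S(2) by (simp only: numeral_2_eq_2)
  have dline: "((\<lambda>s. z + s *\<^sub>R a + t *\<^sub>R b) has_derivative (\<lambda>x. x *\<^sub>R a)) (at s)" for s t
    by (auto intro!: derivative_eq_intros)
  have dline': "((\<lambda>t. z + s *\<^sub>R a + t *\<^sub>R b) has_derivative (\<lambda>x. x *\<^sub>R b)) (at t)" for s t
    by (auto intro!: derivative_eq_intros)
  have d1: "((\<lambda>s. f (z + s *\<^sub>R a + t *\<^sub>R b)) has_real_derivative ?D (z + s *\<^sub>R a + t *\<^sub>R b) a) (at s)"
    if "0 \<le> s" "s \<le> h" "0 \<le> t" "t \<le> h" for s t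
  proof -
    have d: "(f has_derivative ?D (z + s *\<^sub>R a + t *\<^sub>R b)) (at (z + s *\<^sub>R a + t *\<^sub>R b))"
      using Ck_on_has_derivative[OF C] sub that by blast
    have "((\<lambda>s. f (z + s *\<^sub>R a + t *\<^sub>R b)) has_derivative (\<lambda>x. ?D (z + s *\<^sub>R a + t *\<^sub>R b) (x *\<^sub>R a))) (at s)"
      by (rule has_derivative_compose[OF dline d])
    then show ?thesis
      using linear_cmul[OF has_derivative_linear[OF d]]
      by (simp add: has_field_derivative_def mult_commute_abs)
  qed
  have "\<exists>s. s > 0 \<and> s < h \<and> ?g h - ?g 0 = (h - 0) * (?D (z + s *\<^sub>R a + h *\<^sub>R b) a - ?D (z + s *\<^sub>R a) a)"
    using h d1[of _ h] d1[of _ 0]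
    by (intro MVT2) (auto intro!: derivative_eq_intros)
  then obtain s where s: "0 < s" "s < h"
    and s_eq: "?g h - ?g 0 = h * (?D (z + s *\<^sub>R a + h *\<^sub>R b) a - ?D (z + s *\<^sub>R a) a)" by auto
  have C': "Ck_on (Suc 0) S (\<lambda>y. ?D y a)"
    by (rule Ck_on_frechet_derivative[OF C])
  have d2: "((\<lambda>t. ?D (z + s *\<^sub>R a + t *\<^sub>R b) a) has_real_derivative
      frechet_derivative (\<lambda>y. ?D y a) (at (z + s *\<^sub>R a + t *\<^sub>R b)) b) (at t)"
    if "0 \<le> t" "t \<le> h" for t
  proof -
    have d: "((\<lambda>y. ?D y a) has_derivative frechet_derivative (\<lambda>y. ?D y a) (at (z + s *\<^sub>R a + t *\<^sub>R b)))
        (at (z + s *\<^sub>R a + t *\<^sub>R b))"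
      using Ck_on_has_derivative[OF C'] sub that s by simp
    show ?thesis
      using has_derivative_compose[OF dline' d] linear_cmul[OF has_derivative_linear[OF d]]
      by (simp add: has_field_derivative_def mult_commute_abs)
  qed
  have "\<exists>t. t > 0 \<and> t < h \<and> ?D (z + s *\<^sub>R a + h *\<^sub>R b) a - ?D (z + s *\<^sub>R a + 0 *\<^sub>R b) a =
      (h - 0) * frechet_derivative (\<lambda>y. ?D y a) (at (z + s *\<^sub>R a + t *\<^sub>R b)) b"
    by (rule MVT2[OF h]) (use d2 in auto)
  then obtain t where t: "0 < t" "t < h"
    and t_eq: "?D (z + s *\<^sub>R a + h *\<^sub>R b) a - ?D (z + s *\<^sub>R a) a =
      h * frechet_derivative (\<lambda>y. ?D y a) (at (z + s *\<^sub>R a + t *\<^sub>R b)) b" by auto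
  from s_eq[unfolded t_eq] s t show ?thesis
    by (intro exI[of _ s] exI[of _ t]) (auto simp: algebra_simps)
qed

text \<open>The second difference is symmetric in \<open>a\<close> and \<open>b\<close>, so its two
  evaluations by \<open>second_difference_real\<close> make a value of \<open>?P\<close> equal to a
  value of \<open>?Q\<close>, both taken near \<open>z\<close>. If \<open>?Q z < ?P z\<close>,
  continuity separates these values by \<open>m\<close>. The inequality is enough, since the roles
  of \<open>a\<close> and \<open>b\<close> can be exchanged.\<close>

lemma second_derivative_le_real:
  fixes f :: "'a::real_normed_vector \<Rightarrow> real"
  assumes "open S" "z \<in> S" "Ck_on 2 S f"
  shows "frechet_derivative (\<lambda>y. frechet_derivative f (at y) a) (at z) b
       \<le> frechet_derivative (\<lambda>y. frechet_derivative f (at y) b) (at z) a" (is "?P z \<le> ?Q z")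
proof (rule ccontr)
  assume "\<not> ?thesis"
  then have lt: "?Q z < ?P z" by simp
  define m where "m = (?Q z + ?P z) / 2"
  have m: "?Q z < m" "m < ?P z" using lt by (auto simp: m_def)
  have C: "Ck_on (Suc (Suc 0)) S f" using assms(3) by (simp only: numeral_2_eq_2)
  then have "continuous_on S ?P" "continuous_on S ?Q" by auto
  then have "(?P \<longlongrightarrow> ?P z) (nhds z)" "(?Q \<longlongrightarrow> ?Q z) (nhds z)"
    using assms(1,2)
    by (auto simp: continuous_on_eq_continuous_at isCont_def intro!: tendsto_at_iff_tendsto_nhds[THEN iffD1])
  then have "\<forall>\<^sub>F y in nhds z. m < ?P y \<and> ?Q y < m \<and> y \<in> S"
    using m assms(1,2) by (intro eventually_conj eventually_nhds_in_open) (auto dest: order_tendstoD)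
  then obtain e where e: "e > 0" "\<And>y. dist y z < e \<Longrightarrow> m < ?P y \<and> ?Q y < m \<and> y \<in> S"
    by (auto simp: eventually_nhds_metric)
  \<comment> \<open>The parallelogram with sides \<open>h *\<^sub>R a\<close> and
    \<open>h *\<^sub>R b\<close> then lies within distance \<open>e\<close> of \<open>z\<close>; the
    \<open>+ 1\<close> covers \<open>a = b = 0\<close>.\<close>
  define h where "h = e / (2 * (norm a + norm b + 1))"
  have h: "h > 0" using e by (auto simp: h_def intro!: divide_pos_pos add_nonneg_pos)
  have near: "dist (z + s *\<^sub>R a + t *\<^sub>R b) z < e" if "0 \<le> s" "s \<le> h" "0 \<le> t" "t \<le> h" for s t
  proof -
    have "dist (z + s *\<^sub>R a + t *\<^sub>R b) z \<le> s * norm a + t * norm b"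
      using that by (auto simp: dist_norm intro!: norm_triangle_le)
    also have "\<dots> \<le> h * norm a + h * norm b" using that by (auto intro!: add_mono mult_right_mono)
    also have "\<dots> < h * (2 * (norm a + norm b + 1))"
    proof -
      have "0 \<le> h * norm a" "0 \<le> h * norm b" using h by auto
      then show ?thesis using h by (auto simp: algebra_simps intro!: add_nonneg_pos)
    qed
    also have "\<dots> = e"
    proof -
      have "norm a + norm b + 1 > 0" by (intro add_nonneg_pos) auto
      then show ?thesis by (simp add: h_def)
    qed
    finally show ?thesis .
  qed
  obtain s t where st: "0 \<le> s" "s \<le> h" "0 \<le> t" "t \<le> h"
    and eq1: "f (z + h *\<^sub>R a + h *\<^sub>R b) - f (z + h *\<^sub>R a) - f (z + h *\<^sub>R b) + f z = h * h * ?P (z + s *\<^sub>R a + t *\<^sub>R b)"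
    using second_difference_real[OF assms(1,3) h, of z a b] near e(2) by blast
  have "z + s *\<^sub>R b + t *\<^sub>R a \<in> S" if "0 \<le> s" "s \<le> h" "0 \<le> t" "t \<le> h" for s t
    using near[OF that(3,4,1,2)] e(2) by (simp add: ac_simps)
  then obtain s' t' where st': "0 \<le> s'" "s' \<le> h" "0 \<le> t'" "t' \<le> h"
    and eq2: "f (z + h *\<^sub>R b + h *\<^sub>R a) - f (z + h *\<^sub>R b) - f (z + h *\<^sub>R a) + f z = h * h * ?Q (z + s' *\<^sub>R b + t' *\<^sub>R a)"
    using second_difference_real[OF assms(1,3) h, of z b a] by blast
  have "h * h * ?P (z + s *\<^sub>R a + t *\<^sub>R b) = h * h * ?Q (z + t' *\<^sub>R a + s' *\<^sub>R b)"
    using eq1 eq2 by (simp add: algebra_simps)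
  then have "?P (z + s *\<^sub>R a + t *\<^sub>R b) = ?Q (z + t' *\<^sub>R a + s' *\<^sub>R b)" using h by simp
  moreover have "m < ?P (z + s *\<^sub>R a + t *\<^sub>R b)" using near[OF st] e(2) by blast
  moreover have "?Q (z + t' *\<^sub>R a + s' *\<^sub>R b) < m" using near[OF st'(3,4,1,2)] e(2) by blast
  ultimately show False by simp
qed

lemma frechet_derivative_bounded_linear:
  assumes "bounded_linear h" "f differentiable (at x)"
  shows "frechet_derivative (\<lambda>y. h (f y)) (at x) v = h (frechet_derivative f (at x) v)"
  using frechet_derivative_eq[OF bounded_linear.has_derivative[OF assms(1)
    assms(2)[unfolded frechet_derivative_works]]] by simp

text \<open>Reduced to real components, since the mean value theorem in its form as an equation is
  about real-valued functions.\<close>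

theorem second_derivative_symmetric:
  fixes f :: "'a::real_normed_vector \<Rightarrow> 'b::euclidean_space"
  assumes S: "open S" "z \<in> S" "Ck_on 2 S f"
  shows "frechet_derivative (\<lambda>y. frechet_derivative f (at y) a) (at z) b
       = frechet_derivative (\<lambda>y. frechet_derivative f (at y) b) (at z) a"
proof (rule euclidean_eqI)
  fix c :: 'b assume "c \<in> Basis"
  let ?f = "\<lambda>y. f y \<bullet> c"
  have C: "Ck_on (Suc (Suc 0)) S f" using S(3) by (simp only: numeral_2_eq_2)
  have *: "frechet_derivative (\<lambda>y. frechet_derivative ?f (at y) a) (at z) b
      = frechet_derivative (\<lambda>y. frechet_derivative f (at y) a) (at z) b \<bullet> c" for a b
  proof -
    have "frechet_derivative (\<lambda>y. frechet_derivative ?f (at y) a) (at z)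
        = frechet_derivative (\<lambda>y. frechet_derivative f (at y) a \<bullet> c) (at z)"
      using C by (intro frechet_derivative_cong_open[OF S(1,2)]
          frechet_derivative_bounded_linear[OF bounded_linear_inner_left]) auto
    then show ?thesis
      using C S(2) by (simp add: frechet_derivative_bounded_linear[OF bounded_linear_inner_left])
  qed
  have f: "Ck_on 2 S ?f" by (rule Ck_on_bounded_linear[OF S(1) bounded_linear_inner_left S(3)])
  show "frechet_derivative (\<lambda>y. frechet_derivative f (at y) a) (at z) b \<bullet> c
      = frechet_derivative (\<lambda>y. frechet_derivative f (at y) b) (at z) a \<bullet> c"
    unfolding *[symmetric] by (intro antisym second_derivative_le_real[OF S(1,2) f])
qed

section \<open>Alternating multilinear functions\<close>

text \<open>No factor \<open>1 / fact m\<close>: in this form \<open>wedge_functionals\<close> is an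
  instance, and the factorials produced by nesting cancel against the denominators of
  \<open>wedge_covectors\<close> and of the insertion formula.\<close>

definition antisymmetrize :: "nat \<Rightarrow> ((nat \<Rightarrow> 'v) \<Rightarrow> complex) \<Rightarrow> (nat \<Rightarrow> 'v) \<Rightarrow> complex" where
  "antisymmetrize m F v = (\<Sum>\<sigma> | \<sigma> permutes {..<m}. of_int (sign \<sigma>) * F (v \<circ> \<sigma>))"

definition alternating :: "nat \<Rightarrow> ((nat \<Rightarrow> 'v) \<Rightarrow> complex) \<Rightarrow> bool" where
  "alternating m F \<longleftrightarrow> (\<forall>\<sigma> v. \<sigma> permutes {..<m} \<longrightarrow> F (v \<circ> \<sigma>) = of_int (sign \<sigma>) * F v)"

definition depends_on_first :: "nat \<Rightarrow> ((nat \<Rightarrow> 'v) \<Rightarrow> complex) \<Rightarrow> bool" where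
  "depends_on_first m F \<longleftrightarrow> (\<forall>v w. (\<forall>i<m. v i = w i) \<longrightarrow> F v = F w)"

text \<open>Linear over the reals only, as the differentials of the coordinates and their conjugates
  both have to qualify; the behaviour under complex scalars is recorded by
  \<open>pq_weight\<close>.\<close>

definition slotwise_linear :: "nat \<Rightarrow> ((nat \<Rightarrow> 'v::real_vector) \<Rightarrow> complex) \<Rightarrow> bool" where
  "slotwise_linear m F \<longleftrightarrow> (\<forall>i<m. \<forall>v. linear (\<lambda>u. F (v(i := u))))"

definition altform :: "nat \<Rightarrow> ((nat \<Rightarrow> 'v::real_vector) \<Rightarrow> complex) \<Rightarrow> bool" where
  "altform m F \<longleftrightarrow> depends_on_first m F \<and> slotwise_linear m F \<and> alternating m F"

lemma alternatingD: "alternating m F \<Longrightarrow> \<sigma> permutes {..<m} \<Longrightarrow> F (v \<circ> \<sigma>) = of_int (sign \<sigma>) * F v"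
  by (simp add: alternating_def)

lemma depends_on_firstD: "depends_on_first m F \<Longrightarrow> (\<And>i. i < m \<Longrightarrow> v i = w i) \<Longrightarrow> F v = F w"
  by (simp add: depends_on_first_def)

lemma slotwise_linearD: "slotwise_linear m F \<Longrightarrow> i < m \<Longrightarrow> linear (\<lambda>u. F (v(i := u)))"
  by (simp add: slotwise_linear_def)

lemma sign_mult_self: "(of_int (sign \<sigma>) :: 'a::ring_1) * (of_int (sign \<sigma>) * x) = x"
  by (cases \<sigma> rule: sign_cases) auto

lemma sign_compose_permutes:
  "\<sigma> permutes {..<m} \<Longrightarrow> \<tau> permutes {..<m::nat} \<Longrightarrow> sign (\<sigma> \<circ> \<tau>) = sign \<sigma> * sign \<tau>"
  by (meson finite_lessThan permutation_permutes sign_compose)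

lemma bij_betw_compose_right_permutes:
  assumes "\<tau> permutes S"
  shows "bij_betw (\<lambda>\<sigma>. \<sigma> \<circ> \<tau>) {\<sigma>. \<sigma> permutes S} {\<sigma>. \<sigma> permutes S}"
  by (rule bij_betwI[where g="\<lambda>\<sigma>. \<sigma> \<circ> inv \<tau>"])
    (auto simp: assms permutes_compose permutes_inv o_assoc[symmetric] permutes_inv_o[OF assms])

lemma bij_betw_compose_left_permutes:
  assumes "\<tau> permutes S"
  shows "bij_betw (\<lambda>\<sigma>. \<tau> \<circ> \<sigma>) {\<sigma>. \<sigma> permutes S} {\<sigma>. \<sigma> permutes S}"
  by (rule bij_betwI[where g="\<lambda>\<sigma>. inv \<tau> \<circ> \<sigma>"])
    (auto simp: assms permutes_compose permutes_inv o_assoc permutes_inv_o[OF assms])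

lemma antisymmetrize_permuted_vector:
  assumes "\<tau> permutes {..<m}"
  shows "antisymmetrize m F (v \<circ> \<tau>) = of_int (sign \<tau>) * antisymmetrize m F v"
proof -
  have "antisymmetrize m F v = (\<Sum>\<sigma> | \<sigma> permutes {..<m}. of_int (sign (\<tau> \<circ> \<sigma>)) * F (v \<circ> (\<tau> \<circ> \<sigma>)))"
    unfolding antisymmetrize_def
    by (rule sum.reindex_bij_betw[OF bij_betw_compose_left_permutes[OF assms], symmetric])
  also have "\<dots> = (\<Sum>\<sigma> | \<sigma> permutes {..<m}. of_int (sign \<tau>) * (of_int (sign \<sigma>) * F (v \<circ> \<tau> \<circ> \<sigma>)))"
    by (rule sum.cong) (auto simp: sign_compose_permutes[where m=m] assms o_assoc mult.assoc)
  finally show ?thesis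
    by (simp add: antisymmetrize_def sum_distrib_left[symmetric] sign_mult_self)
qed

lemma alternating_antisymmetrize: "alternating m (antisymmetrize m F)"
  by (simp add: alternating_def antisymmetrize_permuted_vector)

lemma antisymmetrize_permuted:
  assumes "\<tau> permutes {..<m}"
  shows "antisymmetrize m (\<lambda>v. F (v \<circ> \<tau>)) v = of_int (sign \<tau>) * antisymmetrize m F v"
proof -
  have "antisymmetrize m F v = (\<Sum>\<sigma> | \<sigma> permutes {..<m}. of_int (sign (\<sigma> \<circ> \<tau>)) * F (v \<circ> (\<sigma> \<circ> \<tau>)))"
    unfolding antisymmetrize_def
    by (rule sum.reindex_bij_betw[OF bij_betw_compose_right_permutes[OF assms], symmetric])
  also have "\<dots> = (\<Sum>\<sigma> | \<sigma> permutes {..<m}. of_int (sign \<tau>) * (of_int (sign \<sigma>) * F (v \<circ> \<sigma> \<circ> \<tau>)))"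
    by (rule sum.cong) (auto simp: sign_compose_permutes[where m=m] assms o_assoc)
  finally show ?thesis
    by (simp add: antisymmetrize_def sum_distrib_left[symmetric] sign_mult_self)
qed

lemma antisymmetrize_cmult: "antisymmetrize m (\<lambda>v. c * F v) v = c * antisymmetrize m F v"
  by (simp add: antisymmetrize_def sum_distrib_left mult.left_commute)

lemma antisymmetrize_add:
  "antisymmetrize m (\<lambda>v. F v + G v) v = antisymmetrize m F v + antisymmetrize m G v"
  by (simp add: antisymmetrize_def distrib_left sum.distrib)

lemma antisymmetrize_sum:
  "antisymmetrize m (\<lambda>v. \<Sum>i\<in>I. F i v) v = (\<Sum>i\<in>I. antisymmetrize m (F i) v)"
  unfolding antisymmetrize_def sum_distrib_left by (rule sum.swap)

lemma antisymmetrize_alternating: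
  assumes "alternating m F"
  shows "antisymmetrize m F v = fact m * F v"
proof -
  have "antisymmetrize m F v = (\<Sum>\<sigma> | \<sigma> permutes {..<m}. F v)"
    unfolding antisymmetrize_def
    by (rule sum.cong) (auto simp: alternatingD[OF assms] sign_mult_self)
  then show ?thesis by (simp add: card_permutations[OF refl])
qed

text \<open>Reindexing by the transposition shows that the sum equals its own negative.\<close>

lemma antisymmetrize_symmetric:
  assumes "i < m" "j < m" "i \<noteq> j" "\<And>v. F (v \<circ> Transposition.transpose i j) = F v"
  shows "antisymmetrize m F v = 0"
proof -
  have "Transposition.transpose i j permutes {..<m}" using assms by (intro permutes_swap_id) auto
  from antisymmetrize_permuted[OF this, of F v] assms show ?thesis
    by (simp add: sign_swap_id)
qed

section \<open>Permutations of a block of slots, and insertion of a vector\<close>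

definition shift_perm :: "nat \<Rightarrow> (nat \<Rightarrow> nat) \<Rightarrow> nat \<Rightarrow> nat" where
  "shift_perm a \<tau> j = (if j < a then j else a + \<tau> (j - a))"

lemma shift_perm_eq_map_permutation:
  assumes "\<tau> permutes {..<k}"
  shows "shift_perm a \<tau> = map_permutation {..<k} ((+) a) \<tau>"
proof
  fix j
  show "shift_perm a \<tau> j = map_permutation {..<k} ((+) a) \<tau> j"
  proof (cases "a \<le> j \<and> j < a + k")
    case True
    then obtain i where i: "j = a + i" "i < k" using le_Suc_ex by auto
    then show ?thesis by (simp add: shift_perm_def map_permutation_apply)
  next
    case False
    then have "j \<notin> (+) a ` {..<k}" by auto
    then have "map_permutation {..<k} ((+) a) \<tau> j = j"
      using assms by (metis bij_betw_imp_inj_on bij_betw_add map_permutation_permutes permutes_not_in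
        inj_on_imp_bij_betw inj_on_add)
    moreover have "\<tau> (j - a) = j - a" if "j \<ge> a"
      using False that by (intro permutes_not_in[OF assms]) auto
    ultimately show ?thesis by (auto simp: shift_perm_def)
  qed
qed

lemma shift_perm:
  assumes "\<tau> permutes {..<k}"
  shows "sign (shift_perm a \<tau>) = sign \<tau>"
    and "a + k \<le> m \<Longrightarrow> shift_perm a \<tau> permutes {..<m}"
proof -
  note eq = shift_perm_eq_map_permutation[OF assms, of a]
  show "sign (shift_perm a \<tau>) = sign \<tau>"
    unfolding eq by (rule sign_map_permutation) (use assms in auto)
  assume le: "a + k \<le> m"
  have "map_permutation {..<k} ((+) a) \<tau> permutes ((+) a ` {..<k})"
    by (rule map_permutation_permutes) (use assms in \<open>auto simp: bij_betw_def\<close>)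
  then show "shift_perm a \<tau> permutes {..<m}"
    unfolding eq by (rule permutes_subset) (use le in auto)
qed

text \<open>Each of the \<open>fact k\<close> permutations of the inner block extends to a
  permutation of all slots, and reindexing the outer sum by it cancels its sign. In
  \<open>P v u\<close> the argument \<open>u\<close> carries the block, while \<open>v\<close> may
  enter only through slots that the block permutations do not disturb. This absorption replaces all
  computations with shuffles.\<close>

lemma antisymmetrize_block:
  assumes le: "a + k \<le> m"
    and P: "\<And>\<tau> v u. \<tau> permutes {..<k} \<Longrightarrow> P (v \<circ> shift_perm a \<tau>) u = P v u"
  shows "antisymmetrize m (\<lambda>v. antisymmetrize k (P v) (\<lambda>i. v (a + i))) v
       = fact k * antisymmetrize m (\<lambda>v. P v (\<lambda>i. v (a + i))) v"
proof -
  let ?Q = "\<lambda>v. P v (\<lambda>i. v (a + i))"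
  have "antisymmetrize k (P v) (\<lambda>i. v (a + i))
      = (\<Sum>\<tau> | \<tau> permutes {..<k}. of_int (sign \<tau>) * ?Q (v \<circ> shift_perm a \<tau>))" for v
    unfolding antisymmetrize_def
  proof (intro sum.cong refl, clarify)
    fix \<tau> assume \<tau>: "\<tau> permutes {..<k}"
    have "(\<lambda>i. (v \<circ> shift_perm a \<tau>) (a + i)) = (\<lambda>i. v (a + i)) \<circ> \<tau>"
      by (auto simp: shift_perm_def)
    then show "of_int (sign \<tau>) * P v ((\<lambda>i. v (a + i)) \<circ> \<tau>) = of_int (sign \<tau>) * ?Q (v \<circ> shift_perm a \<tau>)"
      using P[OF \<tau>] by simp
  qed
  then have "antisymmetrize m (\<lambda>v. antisymmetrize k (P v) (\<lambda>i. v (a + i))) v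
     = (\<Sum>\<tau> | \<tau> permutes {..<k}. of_int (sign \<tau>) * antisymmetrize m (\<lambda>v. ?Q (v \<circ> shift_perm a \<tau>)) v)"
    by (simp add: antisymmetrize_sum antisymmetrize_cmult)
  also have "\<dots> = (\<Sum>\<tau> | \<tau> permutes {..<k}. antisymmetrize m ?Q v)"
    by (rule sum.cong[OF refl], subst antisymmetrize_permuted[where F="?Q"])
      (auto simp: shift_perm le sign_mult_self)
  finally show ?thesis by (simp add: card_permutations[OF refl])
qed

text \<open>Composing with this cycle moves slot \<open>i\<close> to the front.\<close>

definition front_cycle :: "nat \<Rightarrow> nat \<Rightarrow> nat" where
  "front_cycle i j = (if j = 0 then i else if j \<le> i then j - 1 else j)"

lemma front_cycle_Suc: "front_cycle (Suc i) = Transposition.transpose i (Suc i) \<circ> front_cycle i"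
  by (rule ext) (auto simp: front_cycle_def Transposition.transpose_def)

lemma front_cycle: "i < m \<Longrightarrow> front_cycle i permutes {..<m} \<and> sign (front_cycle i) = (- 1) ^ i"
proof (induction i)
  case 0
  have "front_cycle 0 = id" by (rule ext) (auto simp: front_cycle_def)
  then show ?case by (metis permutes_id power_0 sign_id)
next
  case (Suc i)
  then have IH: "front_cycle i permutes {..<m}" "sign (front_cycle i) = (- 1) ^ i" by auto
  have t: "Transposition.transpose i (Suc i) permutes {..<m}" using Suc.prems by (intro permutes_swap_id) auto
  show ?case
    unfolding front_cycle_Suc sign_compose_permutes[OF t IH(1)]
    using permutes_compose[OF IH(1) t] IH(2) by (simp only: sign_swap_id) simp
qed

lemma comp_front_cycle_Suc: "(\<lambda>j. (v \<circ> front_cycle i) (Suc j)) = omit i v"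
  by (rule ext) (auto simp: front_cycle_def omit_def)

text \<open>The permutations of \<open>{..<Suc k}\<close> fall into \<open>Suc k\<close> cosets of
  the stabiliser of slot 0. As \<open>G w\<close> is alternating, the \<open>fact k\<close> terms of
  a coset are equal, and the coset of \<open>front_cycle i\<close> yields the summand in which
  \<open>v i\<close> is inserted first.\<close>

lemma insertion_eq_antisymmetrize:
  assumes G: "\<And>w. alternating k (G w)"
  shows "(\<Sum>i\<le>k. (- 1) ^ i * G (v i) (omit i v))
       = antisymmetrize (Suc k) (\<lambda>v. G (v 0) (\<lambda>i. v (Suc i))) v / fact k"
proof -
  let ?F = "\<lambda>v. G (v 0) (\<lambda>i. v (Suc i))"
  have F: "?F (v \<circ> \<tau>) = of_int (sign \<tau>) * ?F v" if \<tau>: "\<tau> permutes {1..k}" for \<tau> v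
  proof -
    \<comment> \<open>What \<open>\<tau>\<close> does to the slots other than 0, renumbered from
      0.\<close>
    define \<tau>' where "\<tau>' = (\<lambda>j. \<tau> (Suc j) - 1)"
    have pos: "\<tau> (Suc j) \<noteq> 0" for j
      using \<tau> permutes_not_in[OF \<tau>, of 0] by (metis atLeastAtMost_iff inv_f_f nat.distinct(1) not_one_le_zero permutes_inj)
    have \<tau>0: "\<tau> 0 = 0" using permutes_not_in[OF \<tau>, of 0] by simp
    have eq: "\<tau> = shift_perm 1 \<tau>'"
    proof
      fix j show "\<tau> j = shift_perm 1 \<tau>' j"
        by (cases j) (use pos \<tau>0 in \<open>auto simp: shift_perm_def \<tau>'_def\<close>)
    qed
    have \<tau>': "\<tau>' permutes {..<k}"
    proof (rule bij_imp_permutes)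
      show "bij_betw \<tau>' {..<k} {..<k}"
      proof (rule bij_betwI[where g="\<lambda>j. inv \<tau> (Suc j) - 1"])
        have inv: "inv \<tau> permutes {1..k}" by (rule permutes_inv[OF \<tau>])
        have inv0: "inv \<tau> (Suc j) \<noteq> 0" for j
          using \<tau>0 permutes_inverses[OF \<tau>] by (metis nat.distinct(1))
        have in1: "\<tau> (Suc j) - 1 < k" "inv \<tau> (Suc j) - 1 < k" if "j < k" for j
          using permutes_in_image[OF \<tau>, of "Suc j"] permutes_in_image[OF inv, of "Suc j"] that by auto
        show "\<tau>' \<in> {..<k} \<rightarrow> {..<k}" "(\<lambda>j. inv \<tau> (Suc j) - 1) \<in> {..<k} \<rightarrow> {..<k}"
          using in1 by (auto simp only: \<tau>'_def Pi_iff lessThan_iff)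
        fix j
        show "inv \<tau> (Suc (\<tau>' j)) - 1 = j"
          using pos[of j] permutes_inverses(2)[OF \<tau>, of "Suc j"] by (simp add: \<tau>'_def)
        show "\<tau>' (inv \<tau> (Suc j) - 1) = j"
          using inv0[of j] permutes_inverses(1)[OF \<tau>, of "Suc j"] by (simp add: \<tau>'_def)
      qed
      fix j assume "j \<notin> {..<k}"
      then show "\<tau>' j = j" using permutes_not_in[OF \<tau>, of "Suc j"] by (simp add: \<tau>'_def)
    qed
    have "(\<lambda>i. (v \<circ> \<tau>) (Suc i)) = (\<lambda>i. v (Suc i)) \<circ> \<tau>'"
      using pos by (auto simp: \<tau>'_def comp_def)
    then have "?F (v \<circ> \<tau>) = of_int (sign \<tau>') * ?F v"
      using alternatingD[OF G \<tau>', of "v 0" "\<lambda>i. v (Suc i)"] \<tau>0 by simp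
    then show ?thesis using shift_perm(1)[OF \<tau>', of 1] eq by simp
  qed
  have 0: "0 \<notin> {1..k}" and ins: "{..<Suc k} = insert 0 {1..k}" by auto
  have trans: "Transposition.transpose 0 b permutes {..<Suc k}" if "b \<in> insert 0 {1..k}" for b
    using that by (intro permutes_swap_id) auto
  have perm: "\<tau> permutes {..<Suc k}" if "\<tau> permutes {1..k}" for \<tau>
    using that by (rule permutes_subset) auto
  \<comment> \<open>The decomposition of the sum over permutations uses transpositions as coset
    representatives. \<open>front_cycle b\<close> lies in the same coset and, unlike the
    transposition, keeps the remaining vectors in their order, as \<open>omit b\<close>
    demands.\<close>
  have swap: "of_int (sign (Transposition.transpose 0 b)) * ?F (v \<circ> Transposition.transpose 0 b) = (- 1) ^ b * ?F (v \<circ> front_cycle b)"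
    if b: "b \<in> insert 0 {1..k}" for b
  proof -
    have bk: "b < Suc k" using b by auto
    note c = front_cycle[OF bk]
    define \<tau> where "\<tau> = inv (front_cycle b) \<circ> Transposition.transpose 0 b"
    have p: "\<tau> permutes {..<Suc k}" unfolding \<tau>_def
      by (intro permutes_compose trans b permutes_inv c[THEN conjunct1])
    have "\<tau> 0 = 0" using permutes_inverses(2)[OF c[THEN conjunct1], of 0]
      by (simp add: \<tau>_def front_cycle_def)
    then have \<tau>: "\<tau> permutes {1..k}"
      using p unfolding ins by (intro permutes_superset[OF p[unfolded ins]]) auto
    have eq: "Transposition.transpose 0 b = front_cycle b \<circ> \<tau>"
      using permutes_inv_o(1)[OF c[THEN conjunct1]] by (simp add: \<tau>_def o_assoc)
    have "sign (Transposition.transpose 0 b) = (- 1) ^ b * sign \<tau>"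
      unfolding eq using c p by (simp add: sign_compose_permutes[where m="Suc k"])
    moreover have "?F (v \<circ> Transposition.transpose 0 b) = of_int (sign \<tau>) * ?F (v \<circ> front_cycle b)"
      unfolding eq o_assoc by (rule F[OF \<tau>])
    ultimately show ?thesis by (simp add: mult.assoc sign_mult_self)
  qed
  have "antisymmetrize (Suc k) ?F v
      = (\<Sum>b\<in>insert 0 {1..k}. \<Sum>\<tau> | \<tau> permutes {1..k}.
          of_int (sign (Transposition.transpose 0 b \<circ> \<tau>)) * ?F (v \<circ> (Transposition.transpose 0 b \<circ> \<tau>)))"
    unfolding antisymmetrize_def ins by (rule sum_over_permutations_insert) auto
  also have "\<dots> = (\<Sum>b\<in>insert 0 {1..k}. \<Sum>\<tau> | \<tau> permutes {1..k}.
          of_int (sign (Transposition.transpose 0 b)) * ?F (v \<circ> Transposition.transpose 0 b))"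
  proof (intro sum.cong refl)
    fix b \<tau> assume b: "b \<in> insert 0 {1..k}" and "\<tau> \<in> {\<tau>. \<tau> permutes {1..k}}"
    then have \<tau>: "\<tau> permutes {1..k}" by simp
    have "?F (v \<circ> (Transposition.transpose 0 b \<circ> \<tau>)) = of_int (sign \<tau>) * ?F (v \<circ> Transposition.transpose 0 b)"
      unfolding o_assoc by (rule F[OF \<tau>])
    then show "of_int (sign (Transposition.transpose 0 b \<circ> \<tau>)) * ?F (v \<circ> (Transposition.transpose 0 b \<circ> \<tau>))
        = of_int (sign (Transposition.transpose 0 b)) * ?F (v \<circ> Transposition.transpose 0 b)"
      using sign_compose_permutes[OF trans[OF b] perm[OF \<tau>]]
      by (simp add: mult.assoc sign_mult_self)
  qed
  also have "\<dots> = (\<Sum>b\<in>insert 0 {1..k}. \<Sum>\<tau> | \<tau> permutes {1..k}. (- 1) ^ b * ?F (v \<circ> front_cycle b))"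
    by (intro sum.cong refl swap)
  also have "\<dots> = fact k * (\<Sum>b\<in>insert 0 {1..k}. (- 1) ^ b * ?F (v \<circ> front_cycle b))"
    by (simp add: card_permutations sum_distrib_left del: sum.insert)
  also have "insert 0 {1..k} = {..k}" by auto
  finally show ?thesis
    using comp_front_cycle_Suc[of v] by (simp add: front_cycle_def)
qed

subsection \<open>Expansion in a basis\<close>

lemma sum_PiE_insert:
  assumes "finite S" "x \<notin> S"
  shows "(\<Sum>s\<in>Pi\<^sub>E (insert x S) T. f s) = (\<Sum>s\<in>Pi\<^sub>E S T. \<Sum>y\<in>T x. f (s(x := y)))"
proof -
  have "(\<Sum>s\<in>Pi\<^sub>E (insert x S) T. f s) = (\<Sum>(y, s)\<in>T x \<times> Pi\<^sub>E S T. f (s(x := y)))"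
    unfolding PiE_insert_eq by (subst sum.reindex[OF inj_combinator[OF assms(2)]]) (auto simp: case_prod_unfold)
  also have "\<dots> = (\<Sum>y\<in>T x. \<Sum>s\<in>Pi\<^sub>E S T. f (s(x := y)))"
    by (rule sum.cartesian_product[symmetric])
  finally show ?thesis by (subst sum.swap) 
qed

text \<open>The slots are replaced by basis vectors one at a time. Coordinates enter only through
  \<open>cf\<close> and \<open>step\<close>, so that the same lemma serves for \<open>Basis\<close>,
  \<open>reim_basis\<close> and \<open>real_frame\<close>.\<close>

lemma slotwise_expansion:
  fixes F :: "(nat \<Rightarrow> 'v) \<Rightarrow> complex" and b :: "'i \<Rightarrow> 'v" and cf :: "'v \<Rightarrow> 'i \<Rightarrow> complex"
  assumes F: "depends_on_first m F"
    and step: "\<And>i v. i < m \<Longrightarrow> F v = (\<Sum>j\<in>B. cf (v i) j * F (v(i := b j)))"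
  shows "F v = (\<Sum>s\<in>{..<m} \<rightarrow>\<^sub>E B. (\<Prod>i<m. cf (v i) (s i)) * F (\<lambda>i. b (s i)))"
proof -
  have "F v = (\<Sum>s\<in>{..<l} \<rightarrow>\<^sub>E B. (\<Prod>i<l. cf (v i) (s i)) * F (\<lambda>i. if i < l then b (s i) else v i))"
    if "l \<le> m" for l
    using that
  proof (induction l)
    case 0
    then show ?case by simp
  next
    case (Suc l)
    let ?w = "\<lambda>s i. if i < l then b (s i) else v i"
    have "F v = (\<Sum>s\<in>{..<l} \<rightarrow>\<^sub>E B. (\<Prod>i<l. cf (v i) (s i)) * F (?w s))"
      using Suc by simp
    also have "\<dots> = (\<Sum>s\<in>{..<l} \<rightarrow>\<^sub>E B. \<Sum>y\<in>B. (\<Prod>i<Suc l. cf (v i) ((s(l := y)) i)) *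
        F (\<lambda>i. if i < Suc l then b ((s(l := y)) i) else v i))"
    proof (rule sum.cong[OF refl])
      fix s
      have "F (?w s) = (\<Sum>y\<in>B. cf (v l) y * F ((?w s)(l := b y)))"
        using step[of l "?w s"] Suc.prems by simp
      moreover have "(?w s)(l := b y) = (\<lambda>i. if i < Suc l then b ((s(l := y)) i) else v i)" for y
        by (auto simp: fun_eq_iff)
      ultimately show "(\<Prod>i<l. cf (v i) (s i)) * F (?w s) = (\<Sum>y\<in>B. (\<Prod>i<Suc l. cf (v i) ((s(l := y)) i)) *
        F (\<lambda>i. if i < Suc l then b ((s(l := y)) i) else v i))"
        by (simp add: sum_distrib_left mult.assoc)
    qed
    also have "\<dots> = (\<Sum>s\<in>{..<Suc l} \<rightarrow>\<^sub>E B. (\<Prod>i<Suc l. cf (v i) (s i)) *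
        F (\<lambda>i. if i < Suc l then b (s i) else v i))"
    proof -
      have "l \<notin> {..<l}" by simp
      then show ?thesis unfolding lessThan_Suc
        by (intro sum_PiE_insert[where T="\<lambda>_. B" and f="\<lambda>s. (\<Prod>i\<in>insert l {..<l}. cf (v i) (s i)) *
          F (\<lambda>i. if i < Suc l then b (s i) else v i)", symmetric]) simp_all
    qed
    finally show ?case .
  qed
  from this[of m] have "F v = (\<Sum>s\<in>{..<m} \<rightarrow>\<^sub>E B. (\<Prod>i<m. cf (v i) (s i)) * F (\<lambda>i. if i < m then b (s i) else v i))"
    by simp
  also have "\<dots> = (\<Sum>s\<in>{..<m} \<rightarrow>\<^sub>E B. (\<Prod>i<m. cf (v i) (s i)) * F (\<lambda>i. b (s i)))"
    by (intro sum.cong refl arg_cong2[where f="(*)"] depends_on_firstD[OF F]) auto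
  finally show ?thesis .
qed

lemma alternating_repeat:
  assumes "alternating m F" "i < m" "j < m" "i \<noteq> j" "v i = v j"
  shows "F v = 0"
proof -
  have p: "Transposition.transpose i j permutes {..<m}" using assms by (intro permutes_swap_id) auto
  have "v \<circ> Transposition.transpose i j = v" using assms(5) by (auto simp: fun_eq_iff Transposition.transpose_def)
  with alternatingD[OF assms(1) p, of v] assms(4) show ?thesis by (simp add: sign_swap_id)
qed

text \<open>With as many slots as basis vectors, a choice of basis vectors either repeats one, and
  is killed by alternation, or is a permutation. What is left is the Leibniz formula.\<close>

lemma top_expansion:
  fixes F :: "(nat \<Rightarrow> 'v) \<Rightarrow> complex" and b :: "nat \<Rightarrow> 'v" and cf :: "'v \<Rightarrow> nat \<Rightarrow> complex"
  assumes F: "depends_on_first m F" "alternating m F"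
    and step: "\<And>i v. i < m \<Longrightarrow> F v = (\<Sum>j<m. cf (v i) j * F (v(i := b j)))"
  shows "F v = (\<Sum>\<sigma> | \<sigma> permutes {..<m}. of_int (sign \<sigma>) * (\<Prod>i<m. cf (v i) (\<sigma> i))) * F b"
proof -
  \<comment> \<open>Permutations are the identity outside \<open>{..<m}\<close>, whereas the index
    functions of the expansion are \<open>undefined\<close> there; \<open>?r\<close>
    translates.\<close>
  let ?P = "{\<sigma>. \<sigma> permutes {..<m}}" and ?r = "\<lambda>\<sigma>::nat\<Rightarrow>nat. restrict \<sigma> {..<m}"
  have sub: "?r ` ?P \<subseteq> {..<m} \<rightarrow>\<^sub>E {..<m}"
    using permutes_in_image by (fastforce simp: image_subset_iff)
  have inj: "inj_on ?r ?P"
  proof (rule inj_onI, rule ext)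
    fix \<sigma> \<tau> i assume "\<sigma> \<in> ?P" "\<tau> \<in> ?P" and eq: "?r \<sigma> = ?r \<tau>"
    moreover have "\<sigma> i = \<tau> i" if "i < m" using fun_cong[OF eq, of i] that by simp
    ultimately show "\<sigma> i = \<tau> i" using permutes_not_in[of \<sigma> "{..<m}" i] permutes_not_in[of \<tau> "{..<m}" i]
      by (cases "i < m") auto
  qed
  have zero: "F (\<lambda>i. b (s i)) = 0" if s: "s \<in> ({..<m} \<rightarrow>\<^sub>E {..<m}) - ?r ` ?P" for s
  proof (cases "inj_on s {..<m}")
    case True
    define \<sigma> where "\<sigma> i = (if i < m then s i else i)" for i
    have "s ` {..<m} = {..<m}" using True s by (intro endo_inj_surj) auto
    then have "bij_betw s {..<m} {..<m}" using True by (simp add: bij_betw_def)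
    then have "bij_betw \<sigma> {..<m} {..<m}" by (rule bij_betw_cong[THEN iffD1, rotated]) (simp add: \<sigma>_def)
    then have "\<sigma> permutes {..<m}" by (rule bij_imp_permutes) (simp add: \<sigma>_def)
    moreover have "s = ?r \<sigma>" using s by (auto simp: \<sigma>_def fun_eq_iff PiE_def extensional_def)
    ultimately show ?thesis using s by blast
  next
    case False
    then obtain i j where "i < m" "j < m" "i \<noteq> j" "s i = s j" by (auto simp: inj_on_def)
    then show ?thesis by (intro alternating_repeat[OF F(2), of i j]) auto
  qed
  have "F v = (\<Sum>s\<in>{..<m} \<rightarrow>\<^sub>E {..<m}. (\<Prod>i<m. cf (v i) (s i)) * F (\<lambda>i. b (s i)))"
    by (rule slotwise_expansion[OF F(1) step])
  also have "\<dots> = (\<Sum>s\<in>?r ` ?P. (\<Prod>i<m. cf (v i) (s i)) * F (\<lambda>i. b (s i)))"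
    by (rule sum.mono_neutral_right) (use sub zero in \<open>auto intro!: finite_PiE\<close>)
  also have "\<dots> = (\<Sum>\<sigma>\<in>?P. (\<Prod>i<m. cf (v i) (\<sigma> i)) * F (b \<circ> \<sigma>))"
  proof (subst sum.reindex[OF inj], unfold comp_def, intro sum.cong refl arg_cong2[where f="(*)"])
    fix \<sigma>
    show "(\<Prod>i<m. cf (v i) (?r \<sigma> i)) = (\<Prod>i<m. cf (v i) (\<sigma> i))" by (rule prod.cong) auto
    show "F (\<lambda>i. b (?r \<sigma> i)) = F (\<lambda>x. b (\<sigma> x))" by (rule depends_on_firstD[OF F(1)]) auto
  qed
  also have "\<dots> = (\<Sum>\<sigma>\<in>?P. of_int (sign \<sigma>) * (\<Prod>i<m. cf (v i) (\<sigma> i)) * F b)"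
    by (rule sum.cong) (auto simp: alternatingD[OF F(2)])
  finally show ?thesis by (simp add: sum_distrib_right)
qed

lemma linear_of_real_mult:
  "linear f \<Longrightarrow> f (c *\<^sub>R x) = complex_of_real c * f x"
  by (simp add: linear_cmul scaleR_conv_of_real)

lemma slotwise_linear_step:
  assumes "slotwise_linear m F" "i < m" "v i = (\<Sum>j\<in>B. c j *\<^sub>R b j)"
  shows "F v = (\<Sum>j\<in>B. complex_of_real (c j) * F (v(i := b j)))"
proof -
  note lin = slotwise_linearD[OF assms(1,2), of v]
  have "F v = F (v(i := v i))" by simp
  also have "\<dots> = F (v(i := (\<Sum>j\<in>B. c j *\<^sub>R b j)))" by (simp only: assms(3))
  also have "\<dots> = (\<Sum>j\<in>B. F (v(i := c j *\<^sub>R b j)))" using linear_sum[OF lin] .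
  finally show ?thesis using linear_of_real_mult[OF lin] by simp
qed

lemma slotwise_linear_expansion:
  fixes F :: "(nat \<Rightarrow> 'v::euclidean_space) \<Rightarrow> complex"
  assumes "depends_on_first m F" "slotwise_linear m F"
  shows "F v = (\<Sum>s\<in>{..<m} \<rightarrow>\<^sub>E Basis. of_real (\<Prod>i<m. v i \<bullet> s i) * F s)"
proof -
  have "F v = (\<Sum>s\<in>{..<m} \<rightarrow>\<^sub>E Basis. (\<Prod>i<m. of_real (v i \<bullet> s i)) * F (\<lambda>i. s i))"
    by (rule slotwise_expansion[OF assms(1)], rule slotwise_linear_step[OF assms(2)])
      (simp_all add: euclidean_representation)
  then show ?thesis by simp
qed

subsection \<open>Closure properties\<close>

lemma linear_cmult: "linear f \<Longrightarrow> linear (\<lambda>u. (c::complex) * f u)"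
  by (intro linearI) (simp_all add: linear_add linear_cmul distrib_left)

lemma linear_cmult_right: "linear f \<Longrightarrow> linear (\<lambda>u. f u * (c::complex))"
  using linear_cmult[of f c] by (simp add: mult.commute)

lemma slotwise_linear_cmult: "slotwise_linear m F \<Longrightarrow> slotwise_linear m (\<lambda>v. c * F v)"
  by (auto simp: slotwise_linear_def intro: linear_cmult)

lemma slotwise_linear_sum:
  "(\<And>i. i \<in> I \<Longrightarrow> slotwise_linear m (F i)) \<Longrightarrow> slotwise_linear m (\<lambda>v. \<Sum>i\<in>I. F i v)"
  by (auto simp: slotwise_linear_def intro: linear_compose_sum)

lemma slotwise_linear_permuted:
  assumes "slotwise_linear m F" "\<sigma> permutes {..<m}"
  shows "slotwise_linear m (\<lambda>v. F (v \<circ> \<sigma>))"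
proof (unfold slotwise_linear_def, intro allI impI)
  fix i and v :: "nat \<Rightarrow> 'a" assume "i < m"
  have "v(i := u) \<circ> \<sigma> = (v \<circ> \<sigma>)(inv \<sigma> i := u)" for u
    by (auto simp: fun_eq_iff permutes_inv_eq[OF assms(2)] permutes_inverses[OF assms(2)])
  moreover have "inv \<sigma> i < m" using permutes_in_image[OF permutes_inv[OF assms(2)], of i] \<open>i < m\<close> by simp
  ultimately show "linear (\<lambda>u. F (v(i := u) \<circ> \<sigma>))" using slotwise_linearD[OF assms(1)] by simp
qed

lemma depends_on_first_permuted:
  assumes "depends_on_first m F" "\<sigma> permutes {..<m}"
  shows "depends_on_first m (\<lambda>v. F (v \<circ> \<sigma>))"
  unfolding depends_on_first_def
  using permutes_in_image[OF assms(2)] by (auto intro!: depends_on_firstD[OF assms(1)])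

lemma altform_antisymmetrize:
  assumes "depends_on_first m F" "slotwise_linear m F"
  shows "altform m (antisymmetrize m F)"
proof -
  have "depends_on_first m (antisymmetrize m F)"
    unfolding depends_on_first_def antisymmetrize_def
    by (intro allI impI sum.cong refl arg_cong2[where f="(*)"] depends_on_firstD[OF depends_on_first_permuted[OF assms(1)]]) auto
  moreover have "slotwise_linear m (antisymmetrize m F)"
    unfolding antisymmetrize_def
    by (intro slotwise_linear_sum slotwise_linear_cmult slotwise_linear_permuted[OF assms(2)]) auto
  ultimately show ?thesis by (simp add: altform_def alternating_antisymmetrize)
qed

lemma altform_cmult: "altform m F \<Longrightarrow> altform m (\<lambda>v. c * F v)"
  by (auto simp: altform_def slotwise_linear_cmult depends_on_first_def alternating_def)

lemma altform_add: "altform m F \<Longrightarrow> altform m G \<Longrightarrow> altform m (\<lambda>v. F v + G v)"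
  by (simp add: altform_def slotwise_linear_def depends_on_first_def alternating_def linear_compose_add
      distrib_left) metis

lemma altform_zero: "altform m (\<lambda>v. 0)"
  by (simp add: altform_def slotwise_linear_def depends_on_first_def alternating_def linear_zero)

lemma altform_sum:
  "(\<And>i. i \<in> I \<Longrightarrow> altform m (F i)) \<Longrightarrow> altform m (\<lambda>v. \<Sum>i\<in>I. F i v)"
  by (induction I rule: infinite_finite_induct) (auto intro: altform_zero altform_add)

lemma slotwise_linear_tensor:
  assumes F: "depends_on_first k F" "slotwise_linear k F" and G: "slotwise_linear l G"
  shows "slotwise_linear (k + l) (\<lambda>v. F v * G (\<lambda>i. v (k + i)))"
proof (unfold slotwise_linear_def, intro allI impI)
  fix i v assume i: "i < k + l"
  show "linear (\<lambda>u. F (v(i := u)) * G (\<lambda>j. (v(i := u)) (k + j)))"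
  proof (cases "i < k")
    case True
    then have "(\<lambda>j. (v(i := u)) (k + j)) = (\<lambda>j. v (k + j))" for u by auto
    with slotwise_linearD[OF F(2) True] show ?thesis by (simp add: linear_cmult_right)
  next
    case False
    then have "(\<lambda>j. (v(i := u)) (k + j)) = (\<lambda>j. v (k + j))(i - k := u)" for u by (auto simp: fun_eq_iff)
    moreover have "F (v(i := u)) = F v" for u using False by (intro depends_on_firstD[OF F(1)]) auto
    moreover have "i - k < l" using i False by simp
    ultimately show ?thesis using slotwise_linearD[OF G] by (simp add: linear_cmult)
  qed
qed

lemma depends_on_first_tensor:
  "depends_on_first k F \<Longrightarrow> depends_on_first l G \<Longrightarrow> depends_on_first (k + l) (\<lambda>v. F v * G (\<lambda>i. v (k + i)))"
  unfolding depends_on_first_def by (metis add_less_cancel_left trans_less_add1)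

text \<open>The insertion sum is an antisymmetrization, so only multilinearity of the tensor under
  it has to be checked. Applied both to \<open>dloc\<close> and to \<open>drho_wedge\<close>, which
  differ just in \<open>G\<close>.\<close>

lemma altform_insertion:
  assumes G: "\<And>w. altform k (G w)" and lin: "\<And>u. linear (\<lambda>w. G w u)"
  shows "altform (Suc k) (\<lambda>v. \<Sum>i\<le>k. (- 1) ^ i * G (v i) (omit i v))"
proof -
  have G': "depends_on_first k (G w)" "slotwise_linear k (G w)" "alternating k (G w)" for w
    using G by (auto simp: altform_def)
  have 1: "depends_on_first (Suc k) (\<lambda>v. G (v 0) (\<lambda>i. v (Suc i)))"
  proof (unfold depends_on_first_def, intro allI impI)
    fix v w :: "nat \<Rightarrow> 'a" assume "\<forall>i<Suc k. v i = w i"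
    then show "G (v 0) (\<lambda>i. v (Suc i)) = G (w 0) (\<lambda>i. w (Suc i))"
      using depends_on_firstD[OF G'(1), of "\<lambda>i. v (Suc i)" "\<lambda>i. w (Suc i)"] by simp
  qed
  have 2: "slotwise_linear (Suc k) (\<lambda>v. G (v 0) (\<lambda>i. v (Suc i)))"
  proof (unfold slotwise_linear_def, intro allI impI)
    fix i v assume i: "i < Suc k"
    show "linear (\<lambda>u. G ((v(i := u)) 0) (\<lambda>j. (v(i := u)) (Suc j)))"
    proof (cases i)
      case 0
      then show ?thesis using lin by simp
    next
      case (Suc i')
      then have "(\<lambda>j. (v(i := u)) (Suc j)) = (\<lambda>j. v (Suc j))(i' := u)" for u by auto
      with Suc i slotwise_linearD[OF G'(2), of i'] show ?thesis by simp
    qed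
  qed
  show ?thesis
    unfolding insertion_eq_antisymmetrize[of k G, OF G'(3)]
    using altform_cmult[OF altform_antisymmetrize[OF 1 2], of "1 / fact k"] by simp
qed

lemma wedge_covectors_eq:
  "wedge_covectors k l F G v = antisymmetrize (k + l) (\<lambda>v. F v * G (\<lambda>i. v (k + i))) v / (fact k * fact l)"
  by (simp add: wedge_covectors_def antisymmetrize_def comp_def mult.assoc)

lemma altform_wedge_covectors:
  assumes "altform k F" "altform l G"
  shows "altform (k + l) (wedge_covectors k l F G)"
proof -
  have "altform (k + l) (\<lambda>v. (1 / (fact k * fact l)) * antisymmetrize (k + l) (\<lambda>v. F v * G (\<lambda>i. v (k + i))) v)"
    using assms unfolding altform_def[of k] altform_def[of l]
    by (intro altform_cmult altform_antisymmetrize slotwise_linear_tensor depends_on_first_tensor) auto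
  then show ?thesis by (simp add: wedge_covectors_eq[abs_def])
qed

lemma wedge_functionals_eq:
  "wedge_functionals k \<theta> v = antisymmetrize k (\<lambda>v. \<Prod>i<k. \<theta> i (v i)) v"
  by (simp add: wedge_functionals_def antisymmetrize_def)

lemma slotwise_linear_prod:
  assumes "\<And>i. i < k \<Longrightarrow> linear (\<theta> i)"
  shows "slotwise_linear k (\<lambda>v. \<Prod>i<k. \<theta> i (v i) :: complex)"
proof (unfold slotwise_linear_def, intro allI impI)
  fix i v assume i: "i < k"
  have "(\<Prod>j<k. \<theta> j ((v(i := u)) j)) = \<theta> i u * (\<Prod>j\<in>{..<k} - {i}. \<theta> j (v j))" for u
    by (subst prod.remove[of _ i]) (use i in \<open>auto intro!: prod.cong\<close>)
  with assms[OF i] show "linear (\<lambda>u. \<Prod>j<k. \<theta> j ((v(i := u)) j))"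
    by (simp add: linear_cmult_right)
qed

lemma altform_wedge_functionals:
  assumes "\<And>i. i < k \<Longrightarrow> linear (\<theta> i)"
  shows "altform k (wedge_functionals k \<theta>)"
  unfolding wedge_functionals_eq[abs_def]
  by (intro altform_antisymmetrize slotwise_linear_prod assms) (auto simp: depends_on_first_def)

subsection \<open>Covectors of type \<open>(p,q)\<close>\<close>

definition pq_weight :: "nat \<Rightarrow> nat \<Rightarrow> 'n::finite covector \<Rightarrow> bool" where
  "pq_weight p q F \<longleftrightarrow> (\<forall>a v. F (\<lambda>i. a *s v i) = a ^ p * cnj a ^ q * F v)"

lemma linear_nth: "linear (\<lambda>w::complex^'n. w $ j)"
  by (intro linearI) auto

lemma linear_cnj_nth: "linear (\<lambda>w::complex^'n. cnj (w $ j))"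
  by (intro linearI) simp_all

lemma altform_dz_dzbar: "altform (length I + length J) (dz_dzbar I J)"
  unfolding dz_dzbar_def by (rule altform_wedge_functionals) (case_tac "i < length I"; simp add: linear_nth linear_cnj_nth)

lemma prod_lessThan_add: "(\<Prod>i<k + l. f i) = (\<Prod>i<k. f i) * (\<Prod>i<l. f (k + i) :: 'a::comm_monoid_mult)" for k l :: nat
  by (induction l) (auto simp: mult.assoc)

lemma pq_weight_dz_dzbar: "pq_weight (length I) (length J) (dz_dzbar I J)"
  by (auto simp: pq_weight_def dz_dzbar_def wedge_functionals_def prod_lessThan_add prod.distrib
      sum_distrib_left mult_ac intro!: sum.cong)

lemma is_pq_covector_imp:
  assumes "is_pq_covector p q F"
  shows "altform (p + q) F" "pq_weight p q F"
proof -
  obtain f where F: "F = (\<lambda>v. \<Sum>I | length I = p. \<Sum>J | length J = q. f I J * dz_dzbar I J v)"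
    using assms by (auto simp: is_pq_covector_def)
  show "altform (p + q) F" unfolding F
    by (intro altform_sum altform_cmult) (use altform_dz_dzbar in auto)
  have "dz_dzbar I J (\<lambda>i. a *s v i) = a ^ p * cnj a ^ q * dz_dzbar I J v"
    if "length I = p" "length J = q" for I J :: "'a list" and a v
    using pq_weight_dz_dzbar[of I J] that by (simp add: pq_weight_def)
  then show "pq_weight p q F" unfolding F pq_weight_def
    by (auto simp: sum_distrib_left mult_ac intro!: sum.cong)
qed

lemma finite_length_eq: "finite {I :: 'n::finite list. length I = p}"
  using finite_lists_length_eq[of "UNIV :: 'n set" p] by simp

lemma is_pq_covector_dz_dzbar: "is_pq_covector (length I) (length J) (dz_dzbar I J)"
  unfolding is_pq_covector_def
proof (intro exI ext)
  fix v
  show "dz_dzbar I J v = (\<Sum>I' | length I' = length I. \<Sum>J' | length J' = length J.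
    (if I' = I then if J' = J then 1 else 0 else 0) * dz_dzbar I' J' v)"
    by (subst sum.remove[of _ I], simp_all add: finite_length_eq, subst sum.remove[of _ J])
      (simp_all add: finite_length_eq)
qed

lemma is_pq_covector_add:
  "is_pq_covector p q F \<Longrightarrow> is_pq_covector p q G \<Longrightarrow> is_pq_covector p q (\<lambda>v. F v + G v)"
  unfolding is_pq_covector_def
  by (elim exE, rule_tac x="\<lambda>I J. f I J + fa I J" in exI) (simp add: sum.distrib distrib_right)

lemma is_pq_covector_cmult:
  "is_pq_covector p q F \<Longrightarrow> is_pq_covector p q (\<lambda>v. c * F v)"
  unfolding is_pq_covector_def
  by (elim exE, rule_tac x="\<lambda>I J. c * f I J" in exI) (simp add: sum_distrib_left mult.assoc)

lemma is_pq_covector_zero: "is_pq_covector p q (\<lambda>v. 0)"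
  unfolding is_pq_covector_def by (rule exI[of _ "\<lambda>_ _. 0"]) simp

lemma is_pq_covector_sum:
  "(\<And>i. i \<in> I \<Longrightarrow> is_pq_covector p q (F i)) \<Longrightarrow> is_pq_covector p q (\<lambda>v. \<Sum>i\<in>I. F i v)"
  by (induction I rule: infinite_finite_induct) (auto intro: is_pq_covector_zero is_pq_covector_add)

text \<open>The complex coordinate functionals \<open>z\<^sub>j\<close> and their conjugates, a basis of the complexified
  dual of \<open>\<complex>\<^sup>n\<close>.\<close>

definition cfunctional :: "'n::finite \<times> bool \<Rightarrow> complex ^ 'n \<Rightarrow> complex" where
  "cfunctional t w = (if snd t then w $ fst t else cnj (w $ fst t))"

lemma exists_sorting_perm:
  fixes P :: "nat \<Rightarrow> bool"
  assumes "card {i. i < k \<and> P i} = p"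
  shows "\<exists>\<pi>. \<pi> permutes {..<k} \<and> (\<forall>i<k. P (\<pi> i) \<longleftrightarrow> i < p)"
proof -
  let ?A = "{i. i < k \<and> P i}" and ?B = "{i. i < k \<and> \<not> P i}"
  have "card (?A \<union> ?B) = card ?A + card ?B" by (rule card_Un_disjoint) auto
  moreover have "?A \<union> ?B = {..<k}" by auto
  ultimately have k: "k = p + card ?B" using assms by simp
  obtain f where f: "bij_betw f {..<p} ?A"
    using finite_same_card_bij[of "{..<p}" ?A] assms by auto
  have "card {p..<k} = card ?B" unfolding card_atLeastLessThan using k by linarith
  then obtain g where g: "bij_betw g {p..<k} ?B"
    using finite_same_card_bij[of "{p..<k}" ?B] by auto
  define \<pi> where "\<pi> i = (if i < p then f i else if i < k then g i else i)" for i
  have 1: "bij_betw \<pi> {..<p} ?A" using f by (rule bij_betw_cong[THEN iffD1, rotated]) (simp add: \<pi>_def)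
  have 2: "bij_betw \<pi> {p..<k} ?B" using g by (rule bij_betw_cong[THEN iffD1, rotated]) (simp add: \<pi>_def)
  have "bij_betw \<pi> ({..<p} \<union> {p..<k}) (?A \<union> ?B)" by (rule bij_betw_combine[OF 1 2]) auto
  moreover have "{..<p} \<union> {p..<k} = {..<k}" using k by auto
  ultimately have "bij_betw \<pi> {..<k} {..<k}" using \<open>?A \<union> ?B = {..<k}\<close> by simp
  then have "\<pi> permutes {..<k}" by (rule bij_imp_permutes) (use k in \<open>auto simp: \<pi>_def\<close>)
  moreover have "P (\<pi> i) \<longleftrightarrow> i < p" if "i < k" for i
    using bij_betwE[OF 1] bij_betwE[OF 2] that by (cases "i < p") auto
  ultimately show ?thesis by blast
qed

text \<open>Moving the \<open>p\<close> unconjugated factors to the front costs a sign and produces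
  some \<open>dz_dzbar I J\<close>.\<close>

lemma is_pq_covector_wedge_cfunctional:
  fixes t :: "nat \<Rightarrow> 'n::finite \<times> bool"
  assumes "card {i. i < p + q \<and> snd (t i)} = p"
  shows "is_pq_covector p q (wedge_functionals (p + q) (\<lambda>i. cfunctional (t i)))"
proof -
  obtain \<pi> where \<pi>: "\<pi> permutes {..<p + q}" "\<And>i. i < p + q \<Longrightarrow> snd (t (\<pi> i)) \<longleftrightarrow> i < p"
    using exists_sorting_perm[OF assms] by blast
  define I where "I = map (\<lambda>i. fst (t (\<pi> i))) [0..<p]"
  define J where "J = map (\<lambda>i. fst (t (\<pi> (p + i)))) [0..<q]"
  have len: "length I = p" "length J = q" by (simp_all add: I_def J_def)
  let ?H = "\<lambda>v. \<Prod>i<p + q. cfunctional (t i) (v i)"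
  have "dz_dzbar I J v = of_int (sign \<pi>) * wedge_functionals (p + q) (\<lambda>i. cfunctional (t i)) v" for v
  proof -
    have "dz_dzbar I J v = antisymmetrize (p + q) (\<lambda>v. ?H (v \<circ> inv \<pi>)) v"
      unfolding dz_dzbar_def len wedge_functionals_eq
    proof (rule arg_cong[of _ _ "\<lambda>F. antisymmetrize (p + q) F v"], rule ext)
      fix v :: "nat \<Rightarrow> complex^'n"
      have "?H (v \<circ> inv \<pi>) = (\<Prod>i<p + q. cfunctional (t (\<pi> i)) ((v \<circ> inv \<pi>) (\<pi> i)))"
        by (rule prod.reindex_bij_betw[OF permutes_imp_bij[OF \<pi>(1)], symmetric])
      also have "\<dots> = (\<Prod>i<p + q. cfunctional (t (\<pi> i)) (v i))"
        using permutes_inverses(2)[OF \<pi>(1)] by simp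
      finally show "(\<Prod>i<p + q. if i < p then v i $ I ! i else cnj (v i $ J ! (i - p))) = ?H (v \<circ> inv \<pi>)"
        using \<pi>(2) by (auto simp: cfunctional_def I_def J_def intro!: prod.cong)
    qed
    also have "\<dots> = of_int (sign (inv \<pi>)) * antisymmetrize (p + q) ?H v"
      by (rule antisymmetrize_permuted[OF permutes_inv[OF \<pi>(1)]])
    finally show ?thesis
      using sign_inverse[of \<pi>] \<pi>(1) by (auto simp: wedge_functionals_eq permutation_permutes)
  qed
  then have "wedge_functionals (p + q) (\<lambda>i. cfunctional (t i)) = (\<lambda>v. of_int (sign \<pi>) * dz_dzbar I J v)"
    by (simp add: sign_mult_self)
  then show ?thesis
    using is_pq_covector_cmult[OF is_pq_covector_dz_dzbar[of I J]] len by simp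
qed

definition reim_basis :: "'n::finite \<times> bool \<Rightarrow> complex ^ 'n" where
  "reim_basis s = axis (fst s) (if snd s then 1 else \<i>)"

definition reim_coord :: "complex ^ 'n \<Rightarrow> 'n::finite \<times> bool \<Rightarrow> real" where
  "reim_coord w s = (if snd s then Re (w $ fst s) else Im (w $ fst s))"

lemma sum_prod_bool:
  fixes f :: "'n::finite \<times> bool \<Rightarrow> 'b::comm_monoid_add"
  shows "(\<Sum>s\<in>UNIV. f s) = (\<Sum>j\<in>UNIV. f (j, True) + f (j, False))"
proof -
  have "(\<Sum>s\<in>UNIV. f s) = (\<Sum>s\<in>UNIV \<times> UNIV. f s)" by (simp only: UNIV_Times_UNIV)
  also have "\<dots> = (\<Sum>j\<in>UNIV. \<Sum>b\<in>UNIV. f (j, b))" by (simp only: sum.cartesian_product case_prod_eta)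
  finally show ?thesis by (simp add: UNIV_bool add.commute)
qed

lemma reim_expansion: "w = (\<Sum>s\<in>UNIV. reim_coord w s *\<^sub>R reim_basis s)"
proof (rule vec_eq_iff[THEN iffD2], rule allI)
  fix i
  have "(\<Sum>s\<in>UNIV. reim_coord w s *\<^sub>R reim_basis s) $ i =
      (\<Sum>j\<in>UNIV. if j = i then w $ i else 0)"
    unfolding sum_component sum_prod_bool
    by (rule sum.cong) (auto simp: reim_coord_def reim_basis_def axis_def complex_eq_iff)
  then show "w $ i = (\<Sum>s\<in>UNIV. reim_coord w s *\<^sub>R reim_basis s) $ i" by simp
qed

text \<open>The coefficients in x = (z + cnj z) / 2 and y = (z - cnj z) / (2 \<i>).\<close>

definition reim_matrix :: "'n::finite \<times> bool \<Rightarrow> 'n \<times> bool \<Rightarrow> complex" where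
  "reim_matrix s t = (if fst s = fst t then
     (if snd s then 1 / 2 else if snd t then - \<i> / 2 else \<i> / 2) else 0)"

lemma reim_coord_eq: "of_real (reim_coord w s) = (\<Sum>t\<in>UNIV. reim_matrix s t * cfunctional t w)"
proof -
  have "(\<Sum>t\<in>UNIV. reim_matrix s t * cfunctional t w) =
     (\<Sum>j\<in>UNIV. if j = fst s then of_real (reim_coord w s) else 0)"
    unfolding sum_prod_bool
    by (rule sum.cong) (auto simp: reim_coord_def reim_matrix_def cfunctional_def complex_eq_iff)
  then show ?thesis by simp
qed

text \<open>\<open>F\<close> is only real-linear in each slot, so it is expanded in real coordinates
  first; each of these is then a complex combination of a coordinate and its conjugate.\<close>

lemma altform_cfunctional_expansion:
  fixes F :: "'n::finite covector"
  assumes "altform k F"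
  shows "\<exists>g. \<forall>v. F v = (\<Sum>t\<in>{..<k} \<rightarrow>\<^sub>E UNIV. g t * (\<Prod>i<k. cfunctional (t i) (v i)))"
proof -
  have F: "depends_on_first k F" "slotwise_linear k F" using assms by (auto simp: altform_def)
  let ?B = "{..<k} \<rightarrow>\<^sub>E (UNIV :: ('n \<times> bool) set)"
  let ?g = "\<lambda>t. \<Sum>s\<in>?B. (\<Prod>i<k. reim_matrix (s i) (t i)) * F (\<lambda>i. reim_basis (s i))"
  have "F v = (\<Sum>t\<in>?B. ?g t * (\<Prod>i<k. cfunctional (t i) (v i)))" for v
  proof -
    have "F v = (\<Sum>s\<in>?B. (\<Prod>i<k. of_real (reim_coord (v i) (s i))) * F (\<lambda>i. reim_basis (s i)))"
      by (rule slotwise_expansion[OF F(1)], rule slotwise_linear_step[OF F(2)]) (auto intro: reim_expansion)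
    also have "\<dots> = (\<Sum>s\<in>?B. (\<Sum>t\<in>?B. \<Prod>i<k. reim_matrix (s i) (t i) * cfunctional (t i) (v i)) * F (\<lambda>i. reim_basis (s i)))"
      unfolding reim_coord_eq by (subst prod_sum_PiE) auto
    also have "\<dots> = (\<Sum>t\<in>?B. ?g t * (\<Prod>i<k. cfunctional (t i) (v i)))"
      unfolding sum_distrib_right prod.distrib by (subst sum.swap) (simp add: mult_ac)
    finally show ?thesis .
  qed
  then show ?thesis by (intro exI[of _ ?g]) blast
qed

lemma infinite_unit_circle: "infinite {x :: complex. norm x = 1}"
proof
  assume fin: "finite {x :: complex. norm x = 1}"
  have "cis ` {0<..<pi} \<subseteq> {x. norm x = 1}" by auto
  with fin have "finite (cis ` {0<..<pi})" by (rule rev_finite_subset)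
  moreover have "inj_on cis {0<..<pi}"
    by (rule inj_on_inverseI[where g=Arg]) (auto intro!: Arg_cis)
  ultimately have "finite {0<..<pi}" using finite_imageD by blast
  then show False using infinite_Ioo[of 0 pi] by simp
qed

text \<open>For \<open>norm a = 1\<close>, scaling all arguments by \<open>a\<close> and multiplying
  by \<open>a ^ (p + q)\<close> turns a product of functionals with \<open>m\<close> unconjugated
  factors into \<open>x ^ m\<close> times itself, where \<open>x\<close> is the square of
  \<open>a\<close>. Hence \<open>x ^ p * F v\<close> is a polynomial in \<open>x\<close> on the unit
  circle whose coefficients are the parts of \<open>F v\<close> with \<open>m\<close> unconjugated
  factors. The circle is infinite, so only the part with \<open>m = p\<close> survives.\<close>

theorem is_pq_covectorI:
  fixes F :: "'n::finite covector"
  assumes F: "altform (p + q) F" and w: "pq_weight p q F"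
  shows "is_pq_covector p q F"
proof -
  let ?k = "p + q"
  let ?B = "{..<?k} \<rightarrow>\<^sub>E (UNIV :: ('n \<times> bool) set)"
  define T where "T t = card {i. i < ?k \<and> snd (t i)}" for t :: "nat \<Rightarrow> 'n \<times> bool"
  obtain g where g: "\<And>v. F v = (\<Sum>t\<in>?B. g t * (\<Prod>i<?k. cfunctional (t i) (v i)))"
    using altform_cfunctional_expansion[OF F] by blast
  have finB: "finite ?B" by (intro finite_PiE) auto
  have T_le: "T t \<le> ?k" for t
    using card_mono[of "{..<?k}" "{i. i < ?k \<and> snd (t i)}"] by (auto simp: T_def)
  \<comment> \<open>Each slot takes one of the \<open>?k\<close> factors \<open>a\<close>: it
    cancels the conjugate of \<open>a\<close> or doubles up to the square.\<close>
  have scale: "a ^ ?k * (\<Prod>i<?k. cfunctional (t i) (a *s v i)) = (a\<^sup>2) ^ T t * (\<Prod>i<?k. cfunctional (t i) (v i))"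
    if a: "norm a = 1" for a t and v :: "nat \<Rightarrow> complex^'n"
  proof -
    have aa: "a * cnj a = 1" using a by (simp add: complex_norm_square[symmetric])
    have "a ^ ?k * (\<Prod>i<?k. cfunctional (t i) (a *s v i)) = (\<Prod>i<?k. a * cfunctional (t i) (a *s v i))"
      by (simp add: prod.distrib)
    also have "\<dots> = (\<Prod>i<?k. (if snd (t i) then a\<^sup>2 else 1) * cfunctional (t i) (v i))"
      using aa by (intro prod.cong) (auto simp: cfunctional_def power2_eq_square mult.assoc[symmetric])
    also have "\<dots> = (\<Prod>i<?k. if snd (t i) then a\<^sup>2 else 1) * (\<Prod>i<?k. cfunctional (t i) (v i))"
      by (rule prod.distrib)
    also have "(\<Prod>i<?k. if snd (t i) then a\<^sup>2 else 1) = (a\<^sup>2) ^ T t"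
    proof -
      have "{..<?k} \<inter> {i. snd (t i)} = {i. i < ?k \<and> snd (t i)}" by auto
      then show ?thesis by (simp add: prod.If_cases T_def)
    qed
    finally show ?thesis .
  qed
  define c where "c v m = (\<Sum>t\<in>{t\<in>?B. T t = m}. g t * (\<Prod>i<?k. cfunctional (t i) (v i)))" for v m
  have circle: "(\<Sum>m\<le>?k. (c v m - (if m = p then F v else 0)) * x ^ m) = 0" if x: "norm x = 1" for x v
  proof -
    \<comment> \<open>Every point of the circle has to be reached as a square.\<close>
    define a where "a = csqrt x"
    have a: "a\<^sup>2 = x" "norm a = 1" using x by (simp_all add: a_def norm_csqrt)
    have aa: "a * cnj a = 1" using a by (simp add: complex_norm_square[symmetric])
    have "a ^ ?k * F (\<lambda>i. a *s v i) = a ^ p * (a ^ p * (a * cnj a) ^ q) * F v"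
      using w by (simp add: pq_weight_def power_add power_mult_distrib mult_ac)
    also have "\<dots> = x ^ p * F v"
      by (simp add: aa a(1)[symmetric] power2_eq_square power_mult_distrib)
    finally have 1: "a ^ ?k * F (\<lambda>i. a *s v i) = x ^ p * F v" .
    have "a ^ ?k * F (\<lambda>i. a *s v i) = (\<Sum>t\<in>?B. x ^ T t * (g t * (\<Prod>i<?k. cfunctional (t i) (v i))))"
      unfolding g[of "\<lambda>i. a *s v i"] sum_distrib_left
      by (rule sum.cong[OF refl]) (simp add: scale[OF a(2)] a(1) mult.left_commute)
    also have "\<dots> = (\<Sum>m\<le>?k. \<Sum>t\<in>{t\<in>?B. T t = m}. x ^ T t * (g t * (\<Prod>i<?k. cfunctional (t i) (v i))))"
      by (rule sum.group[symmetric]) (use finB T_le in auto)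
    also have "\<dots> = (\<Sum>m\<le>?k. c v m * x ^ m)"
      unfolding c_def sum_distrib_right by (intro sum.cong refl) (auto simp: mult_ac)
    finally have "(\<Sum>m\<le>?k. c v m * x ^ m) = x ^ p * F v" using 1 by simp
    moreover have "(\<Sum>m\<le>?k. (if m = p then F v else 0) * x ^ m) = x ^ p * F v"
    proof -
      have "(\<Sum>m\<le>?k. (if m = p then F v else 0) * x ^ m) = (\<Sum>m\<le>?k. if m = p then x ^ p * F v else 0)"
        by (rule sum.cong) auto
      then show ?thesis by simp
    qed
    ultimately show ?thesis by (simp add: left_diff_distrib sum_subtractf)
  qed
  have Fc: "F v = c v p" for v
  proof -
    have "infinite {x. (\<Sum>m\<le>?k. (c v m - (if m = p then F v else 0)) * x ^ m) = 0}"
      using circle by (intro infinite_super[OF _ infinite_unit_circle]) auto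
    then have "\<not> (\<exists>m\<le>?k. c v m - (if m = p then F v else 0) \<noteq> 0)"
      using Transcendental.polyfun_finite_roots[where n="?k" and c="\<lambda>m. c v m - (if m = p then F v else 0)"] by metis
    then show ?thesis by auto
  qed
  have "F = (\<lambda>v. (1 / fact ?k) * (\<Sum>t\<in>{t\<in>?B. T t = p}. g t * wedge_functionals ?k (\<lambda>i. cfunctional (t i)) v))"
  proof
    fix v
    \<comment> \<open>The expansion consists of tensor products; antisymmetrizing turns them into
      wedge products and only multiplies the alternating \<open>F\<close> by a factorial.\<close>
    have "fact ?k * F v = antisymmetrize ?k F v"
      using F by (simp add: antisymmetrize_alternating altform_def)
    also have "\<dots> = antisymmetrize ?k (\<lambda>v. c v p) v" by (simp add: Fc[abs_def, symmetric])
    also have "\<dots> = (\<Sum>t\<in>{t\<in>?B. T t = p}. g t * wedge_functionals ?k (\<lambda>i. cfunctional (t i)) v)"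
      unfolding c_def antisymmetrize_sum antisymmetrize_cmult wedge_functionals_eq ..
    finally show "F v = (1 / fact ?k) * (\<Sum>t\<in>{t\<in>?B. T t = p}. g t * wedge_functionals ?k (\<lambda>i. cfunctional (t i)) v)"
      by (simp add: field_simps)
  qed
  moreover have "is_pq_covector p q (\<lambda>v. (1 / fact ?k) * (\<Sum>t\<in>{t\<in>?B. T t = p}. g t * wedge_functionals ?k (\<lambda>i. cfunctional (t i)) v))"
    by (intro is_pq_covector_cmult is_pq_covector_sum is_pq_covector_wedge_cfunctional) (auto simp: T_def)
  ultimately show ?thesis by simp
qed

lemma is_pq_covector_iff: "is_pq_covector p q F \<longleftrightarrow> altform (p + q) F \<and> pq_weight p q F"
  using is_pq_covector_imp is_pq_covectorI by blast

text \<open>By the pigeonhole principle one of the two index lists has a repetition. The wedge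
  product then has two equal factors, and its tensor is unchanged when their slots are
  swapped.\<close>

lemma is_pq_covector_gt_zero:
  fixes F :: "'n::finite covector"
  assumes "is_pq_covector p q F" "p > CARD('n) \<or> q > CARD('n)"
  shows "F v = 0"
proof -
  have "dz_dzbar I J v = 0" if len: "length I = p" "length J = q" for I J :: "'n list" and v
  proof -
    define \<theta> where "\<theta> i w = (if i < length I then w $ (I ! i) else cnj (w $ (J ! (i - length I))))"
      for i and w :: "complex^'n"
    have "\<not> (distinct I \<and> distinct J)"
    proof
      assume d: "distinct I \<and> distinct J"
      have "card (set I) \<le> CARD('n)" "card (set J) \<le> CARD('n)" by (auto intro: card_mono)
      with d len assms(2) show False by (simp add: distinct_card)
    qed
    then obtain i j where ij: "i < p + q" "j < p + q" "i \<noteq> j" "\<theta> i = \<theta> j"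
    proof (cases "distinct I")
      case False
      then obtain i j where "i < length I" "j < length I" "i \<noteq> j" "I ! i = I ! j"
        by (auto simp: distinct_conv_nth)
      with len show ?thesis by (intro that[of i j]) (auto simp: \<theta>_def fun_eq_iff)
    next
      case True
      with \<open>\<not> (distinct I \<and> distinct J)\<close> obtain i j where "i < length J" "j < length J" "i \<noteq> j" "J ! i = J ! j"
        by (auto simp: distinct_conv_nth)
      with len show ?thesis by (intro that[of "p + i" "p + j"]) (auto simp: \<theta>_def fun_eq_iff)
    qed
    define t where "t = Transposition.transpose i j"
    have t: "t permutes {..<p + q}" unfolding t_def using ij by (intro permutes_swap_id) auto
    have "(\<Prod>l<p + q. \<theta> l ((v \<circ> t) l)) = (\<Prod>l<p + q. \<theta> l (v l))" for v :: "nat \<Rightarrow> complex^'n"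
    proof -
      have "(\<Prod>l<p + q. \<theta> l ((v \<circ> t) l)) = (\<Prod>l<p + q. \<theta> (t l) ((v \<circ> t) l))"
        using ij(4) by (intro prod.cong) (auto simp: t_def Transposition.transpose_def)
      also have "\<dots> = (\<Prod>l<p + q. \<theta> l (v l))"
        unfolding comp_def using prod.reindex_bij_betw[OF permutes_imp_bij[OF t], of "\<lambda>l. \<theta> l (v l)"] .
      finally show ?thesis .
    qed
    then have "wedge_functionals (p + q) \<theta> v = 0" unfolding wedge_functionals_eq t_def
      by (intro antisymmetrize_symmetric[OF ij(1-3)]) blast
    then show ?thesis by (simp add: dz_dzbar_def len \<theta>_def[abs_def])
  qed
  then show ?thesis using assms(1) by (auto simp: is_pq_covector_def)
qed

subsection \<open>Determinants and forms of top degree\<close>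

text \<open>\<open>det\<close> is indexed by a finite type and slots are natural numbers; this
  carries the Leibniz formula from one to the other.\<close>

lemma det_reindex:
  fixes e :: "'k::finite \<Rightarrow> nat" and M :: "nat \<Rightarrow> nat \<Rightarrow> 'a::comm_ring_1"
  assumes e: "bij_betw e UNIV {..<m}"
  shows "det (\<chi> i j. M (e i) (e j) :: 'a^'k^'k) = (\<Sum>\<sigma> | \<sigma> permutes {..<m}. of_int (sign \<sigma>) * (\<Prod>i<m. M i (\<sigma> i)))"
proof -
  have inj: "inj e" using e by (rule bij_betw_imp_inj_on)
  let ?mp = "map_permutation UNIV e"
  have eq: "?mp = (\<lambda>\<pi> x. if x \<in> {..<m} then e (\<pi> (inv_into UNIV e x)) else x)"
    using bij_betw_imp_surj_on[OF e] by (auto simp: fun_eq_iff map_permutation_def restrict_id_def)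
  have bij: "bij_betw ?mp {p. p permutes UNIV} {\<sigma>. \<sigma> permutes {..<m}}"
    unfolding eq by (rule bij_betw_permutations[OF e])
  have "(\<Sum>\<sigma> | \<sigma> permutes {..<m}. of_int (sign \<sigma>) * (\<Prod>i<m. M i (\<sigma> i)))
      = (\<Sum>p | p permutes UNIV. of_int (sign (?mp p)) * (\<Prod>i<m. M i (?mp p i)))"
    by (rule sum.reindex_bij_betw[OF bij, symmetric])
  also have "\<dots> = (\<Sum>p | p permutes UNIV. of_int (sign p) * (\<Prod>i\<in>UNIV. M (e i) (e (p i))))"
  proof (intro sum.cong refl arg_cong2[where f="(*)"])
    fix p :: "'k \<Rightarrow> 'k" assume "p \<in> {p. p permutes UNIV}"
    then show "of_int (sign (?mp p)) = (of_int (sign p) :: 'a)"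
      using sign_map_permutation[OF inj, of p] by simp
    show "(\<Prod>i<m. M i (?mp p i)) = (\<Prod>i\<in>UNIV. M (e i) (e (p i)))"
      by (subst prod.reindex_bij_betw[OF e, symmetric]) (simp add: map_permutation_apply[OF inj])
  qed
  finally show ?thesis by (simp add: det_def)
qed

lemma coord_list: "distinct (coord_list :: 'n::finite list)" "set (coord_list :: 'n list) = UNIV"
proof -
  obtain xs :: "'n list" where "set xs = UNIV" "distinct xs"
    using finite_distinct_list[of "UNIV :: 'n set"] by auto
  then have "\<exists>xs :: 'n list. distinct xs \<and> set xs = UNIV" by blast
  then show "distinct (coord_list :: 'n list)" "set (coord_list :: 'n list) = UNIV"
    unfolding coord_list_def by (metis (mono_tags, lifting) someI_ex)+
qed

lemma length_coord_list: "length (coord_list :: 'n::finite list) = CARD('n)"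
  using distinct_card[OF coord_list(1)[where 'n='n]] by (simp add: coord_list(2))

lemma bij_betw_coord_list: "bij_betw ((!) (coord_list :: 'n::finite list)) {..<CARD('n)} UNIV"
  using bij_betw_nth[OF coord_list(1) refl refl] by (simp add: length_coord_list coord_list(2))

section \<open>Coordinates and determinants with respect to the real frame\<close>

definition frame_coord :: "complex ^ 'n::finite \<Rightarrow> nat \<Rightarrow> real" where
  "frame_coord w j = (if even j then Re else Im) (w $ (coord_list ! (j div 2)))"

lemma sum_lessThan_double:
  "(\<Sum>j<2 * n. f j :: 'b::comm_monoid_add) = (\<Sum>i<n. f (2 * i) + f (Suc (2 * i)))"
  by (induction n) (auto simp: add_ac)

lemma sum_frame:
  fixes f :: "nat \<Rightarrow> 'b::comm_monoid_add" and g :: "'n::finite \<Rightarrow> 'b"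
  assumes "\<And>i. i < CARD('n) \<Longrightarrow> f (2 * i) + f (Suc (2 * i)) = g (coord_list ! i)"
  shows "(\<Sum>j<2 * CARD('n). f j) = (\<Sum>k\<in>UNIV. g k)"
  unfolding sum_lessThan_double
  by (subst sum.reindex_bij_betw[OF bij_betw_coord_list, symmetric]) (simp add: assms)

lemma frame_expansion:
  fixes w :: "complex ^ 'n::finite"
  shows "w = (\<Sum>j<2 * CARD('n). frame_coord w j *\<^sub>R real_frame j)"
proof (rule vec_eq_iff[THEN iffD2], rule allI)
  fix k :: 'n
  have "(\<Sum>j<2 * CARD('n). frame_coord w j *\<^sub>R real_frame j) $ k = (\<Sum>l\<in>UNIV. if l = k then w $ k else 0)"
    unfolding sum_component
    by (rule sum_frame) (auto simp: frame_coord_def real_frame_def axis_def complex_eq_iff)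
  then show "w $ k = (\<Sum>j<2 * CARD('n). frame_coord w j *\<^sub>R real_frame j) $ k" by simp
qed

text \<open>The determinant of the real-linear map \<open>L\<close> in the basis \<open>real_frame\<close>.\<close>

definition frame_det :: "(complex ^ 'n::finite \<Rightarrow> complex ^ 'n) \<Rightarrow> real" where
  "frame_det L = (\<Sum>\<sigma> | \<sigma> permutes {..<2 * CARD('n)}.
     of_int (sign \<sigma>) * (\<Prod>i<2 * CARD('n). frame_coord (L (real_frame i)) (\<sigma> i)))"

text \<open>The coefficients of \<open>top_expansion\<close> on the vectors
  \<open>L (real_frame i)\<close> form exactly the Leibniz sum in \<open>frame_det\<close>.\<close>

lemma altform_top:
  fixes F :: "'n::finite covector"
  assumes "altform (2 * CARD('n)) F"
  shows "F (\<lambda>i. L (real_frame i)) = of_real (frame_det L) * F real_frame"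
proof -
  have "F v = (\<Sum>\<sigma> | \<sigma> permutes {..<2 * CARD('n)}. of_int (sign \<sigma>) *
      (\<Prod>i<2 * CARD('n). of_real (frame_coord (v i) (\<sigma> i)))) * F real_frame" for v
    using assms unfolding altform_def
    by (intro top_expansion slotwise_linear_step) (auto intro: frame_expansion)
  from this[of "\<lambda>i. L (real_frame i)"] show ?thesis by (simp add: frame_det_def)
qed

text \<open>\<open>cvolume\<close> is \<open>dz\<^sub>1 \<and> \<dots> \<and> dz\<^sub>n\<close>, and \<open>rvolume\<close> is, up to a factor, its wedge
  product with its conjugate.\<close>

definition cvolume :: "'n::finite covector" where
  "cvolume = wedge_functionals CARD('n) (\<lambda>i w. w $ (coord_list ! i))"

text \<open>The value of \<open>cvolume\<close> is the determinant of the matrix with the given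
  vectors as columns. Since \<open>L\<close> is complex-linear, it acts on the columns by
  multiplication with \<open>matrix L\<close>.\<close>

lemma cvolume_map:
  fixes L :: "complex ^ 'n::finite \<Rightarrow> complex ^ 'n"
  assumes L: "linear L" "\<And>a v. L (a *s v) = a *s L v"
  shows "cvolume (\<lambda>i. L (v i)) = det (matrix L) * cvolume v"
proof -
  let ?n = "CARD('n)"
  define e where "e = inv_into {..<?n} ((!) (coord_list :: 'n list))"
  have e: "bij_betw e UNIV {..<?n}" unfolding e_def by (rule bij_betw_inv_into[OF bij_betw_coord_list])
  have ce: "coord_list ! e a = a" for a
    unfolding e_def using bij_betw_coord_list by (auto intro!: f_inv_into_f simp: bij_betw_def)
  have vol: "cvolume v = det (\<chi> a b. v (e b) $ a)" for v :: "nat \<Rightarrow> complex^'n"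
    using det_reindex[OF e, of "\<lambda>i j. v j $ (coord_list ! i)"]
    by (simp add: cvolume_def wedge_functionals_def ce)
  have "Vector_Spaces.linear (*s) (*s) L"
    using L by (intro Vector_Spaces.linear.intro module_hom.intro vec.vector_space_axioms
       module_hom_axioms.intro vec.module_axioms) (auto simp: linear_add)
  then have "L w = matrix L *v w" for w by (simp add: matrix_works)
  then have "(\<chi> a b. L (v (e b)) $ a) = matrix L ** (\<chi> a b. v (e b) $ a)"
    by (simp add: vec_eq_iff matrix_vector_mult_def matrix_matrix_mult_def)
  then show ?thesis by (simp add: vol det_mul)
qed

definition rvolume :: "'n::finite covector" where
  "rvolume = antisymmetrize (CARD('n) + CARD('n)) (\<lambda>v. cvolume v * cnj (cvolume (\<lambda>i. v (CARD('n) + i))))"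

lemma altform_cvolume: "altform CARD('n) (cvolume :: 'n::finite covector)"
  unfolding cvolume_def by (rule altform_wedge_functionals) (rule linear_nth)

lemma cnj_cvolume:
  "cnj (cvolume v) = wedge_functionals CARD('n) (\<lambda>i w. cnj (w $ (coord_list ! i))) (v :: nat \<Rightarrow> complex^'n::finite)"
  by (simp add: cvolume_def wedge_functionals_def)

lemma altform_cnj_cvolume: "altform CARD('n) (\<lambda>v. cnj (cvolume (v :: nat \<Rightarrow> complex^'n::finite)))"
  unfolding cnj_cvolume by (rule altform_wedge_functionals) (rule linear_cnj_nth)

lemma altform_rvolume: "altform (2 * CARD('n)) (rvolume :: 'n::finite covector)"
  unfolding rvolume_def mult_2
  using altform_cvolume[where 'n='n] altform_cnj_cvolume[where 'n='n]
    slotwise_linear_tensor[of "CARD('n)" cvolume "CARD('n)" "\<lambda>v. cnj (cvolume v)"]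
    depends_on_first_tensor[of "CARD('n)" cvolume "CARD('n)" "\<lambda>v. cnj (cvolume v)"]
  by (intro altform_antisymmetrize) (auto simp: altform_def)

lemma rvolume_map:
  fixes L :: "complex ^ 'n::finite \<Rightarrow> complex ^ 'n"
  assumes L: "linear L" "\<And>a v. L (a *s v) = a *s L v"
  shows "rvolume (\<lambda>i. L (v i)) = of_real ((norm (det (matrix L)))\<^sup>2) * rvolume v"
proof -
  have "rvolume (\<lambda>i. L (v i)) = det (matrix L) * cnj (det (matrix L)) * rvolume v"
    unfolding rvolume_def antisymmetrize_def sum_distrib_left
    by (intro sum.cong refl) (simp add: comp_def cvolume_map[OF L])
  then show ?thesis by (simp only: complex_norm_square)
qed

text \<open>Needed to cancel \<open>rvolume\<close> when the real and the complex Jacobian are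
  compared. The value is a multiple, by the square of \<open>fact CARD('n)\<close>, of the
  determinant of all coordinates and their conjugates on the real frame. That matrix is invertible,
  because real and imaginary parts can be recovered from them.\<close>

lemma rvolume_real_frame: "rvolume (real_frame :: nat \<Rightarrow> complex ^ 'n::finite) \<noteq> 0"
proof -
  let ?n = "CARD('n)"
  let ?H = "\<lambda>v :: nat \<Rightarrow> complex^'n. \<Prod>i<?n. v i $ (coord_list ! i)"
  let ?H' = "\<lambda>v :: nat \<Rightarrow> complex^'n. \<Prod>i<?n. cnj (v i $ (coord_list ! i))"
  define \<theta> where "\<theta> i w = (if i < ?n then w $ (coord_list ! i) else cnj (w $ (coord_list ! (i - ?n))))"
    for i and w :: "complex^'n"
  \<comment> \<open>The antisymmetrizations inside the two factors \<open>cvolume\<close> are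
    absorbed in turn, each at the cost of \<open>fact ?n\<close>; the wedge product of all the
    \<open>\<theta> i\<close> remains.\<close>
  have "rvolume v = fact ?n * antisymmetrize (?n + ?n) (\<lambda>v. cvolume v * ?H' (\<lambda>i. v (?n + i))) v" for v :: "nat \<Rightarrow> complex^'n"
  proof -
    have "rvolume v = antisymmetrize (?n + ?n) (\<lambda>v. antisymmetrize ?n (\<lambda>u. cvolume v * ?H' u) (\<lambda>i. v (?n + i))) v"
      by (simp only: rvolume_def cnj_cvolume wedge_functionals_eq antisymmetrize_cmult)
    also have "\<dots> = fact ?n * antisymmetrize (?n + ?n) (\<lambda>v. cvolume v * ?H' (\<lambda>i. v (?n + i))) v"
    proof (rule antisymmetrize_block)
      fix \<tau> and v u :: "nat \<Rightarrow> complex^'n"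
      have "cvolume (v \<circ> shift_perm ?n \<tau>) = (cvolume v :: complex)" for v :: "nat \<Rightarrow> complex^'n"
        by (rule depends_on_firstD[OF altform_cvolume[unfolded altform_def, THEN conjunct1]])
          (simp add: shift_perm_def)
      then show "cvolume (v \<circ> shift_perm ?n \<tau>) * ?H' u = cvolume v * ?H' u" by simp
    qed simp
    finally show ?thesis .
  qed
  moreover have "antisymmetrize (?n + ?n) (\<lambda>v. cvolume v * ?H' (\<lambda>i. v (?n + i))) v
     = fact ?n * antisymmetrize (?n + ?n) (\<lambda>v. ?H v * ?H' (\<lambda>i. v (?n + i))) v" for v :: "nat \<Rightarrow> complex^'n"
  proof -
    have "antisymmetrize (?n + ?n) (\<lambda>v. cvolume v * ?H' (\<lambda>i. v (?n + i))) v
        = antisymmetrize (?n + ?n) (\<lambda>v. antisymmetrize ?n (\<lambda>u. ?H' (\<lambda>i. v (?n + i)) * ?H u) (\<lambda>i. v (0 + i))) v"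
      by (simp only: antisymmetrize_cmult add_0 cvolume_def wedge_functionals_eq) (simp only: mult.commute)
    also have "\<dots> = fact ?n * antisymmetrize (?n + ?n) (\<lambda>v. ?H' (\<lambda>i. v (?n + i)) * ?H (\<lambda>i. v (0 + i))) v"
    proof (rule antisymmetrize_block)
      fix \<tau> v u assume "\<tau> permutes {..<?n}"
      then have "\<tau> (?n + i) = ?n + i" for i by (rule permutes_not_in) simp
      then show "?H' (\<lambda>i. (v \<circ> shift_perm 0 \<tau>) (?n + i)) * ?H u = ?H' (\<lambda>i. v (?n + i)) * ?H u"
        by (simp add: shift_perm_def)
    qed simp
    finally show ?thesis by (simp add: mult.commute)
  qed
  moreover have "?H v * ?H' (\<lambda>i. v (?n + i)) = (\<Prod>i<?n + ?n. \<theta> i (v i))" for v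
    by (simp add: prod_lessThan_add \<theta>_def)
  ultimately have 1: "rvolume v = fact ?n * fact ?n * wedge_functionals (?n + ?n) \<theta> v" for v
    by (simp add: wedge_functionals_eq)
  \<comment> \<open>A type with \<open>2 * CARD('n)\<close> elements, over which \<open>det\<close>
    can be formed.\<close>
  have "card (UNIV :: 'n bit0 set) = card {..<?n + ?n}" by simp
  then obtain e :: "'n bit0 \<Rightarrow> nat" where e: "bij_betw e UNIV {..<?n + ?n}"
    using finite_same_card_bij[of "UNIV :: 'n bit0 set" "{..<?n + ?n}"] by auto
  txt \<open>\<open>R\<close> is the inverse of \<open>Q\<close>; it expresses \<open>x\<^sub>j\<close> and \<open>y\<^sub>j\<close> through \<open>z\<^sub>j\<close> and its conjugate.\<close>
  define R :: "nat \<Rightarrow> nat \<Rightarrow> complex" where "R j k = (if j div 2 = (if k < ?n then k else k - ?n)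
     then (if even j then 1 / 2 else if k < ?n then - \<i> / 2 else \<i> / 2) else 0)" for j k
  define Q :: "complex^'n bit0^'n bit0" where "Q = (\<chi> i j. \<theta> (e i) (real_frame (e j)))"
  have QR: "(\<Sum>j<?n + ?n. \<theta> i (real_frame j) * R j k) = (if i = k then 1 else 0)"
    if i: "i < ?n + ?n" and k: "k < ?n + ?n" for i k
  proof -
    define i' where "i' = (if i < ?n then i else i - ?n)"
    have i': "i' < ?n" using i by (auto simp: i'_def)
    have inj: "coord_list ! l = (coord_list ! i' :: 'n) \<longleftrightarrow> l = i'" if "l < ?n" for l
      using nth_eq_iff_index_eq[OF coord_list(1)[where 'n='n]] that i' by (simp add: length_coord_list)
    have \<theta>: "\<theta> i w = (if i < ?n then w $ (coord_list ! i') else cnj (w $ (coord_list ! i')))" for w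
      by (simp add: \<theta>_def i'_def)
    have "(\<Sum>j<?n + ?n. \<theta> i (real_frame j) * R j k) =
       (\<Sum>l<?n. if l = i' then (if i = k then 1 else 0) else 0)"
      unfolding mult_2[symmetric] sum_lessThan_double
    proof (rule sum.cong[OF refl])
      fix l assume "l \<in> {..<?n}"
      then have l: "l < ?n" by simp
      show "\<theta> i (real_frame (2 * l)) * R (2 * l) k + \<theta> i (real_frame (Suc (2 * l))) * R (Suc (2 * l)) k
          = (if l = i' then (if i = k then 1 else 0) else 0)"
      proof (cases "l = i'")
        case True
        then show ?thesis using i k
          by (auto simp: \<theta> real_frame_def R_def i'_def split: if_splits)
      next
        case False
        with inj[OF l] have "coord_list ! l \<noteq> (coord_list ! i' :: 'n)" by simp
        then show ?thesis using False by (simp add: \<theta> real_frame_def axis_def)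
      qed
    qed
    then show ?thesis using i' by simp
  qed
  have "(Q ** (\<chi> i j. R (e i) (e j))) $ i $ j = mat 1 $ i $ j" for i j
  proof -
    have "(Q ** (\<chi> i j. R (e i) (e j))) $ i $ j = (\<Sum>l\<in>UNIV. \<theta> (e i) (real_frame (e l)) * R (e l) (e j))"
      by (simp add: Q_def matrix_matrix_mult_def)
    also have "\<dots> = (\<Sum>l<?n + ?n. \<theta> (e i) (real_frame l) * R l (e j))"
      by (rule sum.reindex_bij_betw[OF e])
    also have "\<dots> = (if e i = e j then 1 else 0)"
      using bij_betwE[OF e] by (intro QR) auto
    also have "\<dots> = mat 1 $ i $ j"
      using bij_betw_imp_inj_on[OF e] by (auto simp: mat_def dest: injD)
    finally show ?thesis .
  qed
  then have "Q ** (\<chi> i j. R (e i) (e j)) = mat 1" by (simp add: vec_eq_iff)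
  then have "det Q * det (\<chi> i j. R (e i) (e j) :: complex^'n bit0^'n bit0) = 1"
    by (metis det_mul det_I)
  then have "det Q \<noteq> 0" by auto
  moreover have "det Q = wedge_functionals (?n + ?n) \<theta> real_frame"
    unfolding Q_def wedge_functionals_def by (rule det_reindex[OF e])
  ultimately show ?thesis using 1 by simp
qed

text \<open>The real Jacobian of a complex-linear map is the squared modulus of the complex one.\<close>

lemma frame_det_nonneg:
  fixes L :: "complex ^ 'n::finite \<Rightarrow> complex ^ 'n"
  assumes L: "linear L" "\<And>a v. L (a *s v) = a *s L v"
  shows "0 \<le> frame_det L"
proof -
  have "of_real ((norm (det (matrix L)))\<^sup>2) * rvolume (real_frame :: nat \<Rightarrow> complex ^ 'n) = of_real (frame_det L) * rvolume (real_frame :: nat \<Rightarrow> complex ^ 'n)"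
    unfolding rvolume_map[OF L, symmetric] by (rule altform_top[OF altform_rvolume])
  then have "frame_det L = (norm (det (matrix L)))\<^sup>2"
    using rvolume_real_frame[where 'n='n] by (metis mult_right_cancel of_real_eq_iff)
  then show ?thesis by simp
qed

section \<open>The operators \<open>\<partial>\<close> and \<open>\<partial>\<close>-bar in a chart\<close>

text \<open>Both are treated simultaneously: \<open>\<epsilon> = 1\<close> gives \<open>\<partial>\<close>, and \<open>\<epsilon> = -1\<close> gives its conjugate.\<close>

definition Dop :: "complex \<Rightarrow> (complex ^ 'n::finite \<Rightarrow> complex) \<Rightarrow> complex ^ 'n \<Rightarrow> complex ^ 'n \<Rightarrow> complex" where
  "Dop \<epsilon> f z w = (frechet_derivative f (at z) w - \<epsilon> * \<i> * frechet_derivative f (at z) (\<i> *s w)) / 2"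

lemma D10_eq: "D10 f z w = Dop 1 f z w" and D01_eq: "D01 f z w = Dop (- 1) f z w"
  by (simp_all add: D10_def D01_def Dop_def)

lemma linear_vector_mult: "linear (\<lambda>w::complex^'n::finite. a *s w)"
  by (intro linearI) (simp_all add: vec_eq_iff algebra_simps)

lemma bounded_linear_vector_mult: "bounded_linear (\<lambda>w::complex^'n::finite. a *s w)"
  using linear_vector_mult by (rule linear_conv_bounded_linear[THEN iffD1])

lemma Dop_eq:
  assumes "(f has_derivative D) (at z)"
  shows "Dop \<epsilon> f z w = (D w - \<epsilon> * \<i> * D (\<i> *s w)) / 2"
  using frechet_derivative_eq[OF assms] by (simp add: Dop_def)

lemma linear_Dop:
  assumes "f differentiable (at z)"
  shows "linear (Dop \<epsilon> f z)"
proof -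
  have l: "linear (frechet_derivative f (at z))" by (rule linear_frechet_derivative[OF assms])
  have l': "linear (\<lambda>w. frechet_derivative f (at z) (\<i> *s w))"
    using linear_compose[OF linear_vector_mult l] by (simp add: comp_def)
  have "linear (\<lambda>w. (1 / 2) * (frechet_derivative f (at z) w - (\<epsilon> * \<i>) * frechet_derivative f (at z) (\<i> *s w)))"
    by (intro linear_cmult linear_compose_sub l l')
  then show ?thesis by (simp add: Dop_def[abs_def])
qed

lemma Dop_cong:
  assumes "open S" "z \<in> S" "\<And>y. y \<in> S \<Longrightarrow> f y = g y"
  shows "Dop \<epsilon> f z w = Dop \<epsilon> g z w"
  using frechet_derivative_cong_open(1)[of S z f g, OF assms] by (simp add: Dop_def)

lemma Dop_const: "Dop \<epsilon> (\<lambda>y. c) z w = 0"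
  by (subst Dop_eq[OF has_derivative_const]) simp

lemma Dop_add:
  assumes "f differentiable (at z)" "g differentiable (at z)"
  shows "Dop \<epsilon> (\<lambda>y. f y + g y) z w = Dop \<epsilon> f z w + Dop \<epsilon> g z w"
  using assms unfolding frechet_derivative_works
  by (subst Dop_eq[OF has_derivative_add]) (auto simp: Dop_def field_simps)

lemma Dop_sum:
  assumes "\<And>i. i \<in> I \<Longrightarrow> f i differentiable (at z)"
  shows "Dop \<epsilon> (\<lambda>y. \<Sum>i\<in>I. f i y) z w = (\<Sum>i\<in>I. Dop \<epsilon> (f i) z w)"
  using assms
proof (induction I rule: infinite_finite_induct)
  case (insert x F)
  then have "(\<lambda>y. \<Sum>i\<in>F. f i y) differentiable (at z)" by (intro differentiable_sum) auto
  with insert show ?case by (simp add: Dop_add)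
qed (simp_all add: Dop_const)

lemma Dop_mult:
  assumes "f differentiable (at z)" "g differentiable (at z)"
  shows "Dop \<epsilon> (\<lambda>y. f y * g y) z w = Dop \<epsilon> f z w * g z + f z * Dop \<epsilon> g z w"
  using assms unfolding frechet_derivative_works
  by (subst Dop_eq[OF has_derivative_mult]) (auto simp: Dop_def field_simps)

lemma Dop_cmult:
  assumes "f differentiable (at z)"
  shows "Dop \<epsilon> (\<lambda>y. c * f y) z w = c * Dop \<epsilon> f z w"
  using Dop_mult[OF differentiable_const assms, of \<epsilon> c w] by (simp add: Dop_const)

text \<open>Here the two values of \<open>\<epsilon>\<close> part ways: one operator is
  complex-linear in the direction, the other antilinear, which decides whether \<open>p\<close> or
  \<open>q\<close> grows in \<open>dd_forms\<close>.\<close>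

lemma Dop_scale:
  assumes f: "f differentiable (at z)"
  shows "Dop 1 f z (a *s w) = a * Dop 1 f z w" "Dop (- 1) f z (a *s w) = cnj a * Dop (- 1) f z w"
proof -
  let ?D = "frechet_derivative f (at z)"
  have l: "linear ?D" by (rule linear_frechet_derivative[OF f])
  have e: "a *s w = Re a *\<^sub>R w + Im a *\<^sub>R (\<i> *s w)" for a w
    by (simp add: vec_eq_iff) (simp add: complex_eq_iff)
  have D: "?D (a *s w) = Re a * ?D w + Im a * ?D (\<i> *s w)" for a w
    unfolding e[of a w] by (simp only: linear_add[OF l] linear_of_real_mult[OF l])
  have i: "\<i> *s (a *s w) = (\<i> * a) *s w" by (simp add: vec_eq_iff)
  show "Dop 1 f z (a *s w) = a * Dop 1 f z w" "Dop (- 1) f z (a *s w) = cnj a * Dop (- 1) f z w"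
    unfolding Dop_def i D[of a w] D[of "\<i> * a" w] by (simp_all add: complex_eq_iff algebra_simps)
qed

lemma smooth_on_divide_const: "open S \<Longrightarrow> smooth_on S f \<Longrightarrow> smooth_on S (\<lambda>x. f x / (c::complex))"
  using smooth_on_mult[of S f "\<lambda>_. inverse c"] by (simp add: smooth_on_const divide_inverse)

lemma smooth_on_diff:
  "open S \<Longrightarrow> smooth_on S f \<Longrightarrow> smooth_on S g \<Longrightarrow> smooth_on S (\<lambda>x. f x - g x)"
  using smooth_on_add[of S f "\<lambda>x. - g x"] smooth_on_minus by auto

lemma smooth_on_Dop:
  assumes "open S" "smooth_on S f"
  shows "smooth_on S (\<lambda>z. Dop \<epsilon> f z w)"
  unfolding Dop_def
  by (intro smooth_on_divide_const smooth_on_diff smooth_on_mult smooth_on_const assms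
      smooth_on_frechet_derivative)

text \<open>Both operators are combinations of directional derivatives with constant coefficients,
  so the symmetry of second derivatives is all that is used.\<close>

lemma Dop_swap:
  assumes S: "open S" "z \<in> S" and f: "smooth_on S f"
  shows "Dop \<epsilon> (\<lambda>y. Dop \<delta> f y b) z a = Dop \<delta> (\<lambda>y. Dop \<epsilon> f y a) z b"
proof -
  let ?D = "\<lambda>b y. frechet_derivative f (at y) b"
  let ?H = "\<lambda>b a. frechet_derivative (?D b) (at z) a"
  have d: "(?D b has_derivative ?H b) (at z)" for b
    by (rule smooth_on_has_derivative[OF smooth_on_frechet_derivative[OF f] S(2)])
  have 1: "((\<lambda>y. Dop \<delta> f y b) has_derivative (\<lambda>a. (?H b a - \<delta> * \<i> * ?H (\<i> *s b) a) / 2)) (at z)" for \<delta> b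
    unfolding Dop_def by (auto intro!: derivative_eq_intros d)
  have sym: "?H a b = ?H b a" for a b
    by (rule second_derivative_symmetric[OF S smooth_onD[OF f]])
  have 2: "Dop \<epsilon> (\<lambda>y. Dop \<delta> f y b) z a = (?H b a - \<delta> * \<i> * ?H (\<i> *s b) a - \<epsilon> * \<i> * (?H b (\<i> *s a) - \<delta> * \<i> * ?H (\<i> *s b) (\<i> *s a))) / 4" for \<epsilon> \<delta> a b
    by (subst Dop_eq[OF 1]) (simp add: field_simps)
  show ?thesis unfolding 2 sym[of b a] sym[of "\<i> *s b"] sym[of b "\<i> *s a"] by (simp add: algebra_simps)
qed

definition locform :: "nat \<Rightarrow> (complex ^ 'n::finite) set \<Rightarrow> (complex ^ 'n \<Rightarrow> 'n covector) \<Rightarrow> bool" where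
  "locform k U \<omega> \<longleftrightarrow> (\<forall>z\<in>U. altform k (\<omega> z)) \<and> (\<forall>v. smooth_on U (\<lambda>z. \<omega> z v))"

definition dloc :: "complex \<Rightarrow> nat \<Rightarrow> (complex ^ 'n::finite \<Rightarrow> 'n covector) \<Rightarrow> complex ^ 'n \<Rightarrow> 'n covector" where
  "dloc \<epsilon> k \<omega> z v = (\<Sum>i\<le>k. (- 1) ^ i * Dop \<epsilon> (\<lambda>y. \<omega> y (omit i v)) z (v i))"

lemma locform_altform: "locform k U \<omega> \<Longrightarrow> z \<in> U \<Longrightarrow> altform k (\<omega> z)"
  by (simp add: locform_def)

lemma locform_smooth: "locform k U \<omega> \<Longrightarrow> smooth_on U (\<lambda>z. \<omega> z v)"
  by (simp add: locform_def)

lemma locform_differentiable: "locform k U \<omega> \<Longrightarrow> z \<in> U \<Longrightarrow> (\<lambda>z. \<omega> z v) differentiable (at z)"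
  by (rule smooth_on_differentiable[OF locform_smooth])

lemma locform_depends: "locform k U \<omega> \<Longrightarrow> z \<in> U \<Longrightarrow> (\<And>i. i < k \<Longrightarrow> v i = w i) \<Longrightarrow> \<omega> z v = \<omega> z w"
  using locform_altform unfolding altform_def by (blast intro: depends_on_firstD)

lemma dloc_cong:
  assumes "open S" "z \<in> S" "\<And>y. y \<in> S \<Longrightarrow> \<omega> y = \<eta> y"
  shows "dloc \<epsilon> k \<omega> z v = dloc \<epsilon> k \<eta> z v"
  unfolding dloc_def by (intro sum.cong refl arg_cong2[where f="(*)"] Dop_cong[OF assms(1,2)]) (simp add: assms(3))

lemma altform_Dop:
  assumes U: "open U" "z \<in> U" and \<omega>: "locform k U \<omega>"
  shows "altform k (\<lambda>u. Dop \<epsilon> (\<lambda>y. \<omega> y u) z w)"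
  unfolding altform_def
proof (intro conjI)
  note a = locform_altform[OF \<omega>, unfolded altform_def]
  note d = locform_differentiable[OF \<omega> U(2)]
  show "depends_on_first k (\<lambda>u. Dop \<epsilon> (\<lambda>y. \<omega> y u) z w)"
    unfolding depends_on_first_def by (intro allI impI Dop_cong[OF U] locform_depends[OF \<omega>]) auto
  show "slotwise_linear k (\<lambda>u. Dop \<epsilon> (\<lambda>y. \<omega> y u) z w)"
  proof (unfold slotwise_linear_def, intro allI impI linearI)
    fix i v and b c :: "complex^'a" and r :: real assume i: "i < k"
    have l: "linear (\<lambda>u. \<omega> y (v(i := u)))" if "y \<in> U" for y
      using a[OF that] i slotwise_linearD by blast
    have "Dop \<epsilon> (\<lambda>y. \<omega> y (v(i := b + c))) z w = Dop \<epsilon> (\<lambda>y. \<omega> y (v(i := b)) + \<omega> y (v(i := c))) z w"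
      by (rule Dop_cong[OF U]) (rule linear_add[OF l])
    then show "Dop \<epsilon> (\<lambda>y. \<omega> y (v(i := b + c))) z w = Dop \<epsilon> (\<lambda>y. \<omega> y (v(i := b))) z w + Dop \<epsilon> (\<lambda>y. \<omega> y (v(i := c))) z w"
      by (simp add: Dop_add d)
    have "Dop \<epsilon> (\<lambda>y. \<omega> y (v(i := r *\<^sub>R b))) z w = Dop \<epsilon> (\<lambda>y. of_real r * \<omega> y (v(i := b))) z w"
      by (rule Dop_cong[OF U]) (rule linear_of_real_mult[OF l])
    then show "Dop \<epsilon> (\<lambda>y. \<omega> y (v(i := r *\<^sub>R b))) z w = r *\<^sub>R Dop \<epsilon> (\<lambda>y. \<omega> y (v(i := b))) z w"
      by (simp add: Dop_cmult d scaleR_conv_of_real)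
  qed
  show "alternating k (\<lambda>u. Dop \<epsilon> (\<lambda>y. \<omega> y u) z w)"
    unfolding alternating_def
  proof (intro allI impI)
    fix \<sigma> v assume \<sigma>: "\<sigma> permutes {..<k}"
    have "Dop \<epsilon> (\<lambda>y. \<omega> y (v \<circ> \<sigma>)) z w = Dop \<epsilon> (\<lambda>y. of_int (sign \<sigma>) * \<omega> y v) z w"
      using a by (intro Dop_cong[OF U] alternatingD[OF _ \<sigma>]) blast
    then show "Dop \<epsilon> (\<lambda>y. \<omega> y (v \<circ> \<sigma>)) z w = of_int (sign \<sigma>) * Dop \<epsilon> (\<lambda>y. \<omega> y v) z w"
      by (simp add: Dop_cmult d)
  qed
qed

lemma dloc_eq_antisymmetrize:
  assumes U: "open U" "z \<in> U" and \<omega>: "locform k U \<omega>"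
  shows "dloc \<epsilon> k \<omega> z v = antisymmetrize (Suc k) (\<lambda>v. Dop \<epsilon> (\<lambda>y. \<omega> y (\<lambda>i. v (Suc i))) z (v 0)) v / fact k"
  unfolding dloc_def
  by (rule insertion_eq_antisymmetrize[of k "\<lambda>w u. Dop \<epsilon> (\<lambda>y. \<omega> y u) z w"])
    (use altform_Dop[OF U \<omega>] in \<open>simp add: altform_def\<close>)

lemma locform_dloc:
  assumes U: "open U" and \<omega>: "locform k U \<omega>"
  shows "locform (Suc k) U (dloc \<epsilon> k \<omega>)"
  unfolding locform_def
proof (intro conjI ballI allI)
  fix z assume z: "z \<in> U"
  show "altform (Suc k) (dloc \<epsilon> k \<omega> z)"
    unfolding dloc_def[abs_def]
    by (rule altform_insertion[of k "\<lambda>w u. Dop \<epsilon> (\<lambda>y. \<omega> y u) z w"])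
      (auto intro: altform_Dop[OF U z \<omega>] linear_Dop locform_differentiable[OF \<omega> z])
next
  fix v
  show "smooth_on U (\<lambda>z. dloc \<epsilon> k \<omega> z v)"
    unfolding dloc_def
    by (intro smooth_on_sum smooth_on_mult smooth_on_const smooth_on_Dop U locform_smooth[OF \<omega>])
qed

lemma Dop_antisymmetrize:
  assumes "\<And>v. (\<lambda>y. F y v) differentiable (at z)"
  shows "Dop \<epsilon> (\<lambda>y. antisymmetrize m (F y) v) z w = antisymmetrize m (\<lambda>v. Dop \<epsilon> (\<lambda>y. F y v) z w) v"
  unfolding antisymmetrize_def
  by (subst Dop_sum) (auto simp: Dop_cmult assms intro!: differentiable_mult)

text \<open>The antisymmetrization in the inner \<open>dloc\<close> concerns the slots from 1 on and
  is absorbed by the outer one. The second derivative is left, with slots 0 and 1 as its two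
  directions.\<close>

lemma dloc_dloc_eq:
  assumes U: "open U" "z \<in> U" and \<omega>: "locform k U \<omega>"
  shows "dloc \<epsilon> (Suc k) (dloc \<delta> k \<omega>) z v = antisymmetrize (Suc (Suc k))
    (\<lambda>v. Dop \<epsilon> (\<lambda>y. Dop \<delta> (\<lambda>x. \<omega> x (\<lambda>i. v (Suc (Suc i)))) y (v (Suc 0))) z (v 0)) v / fact k"
proof -
  let ?P = "\<lambda>v u. Dop \<epsilon> (\<lambda>y. Dop \<delta> (\<lambda>x. \<omega> x (\<lambda>i. u (Suc i))) y (u 0)) z (v 0)"
  have inner: "Dop \<epsilon> (\<lambda>y. dloc \<delta> k \<omega> y u) z (v 0) = (1 / fact k) * antisymmetrize (Suc k) (?P v) u" for u v
  proof -
    let ?F = "\<lambda>y u. Dop \<delta> (\<lambda>x. \<omega> x (\<lambda>i. u (Suc i))) y (u 0)"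
    have d: "(\<lambda>y. ?F y u) differentiable (at z)" for u
      by (rule smooth_on_differentiable[OF smooth_on_Dop[OF U(1) locform_smooth[OF \<omega>]] U(2)])
    have "Dop \<epsilon> (\<lambda>y. dloc \<delta> k \<omega> y u) z (v 0) = Dop \<epsilon> (\<lambda>y. (1 / fact k) * antisymmetrize (Suc k) (?F y) u) z (v 0)"
      by (rule Dop_cong[OF U]) (simp add: dloc_eq_antisymmetrize[OF U(1) _ \<omega>])
    also have "\<dots> = (1 / fact k) * Dop \<epsilon> (\<lambda>y. antisymmetrize (Suc k) (?F y) u) z (v 0)"
      unfolding antisymmetrize_def
      by (intro Dop_cmult differentiable_sum ballI differentiable_mult differentiable_const d) (simp add: finite_permutations)
    also have "\<dots> = (1 / fact k) * antisymmetrize (Suc k) (?P v) u"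
      using Dop_antisymmetrize[where F="?F" and m="Suc k", OF d] by simp
    finally show ?thesis .
  qed
  have "dloc \<epsilon> (Suc k) (dloc \<delta> k \<omega>) z v = antisymmetrize (Suc (Suc k))
     (\<lambda>v. (1 / fact k) * antisymmetrize (Suc k) (?P v) (\<lambda>i. v (Suc 0 + i))) v / fact (Suc k)"
    by (subst dloc_eq_antisymmetrize[OF U locform_dloc[OF U(1) \<omega>]]) (simp only: inner plus_nat.add_Suc add_0)
  also have "\<dots> = (1 / fact k) * (fact (Suc k) * antisymmetrize (Suc (Suc k)) (\<lambda>v. ?P v (\<lambda>i. v (Suc 0 + i))) v) / fact (Suc k)"
    unfolding antisymmetrize_cmult by (subst antisymmetrize_block) (auto simp: shift_perm_def)
  finally show ?thesis by (simp del: fact_Suc)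
qed

text \<open>Exchanging slots 0 and 1 costs a sign, and \<open>Dop_swap\<close> exchanges the two
  operators. The case \<open>\<epsilon> = \<delta>\<close> will give that each operator squares to
  zero.\<close>

lemma dloc_anticommute:
  assumes U: "open U" "z \<in> U" and \<omega>: "locform k U \<omega>"
  shows "dloc \<epsilon> (Suc k) (dloc \<delta> k \<omega>) z v = - dloc \<delta> (Suc k) (dloc \<epsilon> k \<omega>) z v"
proof -
  let ?S = "\<lambda>\<epsilon> \<delta> v. Dop \<epsilon> (\<lambda>y. Dop \<delta> (\<lambda>x. \<omega> x (\<lambda>i. v (Suc (Suc i)))) y (v (Suc 0))) z (v 0)"
  let ?t = "Transposition.transpose 0 (Suc 0)"
  have "?S \<epsilon> \<delta> v = ?S \<delta> \<epsilon> (v \<circ> ?t)" for v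
    by (simp add: Transposition.transpose_def Dop_swap[OF U locform_smooth[OF \<omega>]])
  then have "antisymmetrize (Suc (Suc k)) (?S \<epsilon> \<delta>) v = antisymmetrize (Suc (Suc k)) (\<lambda>v. ?S \<delta> \<epsilon> (v \<circ> ?t)) v"
    by presburger
  also have "\<dots> = of_int (sign ?t) * antisymmetrize (Suc (Suc k)) (?S \<delta> \<epsilon>) v"
    by (rule antisymmetrize_permuted) (auto intro: permutes_swap_id)
  finally show ?thesis by (simp add: dloc_dloc_eq[OF U \<omega>] sign_swap_id)
qed

subsection \<open>Wedge products\<close>

lemma locform_wedge:
  assumes U: "open U" and \<alpha>: "locform k U \<alpha>" and \<beta>: "locform l U \<beta>"
  shows "locform (k + l) U (\<lambda>z. wedge_covectors k l (\<alpha> z) (\<beta> z))"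
  unfolding locform_def
proof (intro conjI ballI allI)
  fix v
  show "smooth_on U (\<lambda>z. wedge_covectors k l (\<alpha> z) (\<beta> z) v)"
    unfolding wedge_covectors_def
    by (intro smooth_on_divide_const smooth_on_sum smooth_on_mult smooth_on_const
        locform_smooth[OF \<alpha>] locform_smooth[OF \<beta>] U)
qed (intro altform_wedge_covectors locform_altform[OF \<alpha>] locform_altform[OF \<beta>])

text \<open>Under the antisymmetrization this is the product rule for \<open>Dop\<close>. The sign
  of the second term comes from moving the direction of differentiation from slot 0 past the
  \<open>k\<close> slots of \<open>\<alpha>\<close>.\<close>

theorem dloc_wedge:
  assumes U: "open U" "z \<in> U" and \<alpha>: "locform k U \<alpha>" and \<beta>: "locform l U \<beta>"
  shows "dloc \<epsilon> (k + l) (\<lambda>z. wedge_covectors k l (\<alpha> z) (\<beta> z)) z v =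
    wedge_covectors (Suc k) l (dloc \<epsilon> k \<alpha> z) (\<beta> z) v + (- 1) ^ k * wedge_covectors k (Suc l) (\<alpha> z) (dloc \<epsilon> l \<beta> z) v"
proof -
  let ?N = "Suc (k + l)" and ?c = "fact k * fact l :: complex"
  let ?D\<alpha> = "\<lambda>u w. Dop \<epsilon> (\<lambda>y. \<alpha> y u) z w" and ?D\<beta> = "\<lambda>u w. Dop \<epsilon> (\<lambda>y. \<beta> y u) z w"
  let ?A = "\<lambda>v. ?D\<alpha> (\<lambda>i. v (Suc i)) (v 0) * \<beta> z (\<lambda>i. v (Suc k + i))"
  let ?B = "\<lambda>v. \<alpha> z (\<lambda>i. v (Suc i)) * ?D\<beta> (\<lambda>i. v (Suc k + i)) (v 0)"
  let ?C = "\<lambda>v. \<alpha> z v * ?D\<beta> (\<lambda>i. v (Suc k + i)) (v k)"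
  note d\<alpha> = locform_differentiable[OF \<alpha> U(2)] and d\<beta> = locform_differentiable[OF \<beta> U(2)]
  have 1: "dloc \<epsilon> (k + l) (\<lambda>z. wedge_covectors k l (\<alpha> z) (\<beta> z)) z v = (antisymmetrize ?N ?A v + antisymmetrize ?N ?B v) / ?c"
  proof -
    let ?P = "\<lambda>v u. Dop \<epsilon> (\<lambda>y. \<alpha> y u * \<beta> y (\<lambda>i. u (k + i))) z (v 0)"
    have d: "(\<lambda>y. \<alpha> y u * \<beta> y (\<lambda>i. u (k + i))) differentiable (at z)" for u
      by (intro differentiable_mult d\<alpha> d\<beta>)
    have inner: "Dop \<epsilon> (\<lambda>y. wedge_covectors k l (\<alpha> y) (\<beta> y) u) z (v 0) = (1 / ?c) * antisymmetrize (k + l) (?P v) u" for u v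
    proof -
      have "Dop \<epsilon> (\<lambda>y. wedge_covectors k l (\<alpha> y) (\<beta> y) u) z (v 0) =
          Dop \<epsilon> (\<lambda>y. (1 / ?c) * antisymmetrize (k + l) (\<lambda>u. \<alpha> y u * \<beta> y (\<lambda>i. u (k + i))) u) z (v 0)"
        by (simp add: wedge_covectors_eq)
      also have "\<dots> = (1 / ?c) * Dop \<epsilon> (\<lambda>y. antisymmetrize (k + l) (\<lambda>u. \<alpha> y u * \<beta> y (\<lambda>i. u (k + i))) u) z (v 0)"
        unfolding antisymmetrize_def
        by (intro Dop_cmult differentiable_sum ballI differentiable_mult differentiable_const d\<alpha> d\<beta>) (simp add: finite_permutations)
      also have "\<dots> = (1 / ?c) * antisymmetrize (k + l) (?P v) u"
        using Dop_antisymmetrize[where F="\<lambda>y u. \<alpha> y u * \<beta> y (\<lambda>i. u (k + i))" and m="k + l", OF d] by simp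
      finally show ?thesis .
    qed
    have "dloc \<epsilon> (k + l) (\<lambda>z. wedge_covectors k l (\<alpha> z) (\<beta> z)) z v =
       antisymmetrize ?N (\<lambda>v. (1 / ?c) * antisymmetrize (k + l) (?P v) (\<lambda>i. v (Suc 0 + i))) v / fact (k + l)"
      by (subst dloc_eq_antisymmetrize[OF U locform_wedge[OF U(1) \<alpha> \<beta>]]) (simp only: inner plus_nat.add_Suc add_0)
    also have "\<dots> = (1 / ?c) * (fact (k + l) * antisymmetrize ?N (\<lambda>v. ?P v (\<lambda>i. v (Suc 0 + i))) v) / fact (k + l)"
      unfolding antisymmetrize_cmult by (subst antisymmetrize_block) (auto simp: shift_perm_def)
    also have "\<dots> = antisymmetrize ?N (\<lambda>v. ?P v (\<lambda>i. v (Suc 0 + i))) v / ?c" by simp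
    also have "(\<lambda>v. ?P v (\<lambda>i. v (Suc 0 + i))) = (\<lambda>v. ?A v + ?B v)"
      by (simp add: Dop_mult[OF d\<alpha> d\<beta>] fun_eq_iff)
    finally show ?thesis by (simp only: antisymmetrize_add)
  qed
  have 2: "wedge_covectors (Suc k) l (dloc \<epsilon> k \<alpha> z) (\<beta> z) v = antisymmetrize ?N ?A v / ?c"
  proof -
    \<comment> \<open>The block consists of the first \<open>Suc k\<close> slots this time;
      permuting it does not touch the slots of \<open>\<beta>\<close>, which are read off from
      \<open>v\<close>.\<close>
    let ?P = "\<lambda>v u. \<beta> z (\<lambda>i. v (Suc k + i)) * ?D\<alpha> (\<lambda>i. u (Suc i)) (u 0)"
    have "dloc \<epsilon> k \<alpha> z u = (1 / fact k) * antisymmetrize (Suc k) (\<lambda>u. ?D\<alpha> (\<lambda>i. u (Suc i)) (u 0)) u" for u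
      by (simp add: dloc_eq_antisymmetrize[OF U \<alpha>])
    then have "(\<lambda>v. dloc \<epsilon> k \<alpha> z v * \<beta> z (\<lambda>i. v (Suc k + i)))
        = (\<lambda>v. (1 / fact k) * antisymmetrize (Suc k) (?P v) (\<lambda>i. v (0 + i)))"
      by (simp add: antisymmetrize_cmult fun_eq_iff)
    then have "wedge_covectors (Suc k) l (dloc \<epsilon> k \<alpha> z) (\<beta> z) v =
       antisymmetrize ?N (\<lambda>v. (1 / fact k) * antisymmetrize (Suc k) (?P v) (\<lambda>i. v (0 + i))) v / (fact (Suc k) * fact l)"
      by (simp only: wedge_covectors_eq plus_nat.add_Suc)
    moreover have "antisymmetrize ?N (\<lambda>v. antisymmetrize (Suc k) (?P v) (\<lambda>i. v (0 + i))) v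
        = fact (Suc k) * antisymmetrize ?N (\<lambda>v. ?P v (\<lambda>i. v (0 + i))) v"
    proof (rule antisymmetrize_block)
      fix \<tau> v u assume "\<tau> permutes {..<Suc k}"
      then have "\<tau> (Suc k + i) = Suc k + i" for i by (rule permutes_not_in) simp
      then show "?P (v \<circ> shift_perm 0 \<tau>) u = ?P v u" by (simp add: shift_perm_def)
    qed auto
    moreover have "antisymmetrize ?N (\<lambda>v. (1 / fact k) * antisymmetrize (Suc k) (?P v) (\<lambda>i. v (0 + i))) v
        = (1 / fact k) * antisymmetrize ?N (\<lambda>v. antisymmetrize (Suc k) (?P v) (\<lambda>i. v (0 + i))) v"
      by (rule antisymmetrize_cmult)
    moreover have "(\<lambda>v. ?P v (\<lambda>i. v (0 + i))) = ?A" by (simp add: fun_eq_iff mult.commute)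
    ultimately show ?thesis by (simp del: fact_Suc)
  qed
  have 3: "wedge_covectors k (Suc l) (\<alpha> z) (dloc \<epsilon> l \<beta> z) v = antisymmetrize ?N ?C v / ?c"
  proof -
    let ?P = "\<lambda>v u. \<alpha> z v * ?D\<beta> (\<lambda>i. u (Suc i)) (u 0)"
    have "dloc \<epsilon> l \<beta> z u = (1 / fact l) * antisymmetrize (Suc l) (\<lambda>u. ?D\<beta> (\<lambda>i. u (Suc i)) (u 0)) u" for u
      by (simp add: dloc_eq_antisymmetrize[OF U \<beta>])
    then have "(\<lambda>v. \<alpha> z v * dloc \<epsilon> l \<beta> z (\<lambda>i. v (k + i)))
        = (\<lambda>v. (1 / fact l) * antisymmetrize (Suc l) (?P v) (\<lambda>i. v (k + i)))"
      by (simp add: antisymmetrize_cmult fun_eq_iff)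
    then have "wedge_covectors k (Suc l) (\<alpha> z) (dloc \<epsilon> l \<beta> z) v =
       antisymmetrize ?N (\<lambda>v. (1 / fact l) * antisymmetrize (Suc l) (?P v) (\<lambda>i. v (k + i))) v / (fact k * fact (Suc l))"
      by (simp only: wedge_covectors_eq add_Suc_right)
    moreover have "antisymmetrize ?N (\<lambda>v. antisymmetrize (Suc l) (?P v) (\<lambda>i. v (k + i))) v
        = fact (Suc l) * antisymmetrize ?N (\<lambda>v. ?P v (\<lambda>i. v (k + i))) v"
    proof (rule antisymmetrize_block)
      fix \<tau> v u
      have "\<alpha> z (v \<circ> shift_perm k \<tau>) = \<alpha> z v" for v
        by (rule locform_depends[OF \<alpha> U(2)]) (simp add: shift_perm_def)
      then show "?P (v \<circ> shift_perm k \<tau>) u = ?P v u" by simp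
    qed auto
    moreover have "antisymmetrize ?N (\<lambda>v. (1 / fact l) * antisymmetrize (Suc l) (?P v) (\<lambda>i. v (k + i))) v
        = (1 / fact l) * antisymmetrize ?N (\<lambda>v. antisymmetrize (Suc l) (?P v) (\<lambda>i. v (k + i))) v"
      by (rule antisymmetrize_cmult)
    ultimately show ?thesis by (simp del: fact_Suc)
  qed
  \<comment> \<open>\<open>?B\<close> and \<open>?C\<close> differ by the cycle that takes slot
    \<open>k\<close> to the front.\<close>
  have "antisymmetrize ?N ?B v = (- 1) ^ k * antisymmetrize ?N ?C v"
  proof -
    have c: "front_cycle k permutes {..<?N}" "sign (front_cycle k) = (- 1) ^ k"
      using front_cycle[of k ?N] by auto
    have "?B (v \<circ> front_cycle k) = ?C v" for v
    proof -
      have "\<alpha> z (\<lambda>i. (v \<circ> front_cycle k) (Suc i)) = \<alpha> z v"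
        by (rule locform_depends[OF \<alpha> U(2)]) (simp add: front_cycle_def)
      then show ?thesis by (simp add: front_cycle_def)
    qed
    then have "antisymmetrize ?N ?C v = antisymmetrize ?N (\<lambda>v. ?B (v \<circ> front_cycle k)) v" by presburger
    also have "\<dots> = (- 1) ^ k * antisymmetrize ?N ?B v"
      by (subst antisymmetrize_permuted[OF c(1), of ?B]) (simp add: c(2))
    finally show ?thesis by (simp add: mult.assoc[symmetric] power_mult_distrib[symmetric])
  qed
  then show ?thesis unfolding 1 2 3 by (simp add: add_divide_distrib)
qed

subsection \<open>Pullback along holomorphic maps\<close>

text \<open>Expansion over \<open>Basis\<close> writes the value on moving vectors as a finite sum
  of products of scalar functions. The ordinary product rule gives a term for \<open>G\<close> and
  one for each slot, and the expansion is then read backwards.\<close>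

lemma multilinear_has_derivative:
  fixes G :: "'a::real_normed_vector \<Rightarrow> (nat \<Rightarrow> 'b::euclidean_space) \<Rightarrow> complex"
  assumes S: "open S" "z \<in> S"
    and G: "\<And>y. y \<in> S \<Longrightarrow> depends_on_first k (G y)" "\<And>y. y \<in> S \<Longrightarrow> slotwise_linear k (G y)"
    and dG: "\<And>v. ((\<lambda>y. G y v) has_derivative (\<lambda>h. G' h v)) (at z)"
    and du: "\<And>i. i < k \<Longrightarrow> (u i has_derivative u' i) (at z)"
  shows "((\<lambda>y. G y (\<lambda>i. u i y)) has_derivative
    (\<lambda>h. G' h (\<lambda>i. u i z) + (\<Sum>j<k. G z ((\<lambda>i. u i z)(j := u' j h))))) (at z)"
proof -
  let ?B = "{..<k} \<rightarrow>\<^sub>E (Basis :: 'b set)"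
  \<comment> \<open>Multilinearity of \<open>G'\<close> comes from that of \<open>G\<close>, by
    uniqueness of the derivative.\<close>
  have G'_expansion: "G' h v = (\<Sum>s\<in>?B. of_real (\<Prod>i<k. v i \<bullet> s i) * G' h s)" for h v
  proof -
    have "((\<lambda>y. \<Sum>s\<in>?B. of_real (\<Prod>i<k. v i \<bullet> s i) * G y s) has_derivative
        (\<lambda>h. \<Sum>s\<in>?B. of_real (\<Prod>i<k. v i \<bullet> s i) * G' h s)) (at z)"
      by (intro has_derivative_sum has_derivative_mult_right dG)
    then have "((\<lambda>y. G y v) has_derivative (\<lambda>h. \<Sum>s\<in>?B. of_real (\<Prod>i<k. v i \<bullet> s i) * G' h s)) (at z)"
      by (rule has_derivative_transform_within_open[OF _ S])
        (rule slotwise_linear_expansion[OF G, symmetric])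
    from has_derivative_unique[OF dG this] show ?thesis by (rule fun_cong)
  qed
  have "((\<lambda>y. \<Sum>s\<in>?B. of_real (\<Prod>i<k. u i y \<bullet> s i) * G y s) has_derivative
     (\<lambda>h. \<Sum>s\<in>?B. of_real (\<Prod>i<k. u i z \<bullet> s i) * G' h s +
        of_real (\<Sum>j<k. (u' j h \<bullet> s j) * (\<Prod>i\<in>{..<k} - {j}. u i z \<bullet> s i)) * G z s)) (at z)"
    by (intro has_derivative_sum has_derivative_mult dG has_derivative_of_real has_derivative_prod
        has_derivative_inner_left du) auto
  then have "((\<lambda>y. G y (\<lambda>i. u i y)) has_derivative
     (\<lambda>h. \<Sum>s\<in>?B. of_real (\<Prod>i<k. u i z \<bullet> s i) * G' h s +
        of_real (\<Sum>j<k. (u' j h \<bullet> s j) * (\<Prod>i\<in>{..<k} - {j}. u i z \<bullet> s i)) * G z s)) (at z)"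
    by (rule has_derivative_transform_within_open[OF _ S])
      (rule slotwise_linear_expansion[OF G, symmetric])
  moreover have "(\<Sum>s\<in>?B. of_real (\<Prod>i<k. u i z \<bullet> s i) * G' h s +
        of_real (\<Sum>j<k. (u' j h \<bullet> s j) * (\<Prod>i\<in>{..<k} - {j}. u i z \<bullet> s i)) * G z s) =
      G' h (\<lambda>i. u i z) + (\<Sum>j<k. G z ((\<lambda>i. u i z)(j := u' j h)))" for h
  proof -
    have "(\<Sum>s\<in>?B. of_real (\<Sum>j<k. (u' j h \<bullet> s j) * (\<Prod>i\<in>{..<k} - {j}. u i z \<bullet> s i)) * G z s)
      = (\<Sum>j<k. \<Sum>s\<in>?B. of_real ((u' j h \<bullet> s j) * (\<Prod>i\<in>{..<k} - {j}. u i z \<bullet> s i)) * G z s)"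
      unfolding of_real_sum sum_distrib_right by (rule sum.swap)
    also have "\<dots> = (\<Sum>j<k. G z ((\<lambda>i. u i z)(j := u' j h)))"
    proof (intro sum.cong refl)
      fix j assume j: "j \<in> {..<k}"
      have "(u' j h \<bullet> s j) * (\<Prod>i\<in>{..<k} - {j}. u i z \<bullet> s i) = (\<Prod>i<k. ((\<lambda>i. u i z)(j := u' j h)) i \<bullet> s i)" for s
        by (subst prod.remove[OF _ j]) (auto intro!: prod.cong)
      then show "(\<Sum>s\<in>?B. of_real ((u' j h \<bullet> s j) * (\<Prod>i\<in>{..<k} - {j}. u i z \<bullet> s i)) * G z s)
          = G z ((\<lambda>i. u i z)(j := u' j h))"
        by (simp only: slotwise_linear_expansion[OF G(1)[OF S(2)] G(2)[OF S(2)], symmetric])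
    qed
    finally show ?thesis unfolding sum.distrib by (simp only: G'_expansion[symmetric])
  qed
  ultimately show ?thesis by simp
qed

definition pullback ::
    "(complex ^ 'n::finite \<Rightarrow> complex ^ 'n) \<Rightarrow> (complex ^ 'n \<Rightarrow> 'n covector) \<Rightarrow> complex ^ 'n \<Rightarrow> 'n covector" where
  "pullback \<phi> \<omega> z v = \<omega> (\<phi> z) (\<lambda>i. frechet_derivative \<phi> (at z) (v i))"

lemma altform_comp_linear:
  assumes F: "altform k F" and L: "linear L"
  shows "altform k (\<lambda>v. F (\<lambda>i. L (v i)))"
  unfolding altform_def
proof (intro conjI)
  note F' = F[unfolded altform_def]
  show "depends_on_first k (\<lambda>v. F (\<lambda>i. L (v i)))"
    unfolding depends_on_first_def by (intro allI impI depends_on_firstD[OF F'[THEN conjunct1]]) simp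
  show "slotwise_linear k (\<lambda>v. F (\<lambda>i. L (v i)))"
    unfolding slotwise_linear_def
  proof (intro allI impI)
    fix i v assume i: "i < k"
    have "(\<lambda>j. L ((v(i := u)) j)) = (\<lambda>j. L (v j))(i := L u)" for u by (auto simp: fun_eq_iff)
    moreover have "linear (\<lambda>u. F ((\<lambda>j. L (v j))(i := L u)))"
      using linear_compose[OF L slotwise_linearD[OF F'[THEN conjunct2, THEN conjunct1] i]] by (simp add: comp_def)
    ultimately show "linear (\<lambda>u. F (\<lambda>j. L ((v(i := u)) j)))" by simp
  qed
  show "alternating k (\<lambda>v. F (\<lambda>i. L (v i)))"
    unfolding alternating_def
  proof (intro allI impI)
    fix \<sigma> v assume \<sigma>: "\<sigma> permutes {..<k}"
    show "F (\<lambda>i. L ((v \<circ> \<sigma>) i)) = of_int (sign \<sigma>) * F (\<lambda>i. L (v i))"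
      using alternatingD[OF F'[THEN conjunct2, THEN conjunct2] \<sigma>, of "\<lambda>i. L (v i)"] by (simp add: comp_def)
  qed
qed

lemma antisymmetrize_comp: "antisymmetrize m F (\<lambda>i. f (v i)) = antisymmetrize m (\<lambda>v. F (\<lambda>i. f (v i))) v"
  by (simp add: antisymmetrize_def comp_def)

lemma holomorphic_map_onD:
  assumes "holomorphic_map_on U \<phi>"
  shows "smooth_on U \<phi>" "z \<in> U \<Longrightarrow> frechet_derivative \<phi> (at z) (a *s v) = a *s frechet_derivative \<phi> (at z) v"
    "z \<in> U \<Longrightarrow> linear (frechet_derivative \<phi> (at z))"
  using assms smooth_on_differentiable[of U \<phi> z] linear_frechet_derivative[of \<phi> "at z"]
  by (auto simp: holomorphic_map_on_def)

lemma locform_pullback: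
  assumes U: "open U" and T: "open T" and \<phi>: "holomorphic_map_on U \<phi>" "\<phi> ` U \<subseteq> T" and \<omega>: "locform k T \<omega>"
  shows "locform k U (pullback \<phi> \<omega>)"
  unfolding locform_def
proof (intro conjI ballI allI)
  note hol = holomorphic_map_onD[OF \<phi>(1)]
  fix z assume z: "z \<in> U"
  show "altform k (pullback \<phi> \<omega> z)"
    unfolding pullback_def[abs_def]
    by (rule altform_comp_linear[OF locform_altform[OF \<omega>] hol(3)[OF z]]) (use z \<phi>(2) in auto)
next
  note hol = holomorphic_map_onD[OF \<phi>(1)]
  fix v
  \<comment> \<open>The arguments of \<open>\<omega>\<close> move with \<open>z\<close>, but
    smoothness of forms is a condition on fixed arguments; the expansion leaves only the fixed
    arguments \<open>s\<close>.\<close>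
  have eq: "pullback \<phi> \<omega> z v = (\<Sum>s\<in>{..<k} \<rightarrow>\<^sub>E Basis.
      of_real (\<Prod>i<k. frechet_derivative \<phi> (at z) (v i) \<bullet> s i) * \<omega> (\<phi> z) s)" if "z \<in> U" for z
    using locform_altform[OF \<omega>, of "\<phi> z"] \<phi>(2) that unfolding pullback_def altform_def
    by (intro slotwise_linear_expansion) auto
  have "smooth_on U (\<lambda>z. \<Prod>i<k. frechet_derivative \<phi> (at z) (v i) \<bullet> s i)" for s
    unfolding smooth_on_def
    by (intro allI Ck_on_prod U Ck_on_inner_left Ck_on_frechet_derivative smooth_onD hol(1))
  then have sm: "smooth_on U (\<lambda>z. complex_of_real (\<Prod>i<k. frechet_derivative \<phi> (at z) (v i) \<bullet> s i))" for s
    by (rule smooth_on_bounded_linear[OF U bounded_linear_of_real])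
  have so: "smooth_on U (\<lambda>z. \<omega> (\<phi> z) s)" for s
    by (rule smooth_on_compose[OF U T locform_smooth[OF \<omega>] hol(1) \<phi>(2)])
  have "smooth_on U (\<lambda>z. \<Sum>s\<in>{..<k} \<rightarrow>\<^sub>E Basis.
      of_real (\<Prod>i<k. frechet_derivative \<phi> (at z) (v i) \<bullet> s i) * \<omega> (\<phi> z) s)"
    by (intro smooth_on_sum smooth_on_mult U sm so)
  then show "smooth_on U (\<lambda>z. pullback \<phi> \<omega> z v)"
    using smooth_on_cong[OF U, of "\<lambda>z. pullback \<phi> \<omega> z v" "\<lambda>z. \<Sum>s\<in>{..<k} \<rightarrow>\<^sub>E Basis.
      of_real (\<Prod>i<k. frechet_derivative \<phi> (at z) (v i) \<bullet> s i) * \<omega> (\<phi> z) s"] eq by simp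
qed

text \<open>The chain rule, together with the fact that the differential of \<open>\<phi>\<close>
  commutes with multiplication by \<i>. This is the point at which holomorphic coordinate changes
  respect \<partial> and its conjugate separately.\<close>

lemma Dop_compose:
  assumes \<phi>: "\<phi> differentiable (at z)" "frechet_derivative \<phi> (at z) (\<i> *s w) = \<i> *s frechet_derivative \<phi> (at z) w"
    and f: "f differentiable (at (\<phi> z))"
  shows "Dop \<epsilon> (\<lambda>y. f (\<phi> y)) z w = Dop \<epsilon> f (\<phi> z) (frechet_derivative \<phi> (at z) w)"
proof -
  have "((\<lambda>y. f (\<phi> y)) has_derivative (\<lambda>h. frechet_derivative f (at (\<phi> z)) (frechet_derivative \<phi> (at z) h))) (at z)"
    by (rule has_derivative_compose[where g=f, OF \<phi>(1)[unfolded frechet_derivative_works]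
          f[unfolded frechet_derivative_works]])
  from Dop_eq[OF this] show ?thesis by (simp add: Dop_def \<phi>(2))
qed

text \<open>The second derivatives of \<open>\<phi>\<close> that appear are symmetric in two of the vectors, and are
  killed by the antisymmetrization.\<close>

theorem dloc_pullback:
  assumes U: "open U" "z \<in> U" and T: "open T"
    and \<phi>: "holomorphic_map_on U \<phi>" "\<phi> ` U \<subseteq> T" and \<omega>: "locform k T \<omega>"
  shows "dloc \<epsilon> k (pullback \<phi> \<omega>) z v = pullback \<phi> (dloc \<epsilon> k \<omega>) z v"
proof -
  note hol = holomorphic_map_onD[OF \<phi>(1)]
  have \<phi>z: "\<phi> z \<in> T" using \<phi>(2) U(2) by auto
  define \<phi>' where "\<phi>' = frechet_derivative \<phi> (at z)"
  define B where "B h a = frechet_derivative (\<lambda>y. frechet_derivative \<phi> (at y) a) (at z) h" for h a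
  have B_sym: "B h a = B a h" for h a
    unfolding B_def by (rule second_derivative_symmetric[OF U smooth_onD[OF hol(1)]])
  \<comment> \<open>Symmetry moves the factor \<i> to the direction in which \<open>\<phi>\<close>
    is differentiated first. There complex linearity holds at all points near \<open>z\<close>, so
    the identity can be differentiated once more.\<close>
  have B_i: "B (\<i> *s h) a = \<i> *s B h a" for h a
  proof -
    have "B a (\<i> *s h) = frechet_derivative (\<lambda>y. \<i> *s frechet_derivative \<phi> (at y) h) (at z) a"
      unfolding B_def using frechet_derivative_cong_open(1)[OF U, of "\<lambda>y. frechet_derivative \<phi> (at y) (\<i> *s h)"
          "\<lambda>y. \<i> *s frechet_derivative \<phi> (at y) h"] hol(2) by simp
    also have "\<dots> = \<i> *s B a h"
      unfolding B_def
      by (rule frechet_derivative_bounded_linear[OF bounded_linear_vector_mult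
            smooth_on_differentiable[OF smooth_on_frechet_derivative[OF hol(1)] U(2)]])
    finally show ?thesis by (simp only: B_sym[of "\<i> *s h"] B_sym[of h])
  qed
  let ?D = "\<lambda>h s. frechet_derivative (\<lambda>x. \<omega> x s) (at (\<phi> z)) (\<phi>' h)"
  let ?\<phi>v = "\<lambda>u i. \<phi>' (u i)"
  have der: "((\<lambda>y. pullback \<phi> \<omega> y u) has_derivative
      (\<lambda>h. ?D h (?\<phi>v u) + (\<Sum>j<k. \<omega> (\<phi> z) ((?\<phi>v u)(j := B h (u j)))))) (at z)" for u
    unfolding pullback_def \<phi>'_def
  proof (rule multilinear_has_derivative[OF U])
    fix y assume "y \<in> U"
    then have "altform k (\<omega> (\<phi> y))" using \<phi>(2) by (intro locform_altform[OF \<omega>]) auto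
    then show "depends_on_first k (\<omega> (\<phi> y))" "slotwise_linear k (\<omega> (\<phi> y))" by (auto simp: altform_def)
  next
    fix s
    show "((\<lambda>y. \<omega> (\<phi> y) s) has_derivative
       (\<lambda>h. frechet_derivative (\<lambda>x. \<omega> x s) (at (\<phi> z)) (frechet_derivative \<phi> (at z) h))) (at z)"
      by (rule has_derivative_compose[where g="\<lambda>x. \<omega> x s",
            OF smooth_on_has_derivative[OF hol(1) U(2)] smooth_on_has_derivative[OF locform_smooth[OF \<omega>] \<phi>z]])
  next
    fix i
    show "((\<lambda>y. frechet_derivative \<phi> (at y) (u i)) has_derivative (\<lambda>h. B h (u i))) (at z)"
      unfolding B_def by (rule smooth_on_has_derivative[OF smooth_on_frechet_derivative[OF hol(1)] U(2)])
  qed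
  let ?Q = "\<lambda>j w u. (\<omega> (\<phi> z) ((?\<phi>v u)(j := B w (u j))) - \<epsilon> * \<i> * \<omega> (\<phi> z) ((?\<phi>v u)(j := \<i> *s B w (u j)))) / 2"
  have Dop: "Dop \<epsilon> (\<lambda>y. pullback \<phi> \<omega> y u) z w =
      Dop \<epsilon> (\<lambda>x. \<omega> x (?\<phi>v u)) (\<phi> z) (\<phi>' w) + (\<Sum>j<k. ?Q j w u)" for u w
    unfolding Dop_eq[OF der] Dop_def[of _ _ "\<phi> z"] B_i
    by (simp add: \<phi>'_def hol(2)[OF U(2)] sum_subtractf sum_distrib_left sum_divide_distrib diff_divide_distrib
        add_divide_distrib distrib_left)
  have zero: "antisymmetrize (Suc k) (\<lambda>v. ?Q j (v 0) (\<lambda>i. v (Suc i))) v = 0" if "j < k" for j v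
  proof (rule antisymmetrize_symmetric[of 0 _ "Suc j"])
    fix v
    let ?t = "Transposition.transpose 0 (Suc j)"
    have eq: "(?\<phi>v (\<lambda>i. (v \<circ> ?t) (Suc i)))(j := x) = (?\<phi>v (\<lambda>i. v (Suc i)))(j := x)" for x
      by (auto simp: fun_eq_iff Transposition.transpose_def)
    show "?Q j ((v \<circ> ?t) 0) (\<lambda>i. (v \<circ> ?t) (Suc i)) = ?Q j (v 0) (\<lambda>i. v (Suc i))"
      unfolding eq by (simp add: B_sym[of "v 0"])
  qed (use that in auto)
  have "dloc \<epsilon> k (pullback \<phi> \<omega>) z v =
      antisymmetrize (Suc k) (\<lambda>v. Dop \<epsilon> (\<lambda>x. \<omega> x (\<lambda>i. \<phi>' (v (Suc i)))) (\<phi> z) (\<phi>' (v 0))) v / fact k"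
    unfolding dloc_eq_antisymmetrize[OF U locform_pullback[OF U(1) T \<phi> \<omega>]] Dop
    unfolding antisymmetrize_add antisymmetrize_sum by (simp add: zero)
  also have "\<dots> = pullback \<phi> (dloc \<epsilon> k \<omega>) z v"
    unfolding pullback_def dloc_eq_antisymmetrize[OF T \<phi>z \<omega>] \<phi>'_def[symmetric] antisymmetrize_comp ..
  finally show ?thesis .
qed

section \<open>Forms on a complex manifold\<close>

locale complex_atlas =
  fixes X :: "'a topology" and A :: "('a, 'n::finite) chart set"
  assumes atlas: "holomorphic_atlas X A"
begin

lemma chart_openin: "c \<in> A \<Longrightarrow> openin X (fst c)"
  and open_chart_range: "c \<in> A \<Longrightarrow> open (chart_range c)"
  and chart_homeomorphic:
    "c \<in> A \<Longrightarrow> homeomorphic_map (subtopology X (fst c)) (top_of_set (chart_range c)) (snd c)"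
  and charts_cover: "(\<Union>c\<in>A. fst c) = topspace X"
  and transition_holomorphic:
    "c \<in> A \<Longrightarrow> c' \<in> A \<Longrightarrow> holomorphic_map_on (overlap c c') (transition c c')"
  using atlas by (auto simp: holomorphic_atlas_def)

lemma chart_subset_topspace: "c \<in> A \<Longrightarrow> fst c \<subseteq> topspace X"
  using chart_openin openin_subset by blast

lemma topspace_chart: "c \<in> A \<Longrightarrow> topspace (subtopology X (fst c)) = fst c"
  by (rule topspace_subtopology_subset[OF chart_subset_topspace])

lemma chart_inj_on: "c \<in> A \<Longrightarrow> inj_on (snd c) (fst c)"
  using homeomorphic_imp_injective_map[OF chart_homeomorphic] topspace_chart by metis

lemma chart_in_range: "x \<in> fst c \<Longrightarrow> snd c x \<in> chart_range c"
  by (simp add: chart_range_def)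

lemma chart_inv_chart: "c \<in> A \<Longrightarrow> x \<in> fst c \<Longrightarrow> chart_inv c (snd c x) = x"
  unfolding chart_inv_def by (rule inv_into_f_f[OF chart_inj_on])

lemma chart_inv_in: "z \<in> chart_range c \<Longrightarrow> chart_inv c z \<in> fst c"
  unfolding chart_inv_def chart_range_def by (rule inv_into_into)

lemma chart_chart_inv: "z \<in> chart_range c \<Longrightarrow> snd c (chart_inv c z) = z"
  unfolding chart_inv_def chart_range_def by (rule f_inv_into_f)

lemma chart_image_iff:
  assumes "c \<in> A"
  shows "z \<in> snd c ` (fst c \<inter> U) \<longleftrightarrow> z \<in> chart_range c \<and> chart_inv c z \<in> U"
  using chart_inv_chart[OF assms] chart_inv_in[of z c] chart_chart_inv[of z c]
  by (auto simp: chart_range_def intro!: image_eqI[of z "snd c" "chart_inv c z"])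

lemma overlap_iff: "c \<in> A \<Longrightarrow> z \<in> overlap c c' \<longleftrightarrow> z \<in> chart_range c \<and> chart_inv c z \<in> fst c'"
  unfolding overlap_def by (rule chart_image_iff)

lemma overlap_subset: "overlap c c' \<subseteq> chart_range c"
  by (auto simp: overlap_def chart_range_def)

lemma open_chart_image:
  assumes c: "c \<in> A" and U: "openin X U"
  shows "open (snd c ` (fst c \<inter> U))"
proof -
  have "openin (subtopology X (fst c)) (fst c \<inter> U)"
    using U by (metis inf_commute openin_subtopology_Int)
  then have "openin (top_of_set (chart_range c)) (snd c ` (fst c \<inter> U))"
    using homeomorphic_imp_open_map[OF chart_homeomorphic[OF c]] by (simp add: open_map_def)
  then show ?thesis using open_chart_range[OF c] openin_open_trans by blast
qed

lemma open_overlap: "c \<in> A \<Longrightarrow> c' \<in> A \<Longrightarrow> open (overlap c c')"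
  unfolding overlap_def by (intro open_chart_image chart_openin)

lemma transition:
  assumes "c \<in> A" "c' \<in> A" "z \<in> overlap c c'"
  shows "transition c c' z \<in> overlap c' c" "transition c c' z \<in> chart_range c'"
    "chart_inv c' (transition c c' z) = chart_inv c z"
    "transition c' c (transition c c' z) = z"
proof -
  have z: "z \<in> chart_range c" "chart_inv c z \<in> fst c'"
    using assms by (auto simp: overlap_iff)
  show i: "chart_inv c' (transition c c' z) = chart_inv c z"
    using z assms by (simp add: transition_def chart_inv_chart)
  show r: "transition c c' z \<in> chart_range c'"
    using z by (auto simp: transition_def intro: chart_in_range)
  show "transition c c' z \<in> overlap c' c"
    using assms r i z by (simp add: overlap_iff chart_inv_in)
  show "transition c' c (transition c c' z) = z"
    using i z by (simp add: transition_def[of c' c] chart_chart_inv)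
qed

lemma transition_image:
  assumes "c \<in> A" "c' \<in> A"
  shows "transition c c' ` overlap c c' = overlap c' c"
proof -
  have "z \<in> transition c c' ` overlap c c'" if "z \<in> overlap c' c" for z
    using transition(1,4)[OF assms(2,1) that] by (metis image_eqI)
  then show ?thesis using transition(1)[OF assms] by auto
qed

lemma transition_inj_on: "c \<in> A \<Longrightarrow> c' \<in> A \<Longrightarrow> inj_on (transition c c') (overlap c c')"
  using transition(4) by (metis inj_on_inverseI)

lemma continuous_chart_inv: "c \<in> A \<Longrightarrow> continuous_map (top_of_set (chart_range c)) X (chart_inv c)"
proof -
  assume c: "c \<in> A"
  have "homeomorphic_map (top_of_set (chart_range c)) (subtopology X (fst c)) (chart_inv c)"
  proof -
    obtain g where g: "homeomorphic_maps (subtopology X (fst c)) (top_of_set (chart_range c)) (snd c) g"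
      using chart_homeomorphic[OF c] homeomorphic_map_maps by blast
    have eq: "chart_inv c z = g z" if z: "z \<in> chart_range c" for z
      using g z chart_inv_in[OF z] chart_chart_inv[OF z] topspace_chart[OF c]
      by (auto simp: homeomorphic_maps_def)
    have "homeomorphic_map (top_of_set (chart_range c)) (subtopology X (fst c)) g"
      using g homeomorphic_maps_map by blast
    then show ?thesis by (rule homeomorphic_map_eq) (simp add: eq)
  qed
  then have "continuous_map (top_of_set (chart_range c)) (subtopology X (fst c)) (chart_inv c)"
    by (rule homeomorphic_imp_continuous_map)
  then show ?thesis by (simp add: continuous_map_in_subtopology)
qed

lemma compact_chart_image:
  assumes "c \<in> A" "compactin X K" "K \<subseteq> fst c"
  shows "compact (snd c ` K)" "snd c ` K \<subseteq> chart_range c"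
proof -
  have "compactin (subtopology X (fst c)) K" using assms by (simp add: compactin_subtopology)
  then have "compactin (top_of_set (chart_range c)) (snd c ` K)"
    by (rule image_compactin) (rule homeomorphic_imp_continuous_map[OF chart_homeomorphic[OF assms(1)]])
  then show "compact (snd c ` K)" by (simp add: compactin_subtopology)
  show "snd c ` K \<subseteq> chart_range c" using assms(3) by (auto simp: chart_range_def)
qed

text \<open>Types are left out, so that both operators and products are covered at once, and so is
  the convention of being 0 outside the charts; \<open>forms_iff\<close> adds the two back.\<close>

definition gform :: "nat \<Rightarrow> ('a, 'n) form \<Rightarrow> bool" where
  "gform k \<omega> \<longleftrightarrow> (\<forall>c\<in>A. locform k (chart_range c) (\<omega> c)) \<and>
     (\<forall>c\<in>A. \<forall>c'\<in>A. \<forall>z\<in>overlap c c'. \<omega> c z = pullback (transition c c') (\<omega> c') z)"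

lemma gform_locform: "gform k \<omega> \<Longrightarrow> c \<in> A \<Longrightarrow> locform k (chart_range c) (\<omega> c)"
  and gform_pullback: "gform k \<omega> \<Longrightarrow> c \<in> A \<Longrightarrow> c' \<in> A \<Longrightarrow> z \<in> overlap c c' \<Longrightarrow>
     \<omega> c z = pullback (transition c c') (\<omega> c') z"
  by (simp_all add: gform_def)

lemma forms_iff:
  "\<omega> \<in> forms A p q \<longleftrightarrow> gform (p + q) \<omega> \<and> (\<forall>c\<in>A. \<forall>z\<in>chart_range c. pq_weight p q (\<omega> c z)) \<and>
     (\<forall>c z. c \<notin> A \<or> z \<notin> chart_range c \<longrightarrow> \<omega> c z = 0)"
  unfolding forms_def gform_def locform_def pullback_def is_pq_covector_iff
  by (auto simp: fun_eq_iff)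

lemma forms_gform: "\<omega> \<in> forms A p q \<Longrightarrow> gform (p + q) \<omega>"
  and forms_pq_weight: "\<omega> \<in> forms A p q \<Longrightarrow> c \<in> A \<Longrightarrow> z \<in> chart_range c \<Longrightarrow> pq_weight p q (\<omega> c z)"
  by (simp_all add: forms_iff)

lemma forms_outside: "\<omega> \<in> forms A p q \<Longrightarrow> c \<notin> A \<or> z \<notin> chart_range c \<Longrightarrow> \<omega> c z = 0"
  unfolding forms_iff by blast

lemma forms_locform: "\<omega> \<in> forms A p q \<Longrightarrow> c \<in> A \<Longrightarrow> locform (p + q) (chart_range c) (\<omega> c)"
  using forms_gform gform_locform by blast

section \<open>The operators on global forms\<close>

definition dd :: "complex \<Rightarrow> nat \<Rightarrow> ('a, 'n) form \<Rightarrow> ('a, 'n) form" where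
  "dd \<epsilon> k \<omega> c z v = (if c \<in> A \<and> z \<in> chart_range c then dloc \<epsilon> k (\<omega> c) z v else 0)"

lemma del_eq: "del A k = dd 1 k" and delbar_eq: "delbar A k = dd (- 1) k"
  by (auto simp: fun_eq_iff del_def delbar_def dd_def dloc_def D10_eq D01_eq)

lemma dd_inside: "c \<in> A \<Longrightarrow> z \<in> chart_range c \<Longrightarrow> dd \<epsilon> k \<omega> c z = dloc \<epsilon> k (\<omega> c) z"
  by (simp add: dd_def fun_eq_iff)

lemma locform_cong:
  assumes "open U" "\<And>z. z \<in> U \<Longrightarrow> \<omega> z = \<eta> z"
  shows "locform k U \<omega> \<longleftrightarrow> locform k U \<eta>"
proof -
  have "smooth_on U (\<lambda>z. \<omega> z v) = smooth_on U (\<lambda>z. \<eta> z v)" for v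
    by (rule smooth_on_cong[OF assms(1)]) (simp add: assms(2))
  then show ?thesis using assms(2) by (simp add: locform_def)
qed

lemma locform_dd: "gform k \<omega> \<Longrightarrow> c \<in> A \<Longrightarrow> locform (Suc k) (chart_range c) (dd \<epsilon> k \<omega> c)"
  using locform_cong[OF open_chart_range, of c "dd \<epsilon> k \<omega> c" "dloc \<epsilon> k (\<omega> c)"] dd_inside
    locform_dloc[OF open_chart_range gform_locform] by blast

lemma gform_dd:
  assumes \<omega>: "gform k \<omega>"
  shows "gform (Suc k) (dd \<epsilon> k \<omega>)"
  unfolding gform_def
proof (intro conjI ballI locform_dd \<omega>)
  fix c c' z assume c: "c \<in> A" "c' \<in> A" and z: "z \<in> overlap c c'"
  note U = open_overlap[OF c] z
  have zc: "z \<in> chart_range c" using z overlap_subset by blast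
  show "dd \<epsilon> k \<omega> c z = pullback (transition c c') (dd \<epsilon> k \<omega> c') z"
  proof
    fix v
    have "dd \<epsilon> k \<omega> c z v = dloc \<epsilon> k (pullback (transition c c') (\<omega> c')) z v"
      unfolding dd_inside[OF c(1) zc] by (rule dloc_cong[OF U gform_pullback[OF \<omega> c]])
    also have "\<dots> = pullback (transition c c') (dloc \<epsilon> k (\<omega> c')) z v"
      using transition(2)[OF c]
      by (intro dloc_pullback[OF U open_chart_range[OF c(2)] transition_holomorphic[OF c] _
            gform_locform[OF \<omega> c(2)]]) auto
    also have "\<dots> = pullback (transition c c') (dd \<epsilon> k \<omega> c') z v"
      by (simp add: pullback_def dd_inside[OF c(2) transition(2)[OF c z]])
    finally show "dd \<epsilon> k \<omega> c z v = pullback (transition c c') (dd \<epsilon> k \<omega> c') z v" .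
  qed
qed

lemma dloc_scale:
  assumes c: "c \<in> A" "z \<in> chart_range c" and \<omega>: "\<omega> \<in> forms A p q"
  shows "dloc \<epsilon> k (\<omega> c) z (\<lambda>i. a *s v i) =
    (\<Sum>i\<le>k. (- 1) ^ i * (a ^ p * cnj a ^ q * Dop \<epsilon> (\<lambda>y. \<omega> c y (omit i v)) z (a *s v i)))"
  unfolding dloc_def
proof (intro sum.cong refl arg_cong2[where f="(*)"])
  fix i
  have "omit i (\<lambda>i. a *s v i) = (\<lambda>j. a *s omit i v j)" by (auto simp: omit_def fun_eq_iff)
  then have "Dop \<epsilon> (\<lambda>y. \<omega> c y (omit i (\<lambda>i. a *s v i))) z (a *s v i)
      = Dop \<epsilon> (\<lambda>y. a ^ p * cnj a ^ q * \<omega> c y (omit i v)) z (a *s v i)"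
    using forms_pq_weight[OF \<omega> c(1)] by (intro Dop_cong[OF open_chart_range[OF c(1)] c(2)]) (simp add: pq_weight_def)
  then show "Dop \<epsilon> (\<lambda>y. \<omega> c y (omit i (\<lambda>i. a *s v i))) z (a *s v i)
      = a ^ p * cnj a ^ q * Dop \<epsilon> (\<lambda>y. \<omega> c y (omit i v)) z (a *s v i)"
    by (simp add: Dop_cmult[OF locform_differentiable[OF forms_locform[OF \<omega> c(1)] c(2)]])
qed

text \<open>In each summand the coefficient contributes the weight of \<open>\<omega>\<close>, and
  the vector of differentiation contributes one more factor \<open>a\<close> or its conjugate by
  \<open>Dop_scale\<close>.\<close>

lemma dd_forms:
  assumes \<omega>: "\<omega> \<in> forms A p q"
  shows "dd 1 (p + q) \<omega> \<in> forms A (Suc p) q" "dd (- 1) (p + q) \<omega> \<in> forms A p (Suc q)"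
proof -
  note d = locform_differentiable[OF forms_locform[OF \<omega>]]
  have "pq_weight (Suc p) q (dd 1 (p + q) \<omega> c z)" "pq_weight p (Suc q) (dd (- 1) (p + q) \<omega> c z)"
    if c: "c \<in> A" "z \<in> chart_range c" for c z
    unfolding pq_weight_def dd_inside[OF c] dloc_scale[OF c \<omega>] Dop_scale[OF d[OF c]]
    by (auto simp: dloc_def sum_distrib_left mult_ac intro!: sum.cong)
  with gform_dd[OF forms_gform[OF \<omega>]]
  show "dd 1 (p + q) \<omega> \<in> forms A (Suc p) q" "dd (- 1) (p + q) \<omega> \<in> forms A p (Suc q)"
    by (auto simp: forms_iff dd_def fun_eq_iff)
qed

lemma dd_anticommute:
  assumes \<omega>: "gform k \<omega>"
  shows "dd \<epsilon> (Suc k) (dd \<delta> k \<omega>) = - dd \<delta> (Suc k) (dd \<epsilon> k \<omega>)"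
proof (intro ext)
  fix c z v
  show "dd \<epsilon> (Suc k) (dd \<delta> k \<omega>) c z v = (- dd \<delta> (Suc k) (dd \<epsilon> k \<omega>)) c z v"
  proof (cases "c \<in> A \<and> z \<in> chart_range c")
    case True
    then have c: "c \<in> A" "z \<in> chart_range c" by auto
    have eq: "dd \<epsilon> (Suc k) (dd \<delta> k \<omega>) c z v = dloc \<epsilon> (Suc k) (dloc \<delta> k (\<omega> c)) z v" for \<epsilon> \<delta>
      unfolding dd_inside[OF c] by (rule dloc_cong[OF open_chart_range[OF c(1)] c(2)]) (rule dd_inside[OF c(1)])
    show ?thesis
      using dloc_anticommute[OF open_chart_range[OF c(1)] c(2) gform_locform[OF \<omega> c(1)], of \<epsilon> \<delta> v]
      by (simp only: eq uminus_apply)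
  qed (auto simp: dd_def)
qed

lemma dd_square:
  assumes "gform k \<omega>"
  shows "dd \<epsilon> (Suc k) (dd \<epsilon> k \<omega>) = 0"
proof -
  have "x = 0" if "x = - x" for x :: "('a, 'n) form"
  proof (intro ext)
    fix c z v
    have "x c z v = - x c z v" using that by (metis uminus_apply)
    then show "x c z v = 0 c z v" by simp
  qed
  then show ?thesis using dd_anticommute[OF assms] by blast
qed

lemma dloc_cmult:
  assumes "locform k U \<omega>" "z \<in> U"
  shows "dloc \<epsilon> k (\<lambda>z v. a * \<omega> z v) z v = a * dloc \<epsilon> k \<omega> z v"
  unfolding dloc_def by (simp add: Dop_cmult[OF locform_differentiable[OF assms]] sum_distrib_left mult.left_commute)

lemma dloc_add:
  assumes "locform k U \<omega>" "locform k U \<eta>" "z \<in> U"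
  shows "dloc \<epsilon> k (\<lambda>z v. \<omega> z v + \<eta> z v) z v = dloc \<epsilon> k \<omega> z v + dloc \<epsilon> k \<eta> z v"
  unfolding dloc_def
  by (simp add: Dop_add[OF locform_differentiable[OF assms(1,3)] locform_differentiable[OF assms(2,3)]]
      sum.distrib distrib_left)

lemma dd_add:
  assumes "gform k \<omega>" "gform k \<eta>"
  shows "dd \<epsilon> k (\<omega> + \<eta>) = dd \<epsilon> k \<omega> + dd \<epsilon> k \<eta>"
proof (intro ext)
  fix c z v
  show "dd \<epsilon> k (\<omega> + \<eta>) c z v = (dd \<epsilon> k \<omega> + dd \<epsilon> k \<eta>) c z v"
    using dloc_add[OF gform_locform[OF assms(1)] gform_locform[OF assms(2)], of c z \<epsilon> v]
    by (auto simp: dd_def plus_fun_def)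
qed

lemma dd_uminus:
  assumes "gform k \<omega>"
  shows "dd \<epsilon> k (- \<omega>) = - dd \<epsilon> k \<omega>"
proof (intro ext)
  fix c z v
  show "dd \<epsilon> k (- \<omega>) c z v = (- dd \<epsilon> k \<omega>) c z v"
    using dloc_cmult[OF gform_locform[OF assms(1)], of c z \<epsilon> "- 1" v]
    by (auto simp: dd_def fun_Compl_def)
qed

lemma locform_add:
  "open U \<Longrightarrow> locform k U \<omega> \<Longrightarrow> locform k U \<eta> \<Longrightarrow> locform k U (\<lambda>z v. \<omega> z v + \<eta> z v)"
  by (simp add: locform_def altform_add smooth_on_add)

lemma locform_cmult: "open U \<Longrightarrow> locform k U \<omega> \<Longrightarrow> locform k U (\<lambda>z v. a * \<omega> z v)"
  by (simp add: locform_def altform_cmult smooth_on_mult smooth_on_const)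

lemma forms_add:
  assumes "\<omega> \<in> forms A p q" "\<eta> \<in> forms A p q"
  shows "\<omega> + \<eta> \<in> forms A p q"
  using assms locform_add[OF open_chart_range]
  unfolding forms_iff gform_def
  by (auto simp: plus_fun_def pq_weight_def pullback_def distrib_left zero_fun_def)

lemma forms_uminus:
  assumes "\<omega> \<in> forms A p q"
  shows "- \<omega> \<in> forms A p q"
  using assms locform_cmult[OF open_chart_range, of _ _ _ "- 1"]
  unfolding forms_iff gform_def
  by (auto simp: fun_Compl_def pq_weight_def pullback_def zero_fun_def)

lemma forms_zero: "0 \<in> forms A p q"
  unfolding forms_iff gform_def locform_def
  by (auto simp: zero_fun_def pullback_def pq_weight_def altform_zero smooth_on_const open_chart_range)

lemma forms_diff: "\<omega> \<in> forms A p q \<Longrightarrow> \<eta> \<in> forms A p q \<Longrightarrow> \<omega> - \<eta> \<in> forms A p q"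
  using forms_add[OF _ forms_uminus, of \<omega> p q \<eta>] by simp

text \<open>Takes care of the bidegrees beyond the dimension, which the pairing does not see because
  it sums over \<open>p, q \<le> CARD('n)\<close>.\<close>

lemma forms_gt_zero:
  assumes "\<omega> \<in> forms A p q" "p > CARD('n) \<or> q > CARD('n)"
  shows "\<omega> = 0"
proof (intro ext)
  fix c z v
  show "\<omega> c z v = 0 c z v"
  proof (cases "c \<in> A \<and> z \<in> chart_range c")
    case True
    then have "is_pq_covector p q (\<omega> c z)" using assms by (auto simp: forms_def)
    then show ?thesis using is_pq_covector_gt_zero[OF _ assms(2)] by simp
  qed (use forms_outside[OF assms(1)] in auto)
qed

lemma gform_wedge:
  assumes \<alpha>: "gform k \<alpha>" and \<beta>: "gform l \<beta>"
  shows "gform (k + l) (wedge k l \<alpha> \<beta>)"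
  unfolding gform_def
proof (intro conjI ballI)
  fix c assume "c \<in> A"
  then show "locform (k + l) (chart_range c) (wedge k l \<alpha> \<beta> c)"
    unfolding wedge_def[abs_def] by (intro locform_wedge open_chart_range gform_locform[OF \<alpha>] gform_locform[OF \<beta>])
next
  fix c c' z assume "c \<in> A" "c' \<in> A" "z \<in> overlap c c'"
  then show "wedge k l \<alpha> \<beta> c z = pullback (transition c c') (wedge k l \<alpha> \<beta> c') z"
    using gform_pullback[OF \<alpha>] gform_pullback[OF \<beta>]
    by (simp add: wedge_def wedge_covectors_def pullback_def fun_eq_iff)
qed

subsection \<open>Partitions of unity\<close>

lemma exists_chart_ball:
  assumes "x \<in> topspace X"
  shows "\<exists>c r. c \<in> A \<and> x \<in> fst c \<and> r > 0 \<and> cball (snd c x) r \<subseteq> chart_range c"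
proof -
  obtain c where c: "c \<in> A" "x \<in> fst c" using assms charts_cover by blast
  then have "open (chart_range c)" "snd c x \<in> chart_range c"
    by (auto intro: open_chart_range chart_in_range)
  then obtain r where "r > 0" "cball (snd c x) r \<subseteq> chart_range c"
    using open_contains_cball by blast
  with c show ?thesis by blast
qed

definition chart_bump :: "('a, 'n) chart \<Rightarrow> complex ^ 'n \<Rightarrow> real \<Rightarrow> 'a \<Rightarrow> real" where
  "chart_bump c a r y = (if y \<in> fst c then bump a r (snd c y) else 0)"

lemma chart_bump_support:
  assumes "c \<in> A" "r > 0" "chart_bump c a r y \<noteq> 0"
  shows "y \<in> fst c" "snd c y \<in> ball a r"
  using assms bump_nonzero_iff[OF assms(2)] by (auto simp: chart_bump_def split: if_splits)

text \<open>A compact subset of a Hausdorff space is closed. It is closedness in all of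
  \<open>X\<close>, and not merely in the chart, that allows functions to be extended by
  zero.\<close>

lemma closedin_chart_cball:
  assumes "Hausdorff_space X" "c \<in> A" "cball a r \<subseteq> chart_range c"
  shows "closedin X (chart_inv c ` cball a r)"
proof -
  have "compactin (top_of_set (chart_range c)) (cball a r)"
    using assms(3) by (simp add: compactin_subtopology)
  then have "compactin X (chart_inv c ` cball a r)"
    by (rule image_compactin) (rule continuous_chart_inv[OF assms(2)])
  then show ?thesis using assms(1) by (simp add: compactin_imp_closedin)
qed

text \<open>Locally there are two cases. Inside the domain of \<open>c\<close> the function is a
  bump composed with a transition map; at any other point it vanishes on a neighbourhood, the
  complement of the closed image of the ball.\<close>

lemma smooth_on_chart_bump:
  assumes H: "Hausdorff_space X" and c: "c \<in> A" and r: "r > 0" and sub: "cball a r \<subseteq> chart_range c"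
    and c': "c' \<in> A"
  shows "smooth_on (chart_range c') (\<lambda>z. chart_bump c a r (chart_inv c' z))"
proof (rule smooth_on_locally)
  fix z assume z: "z \<in> chart_range c'"
  let ?K = "chart_inv c ` cball a r" and ?f = "\<lambda>z. chart_bump c a r (chart_inv c' z)"
  have K: "?K \<subseteq> fst c" using sub chart_inv_in by blast
  show "\<exists>U. open U \<and> z \<in> U \<and> smooth_on U ?f"
  proof (cases "chart_inv c' z \<in> fst c")
    case True
    have U: "open (overlap c' c)" "z \<in> overlap c' c"
      using open_overlap[OF c' c] True z c' by (auto simp: overlap_iff)
    have "smooth_on (overlap c' c) (\<lambda>z. bump a r (transition c' c z))"
      by (rule smooth_on_compose[OF U(1) open_UNIV smooth_on_bump])
        (use holomorphic_map_onD(1)[OF transition_holomorphic[OF c' c]] in auto)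
    then have "smooth_on (overlap c' c) ?f"
      using smooth_on_cong[OF U(1), of ?f "\<lambda>z. bump a r (transition c' c z)"] overlap_iff[OF c']
      by (simp add: chart_bump_def transition_def)
    then show ?thesis using U by blast
  next
    case False
    let ?U = "snd c' ` (fst c' \<inter> (topspace X - ?K))"
    have U: "open ?U"
      by (intro open_chart_image c' openin_diff openin_topspace closedin_chart_cball H c sub)
    have "z \<in> ?U" unfolding chart_image_iff[OF c']
      using z False K chart_subset_topspace[OF c'] chart_inv_in[OF z] by blast
    moreover have "?f y = 0" if "y \<in> ?U" for y
    proof (rule ccontr)
      assume "?f y \<noteq> 0"
      then have 1: "chart_inv c' y \<in> fst c" "snd c (chart_inv c' y) \<in> cball a r"
        using chart_bump_support[OF c r] ball_subset_cball by blast+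
      then have "chart_inv c' y \<in> ?K" using chart_inv_chart[OF c 1(1)] by (metis image_eqI)
      with that show False unfolding chart_image_iff[OF c'] by blast
    qed
    then have "smooth_on ?U ?f"
      using smooth_on_cong[OF U, of ?f "\<lambda>_. 0"] smooth_on_const[OF U] by blast
    ultimately show ?thesis using U by blast
  qed
qed

text \<open>By compactness finitely many bumps suffice to have no common zero on \<open>X\<close>;
  they are divided by their sum.\<close>

theorem exists_partition_of_unity:
  assumes H: "Hausdorff_space X" and K: "compact_space X"
  shows "\<exists>C \<rho>. partition_of_unity X A C \<rho>"
proof -
  obtain ch r where ch: "\<And>x. x \<in> topspace X \<Longrightarrow> ch x \<in> A \<and> x \<in> fst (ch x) \<and> r x > 0 \<and>
      cball (snd (ch x) x) (r x) \<subseteq> chart_range (ch x)"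
    using exists_chart_ball by metis
  define f where "f x = chart_bump (ch x) (snd (ch x) x) (r x)" for x
  define U where "U x = topspace X \<inter> {y. f x y \<noteq> 0}" for x
  \<comment> \<open>A closed set inside the chart that contains all points where \<open>f x\<close>
    is nonzero. It keeps the closure of these points, taken in \<open>X\<close>, from leaving the
    chart.\<close>
  define L where "L x = chart_inv (ch x) ` cball (snd (ch x) x) (r x)" for x
  have f_nonneg: "0 \<le> f x y" for x y by (simp add: f_def chart_bump_def bump_nonneg)
  have f_smooth: "smooth_on (chart_range c') (\<lambda>z. f x (chart_inv c' z))" if "x \<in> topspace X" "c' \<in> A" for x c'
    unfolding f_def using ch[OF that(1)] that(2) by (intro smooth_on_chart_bump H) auto
  have L: "closedin X (L x)" "L x \<subseteq> fst (ch x)" if "x \<in> topspace X" for x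
    unfolding L_def using ch[OF that] closedin_chart_cball[OF H] chart_inv_in by blast+
  have supp: "y \<in> L x" if "x \<in> topspace X" "f x y \<noteq> 0" for x y
  proof -
    have "y \<in> fst (ch x)" "snd (ch x) y \<in> cball (snd (ch x) x) (r x)"
      using chart_bump_support[of "ch x" "r x" "snd (ch x) x" y] ch[OF that(1)] that(2)
        ball_subset_cball by (auto simp: f_def)
    then show ?thesis unfolding L_def using chart_inv_chart[of "ch x" y] ch[OF that(1)] by (metis image_eqI)
  qed
  have U_open: "openin X (U x)" if x: "x \<in> topspace X" for x
  proof -
    have "U x = {y \<in> topspace (subtopology X (fst (ch x))). snd (ch x) y \<in> ball (snd (ch x) x) (r x)}"
      using ch[OF x] bump_nonzero_iff[of "r x"] chart_subset_topspace[of "ch x"]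
      by (auto simp: U_def f_def chart_bump_def)
    also have "openin (subtopology X (fst (ch x))) \<dots>"
    proof (rule openin_continuous_map_preimage)
      show "continuous_map (subtopology X (fst (ch x))) (top_of_set (chart_range (ch x))) (snd (ch x))"
        using ch[OF x] chart_homeomorphic homeomorphic_imp_continuous_map by blast
      show "openin (top_of_set (chart_range (ch x))) (ball (snd (ch x) x) (r x))"
        using ch[OF x] ball_subset_cball by (intro open_subset) auto
    qed
    finally show ?thesis using ch[OF x] chart_openin openin_trans_full by blast
  qed
  have x_U: "x \<in> U x" if "x \<in> topspace X" for x
    using that ch[OF that] bump_nonzero_iff[of "r x" "snd (ch x) x" "snd (ch x) x"]
    by (simp add: U_def f_def chart_bump_def)
  have "compactin X (topspace X)" using K by (simp add: compact_space_def)
  then obtain \<F> where \<F>: "finite \<F>" "\<F> \<subseteq> U ` topspace X" "topspace X \<subseteq> \<Union>\<F>"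
    using compactinD[of X "topspace X" "U ` topspace X"] U_open x_U by blast
  obtain F where F: "F \<subseteq> topspace X" "finite F" "\<F> = U ` F"
    using finite_subset_image[OF \<F>(1,2)] by blast
  define S where "S y = (\<Sum>x\<in>F. f x y)" for y
  have S_pos: "S y > 0" if y: "y \<in> topspace X" for y
  proof -
    obtain x where "x \<in> F" "f x y \<noteq> 0" using y \<F>(3) F(3) by (auto simp: U_def)
    then show ?thesis unfolding S_def using F(2) f_nonneg by (intro sum_pos2[of F x]) (auto simp: less_le)
  qed
  \<comment> \<open>Several points may have been given the same chart, while the partition is
    indexed by charts; their bumps are added.\<close>
  define \<rho> where "\<rho> c y = (\<Sum>x\<in>{x\<in>F. ch x = c}. f x y) / S y" for c y
  have "partition_of_unity X A (ch ` F) \<rho>"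
    unfolding partition_of_unity_def
  proof (intro conjI ballI)
    show "finite (ch ` F)" "ch ` F \<subseteq> A" using F ch by auto
  next
    fix c c' assume "c \<in> ch ` F" and c': "c' \<in> A"
    have "smooth_on (chart_range c') (\<lambda>z. (\<Sum>x\<in>{x\<in>F. ch x = c}. f x (chart_inv c' z)) / (\<Sum>x\<in>F. f x (chart_inv c' z)))"
    proof (intro smooth_on_divide smooth_on_sum open_chart_range c' f_smooth)
      fix z assume "z \<in> chart_range c'"
      then have "chart_inv c' z \<in> topspace X" using chart_inv_in chart_subset_topspace[OF c'] by blast
      then show "(\<Sum>x\<in>F. f x (chart_inv c' z)) \<noteq> 0" using S_pos by (force simp: S_def)
    qed (use F in auto)
    then show "smooth_on (chart_range c') (\<rho> c \<circ> chart_inv c')"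
      by (simp add: \<rho>_def S_def comp_def)
  next
    fix c y assume "c \<in> ch ` F" "y \<in> topspace X"
    then show "0 \<le> \<rho> c y" unfolding \<rho>_def using S_pos[of y] f_nonneg by (auto intro!: divide_nonneg_pos sum_nonneg)
  next
    fix c assume "c \<in> ch ` F"
    have "X closure_of {x \<in> topspace X. \<rho> c x \<noteq> 0} \<subseteq> (\<Union>x\<in>{x\<in>F. ch x = c}. L x)"
    proof (rule closure_of_minimal)
      show "{x \<in> topspace X. \<rho> c x \<noteq> 0} \<subseteq> (\<Union>x\<in>{x\<in>F. ch x = c}. L x)"
      proof
        fix y assume "y \<in> {x \<in> topspace X. \<rho> c x \<noteq> 0}"
        then have "(\<Sum>x\<in>{x\<in>F. ch x = c}. f x y) \<noteq> 0" by (auto simp: \<rho>_def)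
        then obtain x where "x \<in> F" "ch x = c" "f x y \<noteq> 0" by (metis (mono_tags, lifting) mem_Collect_eq sum.neutral)
        then show "y \<in> (\<Union>x\<in>{x\<in>F. ch x = c}. L x)" using supp F by blast
      qed
      show "closedin X (\<Union>x\<in>{x\<in>F. ch x = c}. L x)"
        using F L(1) by (intro closedin_Union) auto
    qed
    then show "X closure_of {x \<in> topspace X. \<rho> c x \<noteq> 0} \<subseteq> fst c" using L(2) F by blast
  next
    fix y assume y: "y \<in> topspace X"
    have "(\<Sum>c\<in>ch ` F. \<rho> c y) = (\<Sum>c\<in>ch ` F. \<Sum>x\<in>{x\<in>F. ch x = c}. f x y) / S y"
      by (simp add: \<rho>_def sum_divide_distrib)
    also have "(\<Sum>c\<in>ch ` F. \<Sum>x\<in>{x\<in>F. ch x = c}. f x y) = S y"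
      unfolding S_def using F(2) by (intro sum.group) auto
    finally show "(\<Sum>c\<in>ch ` F. \<rho> c y) = 1" using S_pos[OF y] by simp
  qed
  then show ?thesis by blast
qed

end

section \<open>Integration\<close>

lemma set_integral_compact_support:
  fixes f :: "'a::euclidean_space \<Rightarrow> 'b::euclidean_space"
  assumes K: "compact K" "K \<subseteq> U" and f: "continuous_on U f" "\<And>z. z \<in> U - K \<Longrightarrow> f z = 0"
  shows "set_integrable lborel U f" "(LINT z:U|lborel. f z) = (LINT z:K|lborel. f z)"
proof -
  have eq: "(\<lambda>z. indicator U z *\<^sub>R f z) = (\<lambda>z. indicator K z *\<^sub>R f z)"
    using K(2) f(2) by (auto simp: fun_eq_iff indicator_def)
  have "integrable lborel (\<lambda>z. indicator K z *\<^sub>R f z)"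
    using continuous_on_subset[OF f(1) K(2)] by (rule borel_integrable_compact[OF K(1)])
  then show "set_integrable lborel U f" "(LINT z:U|lborel. f z) = (LINT z:K|lborel. f z)"
    by (simp_all add: set_integrable_def set_lebesgue_integral_def eq)
qed

lemma lborel_integral_translate:
  fixes f :: "'a::euclidean_space \<Rightarrow> 'b::euclidean_space"
  assumes "f \<in> borel_measurable borel"
  shows "(\<integral>x. f (c + x) \<partial>lborel) = (\<integral>x. f x \<partial>lborel)"
    and "integrable lborel f \<Longrightarrow> integrable lborel (\<lambda>x. f (c + x))"
proof -
  have "(\<integral>x. f x \<partial>lborel) = (\<integral>x. f x \<partial>distr lborel borel ((+) c))" by (simp add: lborel_distr_plus)
  also have "\<dots> = (\<integral>x. f (c + x) \<partial>lborel)" using assms by (intro integral_distr) auto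
  finally show "(\<integral>x. f (c + x) \<partial>lborel) = (\<integral>x. f x \<partial>lborel)" ..
  assume "integrable lborel f"
  then have "integrable (distr lborel borel ((+) c)) f" by (simp add: lborel_distr_plus)
  then show "integrable lborel (\<lambda>x. f (c + x))" using assms by (subst (asm) integrable_distr_eq) auto
qed

text \<open>By translation invariance, the difference quotients of \<open>g\<close> already have integral zero.\<close>

lemma integral_directional_derivative_zero:
  fixes g :: "'a::euclidean_space \<Rightarrow> 'b::euclidean_space"
  assumes g: "Ck_on 1 UNIV g" and K: "compact K" "\<And>x. x \<notin> K \<Longrightarrow> g x = 0"
  shows "integrable lborel (\<lambda>x. frechet_derivative g (at x) w)"
    and "(\<integral>x. frechet_derivative g (at x) w \<partial>lborel) = 0"
    and "\<And>x. x \<notin> K \<Longrightarrow> frechet_derivative g (at x) w = 0"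
proof -
  let ?D = "\<lambda>x. frechet_derivative g (at x) w"
  have D: "(g has_derivative frechet_derivative g (at x)) (at x)" for x
    using g by (intro Ck_on_has_derivative[of 0 UNIV]) simp_all
  have contD: "continuous_on UNIV ?D" using g by simp
  have contg: "continuous_on UNIV g" using Ck_on_le[OF g, of 0] by simp
  show zero: "?D x = 0" if "x \<notin> K" for x
  proof -
    have "open (- K)" using K(1) compact_imp_closed by blast
    then have "frechet_derivative g (at x) = frechet_derivative (\<lambda>_. 0 :: 'b) (at x)"
      by (rule frechet_derivative_cong_open) (use that K(2) in auto)
    then show ?thesis by (simp add: frechet_derivative_eq[OF has_derivative_const])
  qed
  have integrable: "integrable lborel f" if "continuous_on UNIV f" "\<And>x. x \<notin> K \<Longrightarrow> f x = 0" for f :: "'a \<Rightarrow> 'b"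
    using set_integral_compact_support(1)[OF K(1) subset_UNIV that(1)] that(2) by (simp add: set_integrable_def)
  show "integrable lborel ?D" by (rule integrable[OF contD zero])
  note intg = integrable[OF contg K(2)]
  have meas: "g \<in> borel_measurable borel" using contg by (rule borel_measurable_continuous_onI)
  have "bounded (?D ` K)"
    using continuous_on_subset[OF contD subset_UNIV] K(1) by (intro compact_imp_bounded compact_continuous_image)
  then obtain M where M: "M > 0" "\<And>x. x \<in> K \<Longrightarrow> norm (?D x) \<le> M" by (auto simp: bounded_pos)
  have DM: "norm (?D x) \<le> M" for x
    using M zero[of x] by (cases "x \<in> K") auto
  have lin: "linear (frechet_derivative g (at x))" for x by (rule has_derivative_linear[OF D])
  have line: "((\<lambda>t. g (x + t *\<^sub>R w)) has_derivative (\<lambda>h. h *\<^sub>R ?D (x + t *\<^sub>R w))) (at t)" for x t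
  proof -
    have "((\<lambda>t. x + t *\<^sub>R w) has_derivative (\<lambda>h. h *\<^sub>R w)) (at t)"
      by (auto intro!: derivative_eq_intros)
    from has_derivative_compose[OF this D] show ?thesis by (simp add: linear_cmul[OF lin])
  qed
  \<comment> \<open>Step sizes at most 1, so that the supports of all difference quotients stay in
    one compact set.\<close>
  define s :: "nat \<Rightarrow> real" where "s m = 1 / real (Suc m)" for m
  have s: "s m > 0" "s m \<le> 1" for m by (auto simp: s_def)
  let ?q = "\<lambda>m x. inverse (s m) *\<^sub>R (g (s m *\<^sub>R w + x) - g x)"
  \<comment> \<open>\<open>K\<close> swept along \<open>- w\<close> for times in
    \<open>{0..1}\<close>: off \<open>K'\<close> both terms of every difference quotient
    vanish.\<close>
  define K' where "K' = (\<lambda>(x, t). x - t *\<^sub>R w) ` (K \<times> {0..1})"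
  have K': "compact K'"
    unfolding K'_def using K(1)
    by (intro compact_continuous_image compact_Times compact_Icc) (auto simp: case_prod_unfold intro!: continuous_intros)
  have notK': "g (x + t *\<^sub>R w) = 0" if "x \<notin> K'" "0 \<le> t" "t \<le> 1" for x t
  proof (rule K(2), rule notI)
    assume "x + t *\<^sub>R w \<in> K"
    then have "x \<in> K'" unfolding K'_def using that by (intro image_eqI[of _ _ "(x + t *\<^sub>R w, t)"]) auto
    with that show False by simp
  qed
  \<comment> \<open>The mean value inequality bounds the quotients uniformly in \<open>m\<close>,
    which gives the dominating function.\<close>
  have bound: "norm (?q m x) \<le> indicator K' x *\<^sub>R M" for m x
  proof (cases "x \<in> K'")
    case True
    have "\<exists>t\<in>{0<..<s m}. norm (g (x + s m *\<^sub>R w) - g (x + 0 *\<^sub>R w)) \<le> norm ((s m - 0) *\<^sub>R ?D (x + t *\<^sub>R w))"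
      by (rule mvt_general[OF s(1)])
        (auto intro!: line continuous_at_imp_continuous_on has_derivative_continuous[OF line])
    then obtain t where t: "norm (g (x + s m *\<^sub>R w) - g x) \<le> norm (s m *\<^sub>R ?D (x + t *\<^sub>R w))" by auto
    also have "\<dots> \<le> s m * M" using DM[of "x + t *\<^sub>R w"] s[of m] by simp
    finally have "norm (g (x + s m *\<^sub>R w) - g x) \<le> s m * M" .
    then have "inverse (s m) * norm (g (x + s m *\<^sub>R w) - g x) \<le> M"
      using s(1)[of m] by (simp add: field_simps)
    then show ?thesis using True s(1)[of m] by (simp add: add.commute less_imp_le)
  next
    case False
    then show ?thesis using notK'[OF False, of "s m"] notK'[OF False, of 0] s[of m]
      by (simp add: add.commute)
  qed
  have lim: "(\<lambda>m. ?q m x) \<longlonglongrightarrow> ?D x" for x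
  proof -
    let ?r = "\<lambda>h. inverse h *\<^sub>R (g (x + h *\<^sub>R w) - g x) - ?D x"
    have lim: "((\<lambda>h. norm (g (x + h *\<^sub>R w) - g x - h *\<^sub>R ?D x) / norm h) \<longlongrightarrow> 0) (at 0)"
      using line[of x 0] by (simp add: has_derivative_iff_norm)
    have eq: "norm (g (x + h *\<^sub>R w) - g x - h *\<^sub>R ?D x) / norm h = norm (?r h)" if "h \<noteq> 0" for h
    proof -
      have "g (x + h *\<^sub>R w) - g x - h *\<^sub>R ?D x = h *\<^sub>R ?r h" using that by (simp add: scaleR_diff_right)
      then show ?thesis using that by simp
    qed
    have "((\<lambda>h. norm (?r h)) \<longlongrightarrow> 0) (at 0)"
      by (rule Lim_transform_eventually[OF lim]) (unfold eventually_at_filter, intro always_eventually allI impI eq)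
    then have 1: "((\<lambda>h. inverse h *\<^sub>R (g (x + h *\<^sub>R w) - g x)) \<longlongrightarrow> ?D x) (at 0)"
      by (subst Lim_null) (rule tendsto_norm_zero_cancel)
    have "filterlim s (at 0) sequentially"
    proof -
      have "s \<longlonglongrightarrow> 0" using LIMSEQ_inverse_real_of_nat by (simp add: s_def[abs_def] inverse_eq_divide)
      then show ?thesis unfolding filterlim_at using s(1) by (auto simp: less_imp_neq[symmetric])
    qed
    from filterlim_compose[OF 1 this] show ?thesis by (simp add: add.commute)
  qed
  have "(\<lambda>m. \<integral>x. ?q m x \<partial>lborel) \<longlonglongrightarrow> (\<integral>x. ?D x \<partial>lborel)" (is "?I \<longlonglongrightarrow> _")
  proof (rule integral_dominated_convergence[where w="\<lambda>x. indicator K' x *\<^sub>R M"])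
    show "?D \<in> borel_measurable lborel" using borel_measurable_continuous_onI[OF contD] by simp
    show "?q m \<in> borel_measurable lborel" for m
      using contg by (auto intro!: borel_measurable_continuous_onI continuous_intros continuous_on_compose2[OF contg])
    show "integrable lborel (\<lambda>x. indicator K' x *\<^sub>R M)"
      by (rule borel_integrable_compact[OF K']) simp
  qed (use lim bound in auto)
  moreover have "(\<integral>x. ?q m x \<partial>lborel) = 0" for m
    using lborel_integral_translate[OF meas, of "s m *\<^sub>R w"] intg by simp
  then have "?I = (\<lambda>_. 0)" by (rule ext)
  ultimately have "(\<lambda>_. 0) \<longlonglongrightarrow> (\<integral>x. ?D x \<partial>lborel)" by (simp only:)
  then show "(\<integral>x. ?D x \<partial>lborel) = 0" by (rule LIMSEQ_unique) (rule tendsto_const)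
qed

subsection \<open>Change of variables\<close>

lemma inner_real_frame: "w \<bullet> real_frame j = frame_coord w j"
  by (auto simp: real_frame_def frame_coord_def inner_axis inner_complex_def)

lemma Basis_real_frame:
  "bij_betw real_frame {..<2 * CARD('n)} (Basis :: (complex ^ 'n::finite) set)"
proof -
  have nth: "coord_list ! i = (coord_list ! j :: 'n) \<longleftrightarrow> i = j" if "i < CARD('n)" "j < CARD('n)" for i j
    using nth_eq_iff_index_eq[OF coord_list(1)[where 'n='n]] that by (simp add: length_coord_list)
  have "inj_on (real_frame :: nat \<Rightarrow> complex^'n) {..<2 * CARD('n)}"
  proof (rule inj_onI)
    fix i j assume "i \<in> {..<2 * CARD('n)}" "j \<in> {..<2 * CARD('n)}" and eq: "real_frame i = (real_frame j :: complex^'n)"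
    then have ij: "i div 2 < CARD('n)" "j div 2 < CARD('n)" by auto
    have "coord_list ! (i div 2) = (coord_list ! (j div 2) :: 'n) \<and> (even i \<longleftrightarrow> even j)"
      using eq by (auto simp: real_frame_def axis_eq_axis complex_eq_iff split: if_splits)
    with nth[OF ij] show "i = j" by (metis bit_eq_rec even_iff_mod_2_eq_zero div_mult_mod_eq mod2_eq_if)
  qed
  moreover have "real_frame ` {..<2 * CARD('n)} = (Basis :: (complex^'n) set)"
  proof (intro equalityI subsetI)
    fix b :: "complex^'n" assume "b \<in> real_frame ` {..<2 * CARD('n)}"
    then show "b \<in> Basis" by (auto simp: real_frame_def Basis_vec_def Basis_complex_def)
  next
    fix b :: "complex^'n" assume "b \<in> Basis"
    then obtain k u where b: "b = axis k u" "u = 1 \<or> u = \<i>" by (auto simp: Basis_vec_def Basis_complex_def)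
    obtain i where i: "i < CARD('n)" "coord_list ! i = k"
      using bij_betw_imp_surj_on[OF bij_betw_coord_list[where 'n='n]] by (metis UNIV_I imageE lessThan_iff)
    show "b \<in> real_frame ` {..<2 * CARD('n)}"
    proof (cases "u = 1")
      case True
      then have "b = real_frame (2 * i)" using b i by (simp add: real_frame_def)
      then show ?thesis using i by auto
    next
      case False
      then have "b = real_frame (Suc (2 * i))" using b i by (simp add: real_frame_def)
      then show ?thesis using i by auto
    qed
  qed
  ultimately show ?thesis by (simp add: bij_betw_def)
qed

text \<open>\<open>lborel\<close> is characterised by its values on boxes. As \<open>b\<close>
  enumerates \<open>Basis\<close>, the preimage of a box under \<open>T\<close> is a box with the
  same side lengths.\<close>

lemma lborel_distr_isometry:
  fixes T :: "real ^ 'k::finite \<Rightarrow> 'b::euclidean_space"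
  assumes b: "bij_betw b UNIV Basis" and T: "\<And>x. T x = (\<Sum>i\<in>UNIV. x $ i *\<^sub>R b i)"
  shows "distr lborel borel T = lborel"
proof (rule lborel_eqI[symmetric])
  have inner: "T x \<bullet> b i = x $ i" for x i
  proof -
    have "T x \<bullet> b i = (\<Sum>j\<in>UNIV. if j = i then x $ i else 0)"
      unfolding T inner_sum_left
      using bij_betwE[OF b] bij_betw_imp_inj_on[OF b]
      by (intro sum.cong) (auto simp: inner_Basis dest: injD)
    then show ?thesis by simp
  qed
  have "linear T"
    by (intro linearI) (auto simp: T sum.distrib scaleR_sum_right algebra_simps)
  then have T_meas: "T \<in> borel_measurable lborel"
    using linear_continuous_on[OF linear_conv_bounded_linear[THEN iffD1]]
    by (auto intro!: borel_measurable_continuous_onI)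
  fix l u :: 'b assume le: "\<And>b. b \<in> Basis \<Longrightarrow> l \<bullet> b \<le> u \<bullet> b"
  let ?l = "\<chi> i. l \<bullet> b i" and ?u = "\<chi> i. u \<bullet> b i"
  have "T -` box l u = box ?l ?u"
  proof -
    have "T x \<in> box l u \<longleftrightarrow> (\<forall>i. l \<bullet> b i < T x \<bullet> b i \<and> T x \<bullet> b i < u \<bullet> b i)" for x
      unfolding mem_box bij_betw_imp_surj_on[OF b, symmetric] by simp
    then show ?thesis by (auto simp: mem_box_cart inner)
  qed
  then have "emeasure (distr lborel borel T) (box l u) = emeasure lborel (box ?l ?u)"
    using T_meas by (subst emeasure_distr) auto
  also have "\<dots> = ennreal (\<Prod>c\<in>Basis. (?u - ?l) \<bullet> c)"
    by (rule emeasure_lborel_box) (use le bij_betwE[OF b] in \<open>auto simp: Basis_vec_def inner_axis\<close>)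
  also have "(\<Prod>c\<in>Basis. (?u - ?l) \<bullet> c) = (\<Prod>i\<in>UNIV. (u - l) \<bullet> b i)"
  proof -
    have Basis: "(Basis :: (real^'k) set) = range (\<lambda>i. axis i 1)" by (auto simp: Basis_vec_def)
    have inj: "inj (\<lambda>i::'k. axis i (1::real))" by (auto simp: inj_on_def axis_eq_axis)
    show ?thesis unfolding Basis prod.reindex[OF inj] by (simp add: inner_axis inner_diff_left)
  qed
  also have "\<dots> = (\<Prod>c\<in>Basis. (u - l) \<bullet> c)" by (rule prod.reindex_bij_betw[OF b])
  finally show "emeasure (distr lborel borel T) (box l u) = ennreal (\<Prod>c\<in>Basis. (u - l) \<bullet> c)" .
qed simp

text \<open>The change of variables theorem of the library is about \<open>real ^ 'k\<close> for a well-ordered type \<open>'k\<close>;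
  \<open>'n bit0\<close> is such a type with \<open>2 * CARD('n)\<close> elements.\<close>

lemma change_of_variables_real:
  fixes \<phi> :: "complex ^ 'n::finite \<Rightarrow> complex ^ 'n" and f :: "complex ^ 'n \<Rightarrow> real"
  assumes U: "open U" and \<phi>: "\<And>z. z \<in> U \<Longrightarrow> (\<phi> has_derivative \<phi>' z) (at z)" "inj_on \<phi> U"
    and f: "set_integrable lborel (\<phi> ` U) f"
    and f': "set_integrable lborel U (\<lambda>z. \<bar>frame_det (\<phi>' z)\<bar> * f (\<phi> z))"
  shows "(LINT z:U|lborel. \<bar>frame_det (\<phi>' z)\<bar> * f (\<phi> z)) = (LINT z:\<phi> ` U|lborel. f z)"
proof -
  have "card (UNIV :: 'n bit0 set) = card {..<2 * CARD('n)}" by simp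
  then obtain e :: "'n bit0 \<Rightarrow> nat" where e: "bij_betw e UNIV {..<2 * CARD('n)}"
    using finite_same_card_bij[of "UNIV :: 'n bit0 set" "{..<2 * CARD('n)}"] by auto
  define T :: "real ^ 'n bit0 \<Rightarrow> complex ^ 'n" where "T x = (\<Sum>i\<in>UNIV. x $ i *\<^sub>R real_frame (e i))" for x
  define S :: "complex ^ 'n \<Rightarrow> real ^ 'n bit0" where "S w = (\<chi> i. frame_coord w (e i))" for w
  have b: "bij_betw (\<lambda>i. real_frame (e i) :: complex^'n) UNIV Basis"
    using bij_betw_trans[OF e Basis_real_frame] by (simp add: comp_def)
  have linT: "linear T" by (intro linearI) (auto simp: T_def sum.distrib scaleR_sum_right algebra_simps)
  have linS: "linear S"
    by (intro linearI) (auto simp: S_def vec_eq_iff inner_real_frame[symmetric] inner_add_left)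
  have bT: "bounded_linear T" and bS: "bounded_linear S"
    using linT linS by (auto simp: linear_conv_bounded_linear)
  have TS: "T (S w) = w" for w
  proof -
    have "T (S w) = (\<Sum>i\<in>UNIV. frame_coord w (e i) *\<^sub>R real_frame (e i))" by (simp add: T_def S_def)
    also have "\<dots> = (\<Sum>j<2 * CARD('n). frame_coord w j *\<^sub>R real_frame j)" by (rule sum.reindex_bij_betw[OF e])
    finally show ?thesis by (simp add: frame_expansion[symmetric])
  qed
  have ST: "S (T x) = x" for x
  proof -
    have "S (T x) $ i = x $ i" for i
    proof -
      have "S (T x) $ i = (\<Sum>j\<in>UNIV. if j = i then x $ i else 0)"
        unfolding S_def T_def vec_lambda_beta inner_real_frame[symmetric] inner_sum_left
        using bij_betwE[OF b] bij_betw_imp_inj_on[OF b]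
        by (intro sum.cong) (auto simp: inner_Basis dest: injD)
      then show ?thesis by simp
    qed
    then show ?thesis by (simp add: vec_eq_iff)
  qed
  have T_frame: "T (axis i 1) = real_frame (e i)" for i
  proof -
    have "T (axis i 1) = (\<Sum>j\<in>UNIV. if j = i then real_frame (e i) else 0)"
      unfolding T_def by (intro sum.cong) (auto simp: axis_def)
    then show ?thesis by simp
  qed
  have contT: "continuous_on UNIV T" by (rule linear_continuous_on[OF bT])
  have distr: "distr lborel borel T = lborel" by (rule lborel_distr_isometry[OF b]) (simp add: T_def)
  have measT: "T \<in> lborel \<rightarrow>\<^sub>M borel" using contT by (simp add: borel_measurable_continuous_onI)
  have tr: "set_integrable lborel (T -` W) (\<lambda>x. h (T x))" "(LINT x:T -` W|lborel. h (T x)) = (LINT z:W|lborel. h z)"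
    if h: "set_integrable lborel W h" for W and h :: "complex^'n \<Rightarrow> real"
  proof -
    have eq: "(\<lambda>x. indicator (T -` W) x *\<^sub>R h (T x)) = (\<lambda>x. (\<lambda>z. indicator W z *\<^sub>R h z) (T x))"
      by (auto simp: fun_eq_iff indicator_def)
    have int: "integrable lborel (\<lambda>z. indicator W z *\<^sub>R h z)" using h by (simp add: set_integrable_def)
    then have int': "integrable (distr lborel borel T) (\<lambda>z. indicator W z *\<^sub>R h z)" by (simp add: distr)
    have meas: "(\<lambda>z. indicator W z *\<^sub>R h z) \<in> borel_measurable borel"
      using borel_measurable_integrable[OF int] by simp
    show "set_integrable lborel (T -` W) (\<lambda>x. h (T x))"
      unfolding set_integrable_def eq using int' by (subst (asm) integrable_distr_eq[OF measT meas])
    have "(LINT x:T -` W|lborel. h (T x)) = integral\<^sup>L (distr lborel borel T) (\<lambda>z. indicator W z *\<^sub>R h z)"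
      unfolding set_lebesgue_integral_def eq by (rule integral_distr[OF measT meas, symmetric])
    then show "(LINT x:T -` W|lborel. h (T x)) = (LINT z:W|lborel. h z)"
      by (simp add: distr set_lebesgue_integral_def)
  qed
  define g where "g x = S (\<phi> (T x))" for x
  define g' where "g' x h = S (\<phi>' (T x) (T h))" for x h
  have openU: "open (T -` U)" using contT U by (simp add: continuous_on_open_vimage)
  have gimg: "g ` (T -` U) = T -` (\<phi> ` U)"
  proof (intro equalityI subsetI)
    fix y assume "y \<in> T -` (\<phi> ` U)"
    then obtain z where z: "z \<in> U" "T y = \<phi> z" by auto
    then have "y = g (S z)" by (simp add: g_def TS) (metis ST)
    with z show "y \<in> g ` (T -` U)" by (intro image_eqI[of _ _ "S z"]) (auto simp: TS)
  qed (auto simp: g_def TS)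
  have der: "(g has_derivative g' x) (at x within T -` U)" if "x \<in> T -` U" for x
  proof -
    have "((\<lambda>x. \<phi> (T x)) has_derivative (\<lambda>h. \<phi>' (T x) (T h))) (at x)"
      using that by (intro has_derivative_compose[OF bounded_linear_imp_has_derivative[OF bT] \<phi>(1)]) auto
    from bounded_linear.has_derivative[OF bS this] show ?thesis
      unfolding g_def[abs_def] g'_def[abs_def] by (rule has_derivative_at_withinI)
  qed
  have inj: "inj_on g (T -` U)"
  proof (rule inj_onI)
    fix x y assume xy: "x \<in> T -` U" "y \<in> T -` U" "g x = g y"
    then have "\<phi> (T x) = \<phi> (T y)" unfolding g_def by (metis TS)
    then have "T x = T y" using \<phi>(2) xy by (auto dest: inj_onD)
    then show "x = y" by (metis ST)
  qed
  \<comment> \<open>\<open>matrix\<close> has the images of the basis vectors as columns,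
    \<open>frame_det\<close> has them as rows; hence the transpose.\<close>
  have det: "det (matrix (g' x)) = frame_det (\<phi>' (T x))" for x
  proof -
    have "matrix (g' x) = transpose (\<chi> i j. frame_coord (\<phi>' (T x) (real_frame (e i))) (e j))"
      by (simp add: vec_eq_iff matrix_def transpose_def g'_def T_frame S_def)
    then show ?thesis
      using det_reindex[OF e, of "\<lambda>i j. frame_coord (\<phi>' (T x) (real_frame i)) j"]
      by (simp add: det_transpose frame_det_def)
  qed
  \<comment> \<open>\<open>integral_change_of_variables\<close> is applied to functions with values
    in \<open>real ^ 1\<close>: the scalar is carried as a multiple of \<open>vec 1\<close> and
    recovered at the end by comparing components.\<close>
  let ?f0 = "\<lambda>y. f (T y) *\<^sub>R (vec 1 :: real^1)"
  have leb: "h absolutely_integrable_on W" if "set_integrable lborel W h" for h :: "real ^ 'n bit0 \<Rightarrow> real" and W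
    using that unfolding set_integrable_def by (rule integrable_completion[THEN iffD2, rotated])
      (use that in \<open>auto simp: set_integrable_def\<close>)
  have abs: "(\<lambda>y. f (T y)) absolutely_integrable_on (g ` (T -` U))"
    unfolding gimg by (intro leb tr f)
  then have abs0: "?f0 absolutely_integrable_on (g ` (T -` U))"
    by (rule set_integrable_scaleR_left)
  have cov: "integral (g ` (T -` U)) ?f0 = integral (T -` U) (\<lambda>x. \<bar>det (matrix (g' x))\<bar> *\<^sub>R ?f0 (g x))"
    using abs0 openU der inj by (intro integral_change_of_variables) (auto simp: borel_open)
  have "(\<lambda>x. \<bar>frame_det (\<phi>' (T x))\<bar> * f (\<phi> (T x))) integrable_on (T -` U)"
    by (rule set_borel_integral_eq_integral(1)[OF tr(1)[OF f']])
  then have "integral (T -` U) (\<lambda>x. \<bar>det (matrix (g' x))\<bar> *\<^sub>R ?f0 (g x))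
      = integral (T -` U) (\<lambda>x. \<bar>frame_det (\<phi>' (T x))\<bar> * f (\<phi> (T x))) *\<^sub>R vec 1"
    using integral_linear[OF _ bounded_linear_scaleR_left[of "vec 1 :: real^1"]]
    by (simp add: det g_def TS comp_def)
  moreover have "integral (g ` (T -` U)) ?f0 = integral (g ` (T -` U)) (\<lambda>y. f (T y)) *\<^sub>R (vec 1 :: real^1)"
    using integral_linear[OF set_lebesgue_integral_eq_integral(1)[OF abs] bounded_linear_scaleR_left[of "vec 1 :: real^1"]]
    by (simp add: comp_def)
  ultimately have "integral (g ` (T -` U)) (\<lambda>y. f (T y)) = integral (T -` U) (\<lambda>x. \<bar>frame_det (\<phi>' (T x))\<bar> * f (\<phi> (T x)))"
    using cov by (simp add: vec_eq_iff)
  then show ?thesis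
    using set_borel_integral_eq_integral(2)[OF tr(1)[OF f]] set_borel_integral_eq_integral(2)[OF tr(1)[OF f']]
    by (simp add: gimg tr(2)[OF f] tr(2)[OF f'])
qed

lemma change_of_variables_complex:
  fixes \<phi> :: "complex ^ 'n::finite \<Rightarrow> complex ^ 'n" and f :: "complex ^ 'n \<Rightarrow> complex"
  assumes U: "open U" and \<phi>: "\<And>z. z \<in> U \<Longrightarrow> (\<phi> has_derivative \<phi>' z) (at z)" "inj_on \<phi> U"
    and f: "set_integrable lborel (\<phi> ` U) f"
    and f': "set_integrable lborel U (\<lambda>z. \<bar>frame_det (\<phi>' z)\<bar> *\<^sub>R f (\<phi> z))"
  shows "(LINT z:U|lborel. \<bar>frame_det (\<phi>' z)\<bar> *\<^sub>R f (\<phi> z)) = (LINT z:\<phi> ` U|lborel. f z)"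
proof -
  have re: "set_integrable lborel W (\<lambda>z. Re (h z))" "set_integrable lborel W (\<lambda>z. Im (h z))"
    "Re (LINT z:W|lborel. h z) = (LINT z:W|lborel. Re (h z))" "Im (LINT z:W|lborel. h z) = (LINT z:W|lborel. Im (h z))"
    if "set_integrable lborel W h" for W and h :: "complex^'n \<Rightarrow> complex"
    using that integrable_Re[of lborel "\<lambda>z. indicator W z *\<^sub>R h z"] integrable_Im[of lborel "\<lambda>z. indicator W z *\<^sub>R h z"]
      integral_Re[of lborel "\<lambda>z. indicator W z *\<^sub>R h z"] integral_Im[of lborel "\<lambda>z. indicator W z *\<^sub>R h z"]
    by (auto simp: set_integrable_def set_lebesgue_integral_def)
  show ?thesis
    using change_of_variables_real[OF U \<phi>, of "\<lambda>z. Re (f z)"] change_of_variables_real[OF U \<phi>, of "\<lambda>z. Im (f z)"]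
      re[OF f] re[OF f']
    by (simp add: complex_eq_iff)
qed

subsection \<open>Stokes' theorem\<close>

lemma integral_Dop_zero:
  assumes g: "smooth_on UNIV g" and K: "compact K" "\<And>x. x \<notin> K \<Longrightarrow> g x = 0"
  shows "integrable lborel (\<lambda>z. Dop \<epsilon> g z w)" "(\<integral>z. Dop \<epsilon> g z w \<partial>lborel) = 0"
    "\<And>z. z \<notin> K \<Longrightarrow> Dop \<epsilon> g z w = 0"
proof -
  note z = integral_directional_derivative_zero[OF smooth_onD[OF g] K]
  show "integrable lborel (\<lambda>z. Dop \<epsilon> g z w)" "(\<integral>z. Dop \<epsilon> g z w \<partial>lborel) = 0"
    unfolding Dop_def using z(1,2) by simp_all
  show "Dop \<epsilon> g z w = 0" if "z \<notin> K" for z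
    unfolding Dop_def using that by (simp add: z(3))
qed

locale partitioned_manifold = complex_atlas X A
  for X :: "'a topology" and A :: "('a, 'n::finite) chart set" +
  fixes C :: "('a, 'n) chart set" and \<rho> :: "('a, 'n) chart \<Rightarrow> 'a \<Rightarrow> real"
  assumes compact_X: "compact_space X" and pou: "partition_of_unity X A C \<rho>"
begin

definition rho :: "('a, 'n) chart \<Rightarrow> ('a, 'n) chart \<Rightarrow> complex ^ 'n \<Rightarrow> complex" where
  "rho c d z = of_real (\<rho> c (chart_inv d z))"

definition supp :: "('a, 'n) chart \<Rightarrow> 'a set" where
  "supp c = X closure_of {x \<in> topspace X. \<rho> c x \<noteq> 0}"

lemma C_subset: "c \<in> C \<Longrightarrow> c \<in> A"
  and supp_subset: "c \<in> C \<Longrightarrow> supp c \<subseteq> fst c"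
  using pou by (auto simp: partition_of_unity_def supp_def)

lemma smooth_on_rho: "c \<in> C \<Longrightarrow> d \<in> A \<Longrightarrow> smooth_on (chart_range d) (rho c d)"
  using pou smooth_on_bounded_linear[OF open_chart_range bounded_linear_of_real]
  unfolding partition_of_unity_def rho_def[abs_def] comp_def by blast

lemma compact_supp: "compactin X (supp c)"
  unfolding supp_def by (rule closedin_compact_space[OF compact_X closedin_closure_of])

text \<open>The complement of \<open>supp c\<close> is open because a closure was taken, so the
  function vanishes near such a point and its derivatives vanish with it.\<close>

lemma rho_zero:
  assumes "d \<in> A" "z \<in> chart_range d" "chart_inv d z \<notin> supp c"
  shows "rho c d z = 0" "Dop \<epsilon> (rho c d) z w = 0"
proof -
  have zero: "rho c d y = 0" if "y \<in> chart_range d" "chart_inv d y \<notin> supp c" for y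
  proof -
    have "chart_inv d y \<in> topspace X" using chart_inv_in[OF that(1)] chart_subset_topspace[OF assms(1)] by blast
    then show ?thesis using that(2) closure_of_subset[of "{x \<in> topspace X. \<rho> c x \<noteq> 0}" X]
      by (auto simp: rho_def supp_def)
  qed
  show "rho c d z = 0" using assms by (intro zero)
  let ?U = "snd d ` (fst d \<inter> (topspace X - supp c))"
  have U: "open ?U"
    unfolding supp_def by (intro open_chart_image assms(1) openin_diff openin_topspace closedin_closure_of)
  have "z \<in> ?U" unfolding chart_image_iff[OF assms(1)]
    using assms chart_inv_in[OF assms(2)] chart_subset_topspace[OF assms(1)] by blast
  then have "Dop \<epsilon> (rho c d) z w = Dop \<epsilon> (\<lambda>_. 0) z w"
    by (rule Dop_cong[OF U]) (auto simp: chart_image_iff[OF assms(1)] intro!: zero)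
  then show "Dop \<epsilon> (rho c d) z w = 0" by (simp add: Dop_const)
qed

lemma sum_rho: "d \<in> A \<Longrightarrow> z \<in> chart_range d \<Longrightarrow> (\<Sum>c\<in>C. rho c d z) = 1"
proof -
  assume d: "d \<in> A" and z: "z \<in> chart_range d"
  have "chart_inv d z \<in> topspace X" using chart_inv_in[OF z] chart_subset_topspace[OF d] by blast
  then have "(\<Sum>c\<in>C. \<rho> c (chart_inv d z)) = 1" using pou by (simp add: partition_of_unity_def)
  then have "complex_of_real (\<Sum>c\<in>C. \<rho> c (chart_inv d z)) = 1" by simp
  then show "(\<Sum>c\<in>C. rho c d z) = 1" by (simp add: rho_def)
qed

text \<open>The wedge product of \<open>\<partial>\<rho>\<^sub>c\<close> (or its conjugate) with \<open>\<eta>\<close>, in the chart \<open>d\<close>.\<close>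

definition drho_wedge ::
    "complex \<Rightarrow> nat \<Rightarrow> ('a, 'n) form \<Rightarrow> ('a, 'n) chart \<Rightarrow> ('a, 'n) chart \<Rightarrow> complex ^ 'n \<Rightarrow> 'n covector" where
  "drho_wedge \<epsilon> k \<eta> c d z v = (\<Sum>i\<le>k. (- 1) ^ i * (Dop \<epsilon> (rho c d) z (v i) * \<eta> d z (omit i v)))"

lemma smooth_on_drho_wedge:
  assumes "gform k \<eta>" "c \<in> C" "d \<in> A"
  shows "smooth_on (chart_range d) (\<lambda>z. drho_wedge \<epsilon> k \<eta> c d z v)"
  unfolding drho_wedge_def
  by (intro smooth_on_sum smooth_on_mult smooth_on_const smooth_on_Dop open_chart_range assms
      smooth_on_rho locform_smooth[OF gform_locform[OF assms(1)]])

lemma drho_wedge_zero: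
  "d \<in> A \<Longrightarrow> z \<in> chart_range d \<Longrightarrow> chart_inv d z \<notin> supp c \<Longrightarrow> drho_wedge \<epsilon> k \<eta> c d z v = 0"
  by (simp add: drho_wedge_def rho_zero(2))

lemma altform_drho_wedge:
  assumes "gform k \<eta>" "c \<in> C" "d \<in> A" "z \<in> chart_range d"
  shows "altform (Suc k) (drho_wedge \<epsilon> k \<eta> c d z)"
  unfolding drho_wedge_def[abs_def]
  by (rule altform_insertion[of k "\<lambda>w u. Dop \<epsilon> (rho c d) z w * \<eta> d z u"])
    (intro altform_cmult locform_altform[OF gform_locform[OF assms(1)]] linear_cmult_right linear_Dop
      smooth_on_differentiable[OF smooth_on_rho] assms)+

text \<open>\<open>rho b c\<close> and \<open>rho b d\<close> are one function on \<open>X\<close>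
  seen in two charts, so \<open>Dop_compose\<close> applies to them, and \<open>\<eta>\<close>
  transforms as a form.\<close>

lemma drho_wedge_transition:
  assumes \<eta>: "gform k \<eta>" and b: "b \<in> C" and cd: "c \<in> A" "d \<in> A" and z: "z \<in> overlap c d"
  shows "drho_wedge \<epsilon> k \<eta> b c z v =
    drho_wedge \<epsilon> k \<eta> b d (transition c d z) (\<lambda>i. frechet_derivative (transition c d) (at z) (v i))"
proof -
  let ?\<phi> = "transition c d"
  note hol = holomorphic_map_onD[OF transition_holomorphic[OF cd]]
  have "Dop \<epsilon> (rho b c) z w = Dop \<epsilon> (rho b d) (?\<phi> z) (frechet_derivative ?\<phi> (at z) w)" for w
  proof -
    have "Dop \<epsilon> (rho b c) z w = Dop \<epsilon> (\<lambda>y. rho b d (?\<phi> y)) z w"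
      by (rule Dop_cong[OF open_overlap[OF cd] z]) (simp add: rho_def transition(3)[OF cd])
    also have "\<dots> = Dop \<epsilon> (rho b d) (?\<phi> z) (frechet_derivative ?\<phi> (at z) w)"
      by (intro Dop_compose smooth_on_differentiable[OF hol(1) z] hol(2)[OF z]
          smooth_on_differentiable[OF smooth_on_rho[OF b cd(2)]] transition(2)[OF cd z])
    finally show ?thesis .
  qed
  moreover have "\<eta> c z (omit i v) = \<eta> d (?\<phi> z) (omit i (\<lambda>i. frechet_derivative ?\<phi> (at z) (v i)))" for i
  proof -
    have "(\<lambda>j. frechet_derivative ?\<phi> (at z) (omit i v j)) = omit i (\<lambda>i. frechet_derivative ?\<phi> (at z) (v i))"
      by (auto simp: omit_def)
    then show ?thesis using gform_pullback[OF \<eta> cd z] by (simp add: pullback_def)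
  qed
  ultimately show ?thesis by (simp add: drho_wedge_def)
qed

lemma compact_chart_supp:
  assumes "c \<in> A" "K \<subseteq> fst c" "compactin X K"
  shows "compact (snd c ` K)" "snd c ` K \<subseteq> chart_range c"
    "\<And>z. z \<in> chart_range c \<Longrightarrow> z \<in> snd c ` K \<longleftrightarrow> chart_inv c z \<in> K"
proof -
  show "compact (snd c ` K)" "snd c ` K \<subseteq> chart_range c"
    using compact_chart_image[OF assms(1,3,2)] by auto
  have "fst c \<inter> K = K" using assms(2) by blast
  then show "z \<in> snd c ` K \<longleftrightarrow> chart_inv c z \<in> K" if "z \<in> chart_range c" for z
    using chart_image_iff[OF assms(1), of z K] that by simp
qed

text \<open>Integration by parts: the product rule splits the derivative of the product of
  \<open>rho c c\<close> and \<open>\<eta>\<close>, and the integral of the whole is zero since the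
  product has compact support in the chart.\<close>

lemma chart_stokes:
  assumes \<eta>: "gform k \<eta>" and c: "c \<in> C"
  shows "set_integrable lborel (chart_range c) (\<lambda>z. rho c c z * dloc \<epsilon> k (\<eta> c) z v)"
    "(LINT z:chart_range c|lborel. rho c c z * dloc \<epsilon> k (\<eta> c) z v)
      = - (LINT z:chart_range c|lborel. drho_wedge \<epsilon> k \<eta> c c z v)"
proof -
  have cA: "c \<in> A" by (rule C_subset[OF c])
  note U = open_chart_range[OF cA]
  let ?U = "chart_range c" and ?K = "snd c ` supp c"
  note K = compact_chart_supp[OF cA supp_subset[OF c] compact_supp]
  note l\<eta> = gform_locform[OF \<eta> cA]
  \<comment> \<open>The coefficients of the product, extended by zero. They vanish off the compact
    set \<open>?K\<close> inside the chart range, which makes them smooth on the whole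
    space.\<close>
  define G where "G i y = (if y \<in> ?U then rho c c y * \<eta> c y (omit i v) else 0)" for i y
  have G0: "G i y = 0" if "y \<notin> ?K" for i y
  proof (cases "y \<in> ?U")
    case True
    then show ?thesis using that K(3)[OF True] rho_zero(1)[OF cA True] by (simp add: G_def)
  qed (simp add: G_def)
  have Gsmooth: "smooth_on UNIV (G i)" for i
  proof (rule smooth_on_locally)
    fix x
    have 1: "smooth_on ?U (G i)"
      using smooth_on_cong[OF U, of "G i" "\<lambda>y. rho c c y * \<eta> c y (omit i v)"]
        smooth_on_mult[OF U smooth_on_rho[OF c cA] locform_smooth[OF l\<eta>]] by (simp add: G_def)
    have "open (- ?K)" using K(1) compact_imp_closed by blast
    then have 2: "open (- ?K) \<and> smooth_on (- ?K) (G i)"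
      using smooth_on_cong[of "- ?K" "G i" "\<lambda>_. 0"] G0 smooth_on_const by auto
    show "\<exists>U. open U \<and> x \<in> U \<and> smooth_on U (G i)"
      using 1 2 U K(2) by (cases "x \<in> ?U") (blast, meson ComplI subsetD)
  qed
  have Dop_G: "Dop \<epsilon> (G i) z w = Dop \<epsilon> (rho c c) z w * \<eta> c z (omit i v) + rho c c z * Dop \<epsilon> (\<lambda>y. \<eta> c y (omit i v)) z w"
    if z: "z \<in> ?U" for i z w
  proof -
    have "Dop \<epsilon> (G i) z w = Dop \<epsilon> (\<lambda>y. rho c c y * \<eta> c y (omit i v)) z w"
      by (rule Dop_cong[OF U z]) (simp add: G_def)
    then show ?thesis
      using Dop_mult[OF smooth_on_differentiable[OF smooth_on_rho[OF c cA] z] locform_differentiable[OF l\<eta> z]] by simp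
  qed
  let ?F = "\<lambda>z. \<Sum>i\<le>k. (- 1) ^ i * Dop \<epsilon> (G i) z (v i)"
  have F: "rho c c z * dloc \<epsilon> k (\<eta> c) z v + drho_wedge \<epsilon> k \<eta> c c z v = ?F z" if "z \<in> ?U" for z
    by (simp add: Dop_G[OF that] dloc_def drho_wedge_def sum_distrib_left sum.distrib[symmetric] algebra_simps)
  have Dop_G0: "Dop \<epsilon> (G i) z w = 0" if "z \<notin> ?U" for i z w
    using integral_Dop_zero(3)[OF Gsmooth K(1) G0] that K(2) by blast
  have "(LINT z:?U|lborel. ?F z) = (\<integral>z. ?F z \<partial>lborel)"
    unfolding set_lebesgue_integral_def
    by (rule Bochner_Integration.integral_cong) (auto simp: indicator_def Dop_G0)
  also have "\<dots> = 0"
    using integral_Dop_zero[OF Gsmooth K(1) G0] by simp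
  finally have int0: "(LINT z:?U|lborel. ?F z) = 0" .
  have out: "chart_inv c z \<notin> supp c" if "z \<in> ?U - ?K" for z
    using that K(3) by auto
  show i1: "set_integrable lborel ?U (\<lambda>z. rho c c z * dloc \<epsilon> k (\<eta> c) z v)"
    by (rule set_integral_compact_support(1)[OF K(1,2)])
      (auto intro!: smooth_on_imp_continuous_on smooth_on_mult smooth_on_rho c cA U
        locform_smooth[OF locform_dloc[OF U l\<eta>]] simp: rho_zero(1)[OF cA _ out])
  have i2: "set_integrable lborel ?U (\<lambda>z. drho_wedge \<epsilon> k \<eta> c c z v)"
    by (rule set_integral_compact_support(1)[OF K(1,2)])
      (auto intro!: smooth_on_imp_continuous_on smooth_on_drho_wedge \<eta> c cA simp: drho_wedge_zero[OF cA _ out])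
  have "(LINT z:?U|lborel. rho c c z * dloc \<epsilon> k (\<eta> c) z v + drho_wedge \<epsilon> k \<eta> c c z v) = 0"
    unfolding int0[symmetric] by (rule set_lebesgue_integral_cong) (use U F in auto)
  then show "(LINT z:?U|lborel. rho c c z * dloc \<epsilon> k (\<eta> c) z v) = - (LINT z:?U|lborel. drho_wedge \<epsilon> k \<eta> c c z v)"
    using set_integral_add(2)[OF i1 i2] by (simp add: eq_neg_iff_add_eq_0)
qed

text \<open>The integrand lives on the compact image of the intersection of two supports, which the
  condition on \<open>fst d\<close> places inside the chart. Every admissible \<open>V\<close> thus
  gives the same integral; the chart range and the overlap are the two in use.\<close>

lemma drho_wedge_support:
  assumes \<eta>: "gform k \<eta>" and bb': "b \<in> C" "b' \<in> C" and d: "d \<in> A" "fst d = fst b \<or> fst d = fst b'"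
    and V: "open V" "snd d ` (supp b \<inter> supp b') \<subseteq> V" "V \<subseteq> chart_range d"
  shows "set_integrable lborel V (\<lambda>z. rho b' d z * drho_wedge \<epsilon> k \<eta> b d z v)"
    "(LINT z:V|lborel. rho b' d z * drho_wedge \<epsilon> k \<eta> b d z v) =
      (LINT z:snd d ` (supp b \<inter> supp b')|lborel. rho b' d z * drho_wedge \<epsilon> k \<eta> b d z v)"
proof -
  have "compactin X (supp b \<inter> supp b')"
    unfolding supp_def by (intro closedin_compact_space compact_X closedin_Int closedin_closure_of)
  moreover have "supp b \<inter> supp b' \<subseteq> fst d" using supp_subset bb' d(2) by blast
  ultimately have K: "compact (snd d ` (supp b \<inter> supp b'))"
    "\<And>z. z \<in> chart_range d \<Longrightarrow> z \<in> snd d ` (supp b \<inter> supp b') \<longleftrightarrow> chart_inv d z \<in> supp b \<inter> supp b'"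
    using compact_chart_supp[OF d(1)] by blast+
  have cont: "continuous_on V (\<lambda>z. rho b' d z * drho_wedge \<epsilon> k \<eta> b d z v)"
    by (rule continuous_on_subset[OF _ V(3)])
      (intro smooth_on_imp_continuous_on smooth_on_mult smooth_on_rho smooth_on_drho_wedge \<eta> bb' d(1) open_chart_range)
  have zero: "rho b' d z * drho_wedge \<epsilon> k \<eta> b d z v = 0" if "z \<in> V - snd d ` (supp b \<inter> supp b')" for z
  proof -
    have z: "z \<in> chart_range d" using that V(3) by blast
    then have "chart_inv d z \<notin> supp b \<or> chart_inv d z \<notin> supp b'" using that K(2)[OF z] by blast
    then show ?thesis using rho_zero(1)[OF d(1) z, of b'] drho_wedge_zero[OF d(1) z, of b \<epsilon> k \<eta> v] by auto
  qed
  show "set_integrable lborel V (\<lambda>z. rho b' d z * drho_wedge \<epsilon> k \<eta> b d z v)"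
    "(LINT z:V|lborel. rho b' d z * drho_wedge \<epsilon> k \<eta> b d z v) =
      (LINT z:snd d ` (supp b \<inter> supp b')|lborel. rho b' d z * drho_wedge \<epsilon> k \<eta> b d z v)"
    using set_integral_compact_support[OF K(1) V(2) cont zero] by auto
qed

text \<open>The factor \<open>rho d\<close> confines the integrand to the overlap. There it is a
  top-degree form and transforms with \<open>frame_det\<close>, while change of variables asks for
  its absolute value; the two agree because transition maps are holomorphic.\<close>

lemma drho_wedge_change_chart:
  assumes \<eta>: "gform k \<eta>" "Suc k = 2 * CARD('n)" and c: "c \<in> C" and d: "d \<in> C"
  shows "(LINT z:chart_range c|lborel. rho d c z * drho_wedge \<epsilon> k \<eta> c c z real_frame) =
    (LINT z:chart_range d|lborel. rho d d z * drho_wedge \<epsilon> k \<eta> c d z real_frame)"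
proof -
  let ?K = "supp c \<inter> supp d" and ?\<phi> = "transition c d"
  let ?f = "\<lambda>z. rho d d z * drho_wedge \<epsilon> k \<eta> c d z real_frame"
  let ?g = "\<lambda>z. rho d c z * drho_wedge \<epsilon> k \<eta> c c z real_frame"
  have A: "c \<in> A" "d \<in> A" using c d C_subset by auto
  note hol = holomorphic_map_onD[OF transition_holomorphic[OF A]]
  have sub: "snd c ` ?K \<subseteq> overlap c d" "snd d ` ?K \<subseteq> overlap d c" "overlap c d \<subseteq> chart_range c" "overlap d c \<subseteq> chart_range d"
  proof -
    have "?K \<subseteq> fst c \<inter> fst d" "?K \<subseteq> fst d \<inter> fst c" using supp_subset[OF c] supp_subset[OF d] by blast+
    then show "snd c ` ?K \<subseteq> overlap c d" "snd d ` ?K \<subseteq> overlap d c" unfolding overlap_def by (auto intro!: imageI)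
  qed (rule overlap_subset)+
  have eq: "\<bar>frame_det (frechet_derivative ?\<phi> (at z))\<bar> *\<^sub>R ?f (?\<phi> z) = ?g z" if z: "z \<in> overlap c d" for z
  proof -
    have "0 \<le> frame_det (frechet_derivative ?\<phi> (at z))"
      by (rule frame_det_nonneg[OF hol(3)[OF z] hol(2)[OF z]])
    moreover have "drho_wedge \<epsilon> k \<eta> c c z real_frame =
        of_real (frame_det (frechet_derivative ?\<phi> (at z))) * drho_wedge \<epsilon> k \<eta> c d (?\<phi> z) real_frame"
      unfolding drho_wedge_transition[OF \<eta>(1) c A z]
      by (rule altform_top) (use altform_drho_wedge[OF \<eta>(1) c A(2) transition(2)[OF A z]] \<eta>(2) in simp)
    moreover have "rho d c z = rho d d (?\<phi> z)" by (simp add: rho_def transition(3)[OF A z])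
    ultimately show ?thesis by (simp add: scaleR_conv_of_real)
  qed
  have int_g: "set_integrable lborel (overlap c d) ?g"
    by (rule drho_wedge_support(1)[OF \<eta>(1) c d A(1) _ open_overlap[OF A] sub(1,3)]) simp
  have int_g': "set_integrable lborel (overlap c d) (\<lambda>z. \<bar>frame_det (frechet_derivative ?\<phi> (at z))\<bar> *\<^sub>R ?f (?\<phi> z))"
    using int_g eq unfolding set_integrable_def
    by (subst Bochner_Integration.integrable_cong[OF refl]) (auto simp: indicator_def)
  have int_f: "set_integrable lborel (?\<phi> ` overlap c d) ?f"
    unfolding transition_image[OF A]
    by (rule drho_wedge_support(1)[OF \<eta>(1) c d A(2) _ open_overlap[OF A(2,1)] sub(2,4)]) simp
  have "(LINT z:chart_range c|lborel. ?g z) = (LINT z:snd c ` ?K|lborel. ?g z)"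
    by (rule drho_wedge_support(2)[OF \<eta>(1) c d A(1) _ open_chart_range[OF A(1)]]) (use sub in auto)
  also have "\<dots> = (LINT z:overlap c d|lborel. ?g z)"
    by (rule drho_wedge_support(2)[OF \<eta>(1) c d A(1) _ open_overlap[OF A] sub(1,3), symmetric]) simp
  also have "\<dots> = (LINT z:overlap c d|lborel. \<bar>frame_det (frechet_derivative ?\<phi> (at z))\<bar> *\<^sub>R ?f (?\<phi> z))"
    by (rule set_lebesgue_integral_cong) (use open_overlap[OF A] eq in auto)
  also have "\<dots> = (LINT z:?\<phi> ` overlap c d|lborel. ?f z)"
    by (rule change_of_variables_complex[OF open_overlap[OF A] smooth_on_has_derivative[OF hol(1)]
          transition_inj_on[OF A] int_f int_g'])
  also have "\<dots> = (LINT z:snd d ` ?K|lborel. ?f z)"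
    unfolding transition_image[OF A]
    by (rule drho_wedge_support(2)[OF \<eta>(1) c d A(2) _ open_overlap[OF A(2,1)] sub(2,4)]) simp
  also have "\<dots> = (LINT z:chart_range d|lborel. ?f z)"
    by (rule drho_wedge_support(2)[OF \<eta>(1) c d A(2) _ open_chart_range[OF A(2)], symmetric]) (use sub in auto)
  finally show ?thesis .
qed

lemma sum_drho_wedge:
  assumes "d \<in> A" "z \<in> chart_range d"
  shows "(\<Sum>c\<in>C. drho_wedge \<epsilon> k \<eta> c d z v) = 0"
proof -
  have "(\<Sum>c\<in>C. Dop \<epsilon> (rho c d) z w) = 0" for w
  proof -
    have "(\<Sum>c\<in>C. Dop \<epsilon> (rho c d) z w) = Dop \<epsilon> (\<lambda>y. \<Sum>c\<in>C. rho c d y) z w"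
      using assms by (intro Dop_sum[symmetric] smooth_on_differentiable[OF smooth_on_rho])
    also have "\<dots> = Dop \<epsilon> (\<lambda>_. 1) z w"
      by (rule Dop_cong[OF open_chart_range[OF assms(1)] assms(2)]) (rule sum_rho[OF assms(1)])
    finally show ?thesis by (simp add: Dop_const)
  qed
  then have "(\<Sum>i\<le>k. (- 1) ^ i * ((\<Sum>c\<in>C. Dop \<epsilon> (rho c d) z (v i)) * \<eta> d z (omit i v))) = 0" by simp
  then show ?thesis
    unfolding drho_wedge_def sum_distrib_left sum_distrib_right by (subst sum.swap)
qed

text \<open>After \<open>chart_stokes\<close> each term belongs to its own chart \<open>c\<close>.
  Inserting the sum of all \<open>rho d\<close> and moving each piece to the chart \<open>d\<close>
  makes it possible to sum over \<open>c\<close> first, in a fixed chart, where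
  \<open>sum_drho_wedge\<close> applies.\<close>

theorem stokes:
  assumes \<eta>: "gform k \<eta>" "Suc k = 2 * CARD('n)"
  shows "(\<Sum>c\<in>C. LINT z:chart_range c|lborel. rho c c z * dloc \<epsilon> k (\<eta> c) z real_frame) = 0"
proof -
  let ?\<Psi> = "\<lambda>c d z. drho_wedge \<epsilon> k \<eta> c d z real_frame"
  have int: "set_integrable lborel (chart_range d) (\<lambda>z. rho b' d z * ?\<Psi> b d z)"
    if "b \<in> C" "b' \<in> C" "d = b \<or> d = b'" for b b' d
  proof -
    have d: "d \<in> A" using that C_subset by blast
    have "snd d ` (supp b \<inter> supp b') \<subseteq> chart_range d"
      using supp_subset[OF that(1)] supp_subset[OF that(2)] that(3) unfolding chart_range_def by blast
    then show ?thesis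
      using that by (intro drho_wedge_support(1)[OF \<eta>(1) that(1,2) d _ open_chart_range[OF d]]) auto
  qed
  have "(\<Sum>c\<in>C. LINT z:chart_range c|lborel. ?\<Psi> c c z) = (\<Sum>c\<in>C. \<Sum>d\<in>C. LINT z:chart_range c|lborel. rho d c z * ?\<Psi> c c z)"
  proof (rule sum.cong[OF refl])
    fix c assume c: "c \<in> C"
    have "(LINT z:chart_range c|lborel. ?\<Psi> c c z) = (LINT z:chart_range c|lborel. \<Sum>d\<in>C. rho d c z * ?\<Psi> c c z)"
      using open_chart_range[OF C_subset[OF c]] sum_rho[OF C_subset[OF c]]
      by (intro set_lebesgue_integral_cong) (auto simp: sum_distrib_right[symmetric])
    also have "\<dots> = (\<Sum>d\<in>C. LINT z:chart_range c|lborel. rho d c z * ?\<Psi> c c z)"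
      unfolding set_lebesgue_integral_def scaleR_sum_right
      by (rule Bochner_Integration.integral_sum) (use int c in \<open>auto simp: set_integrable_def\<close>)
    finally show "(LINT z:chart_range c|lborel. ?\<Psi> c c z) = (\<Sum>d\<in>C. LINT z:chart_range c|lborel. rho d c z * ?\<Psi> c c z)" .
  qed
  also have "\<dots> = (\<Sum>c\<in>C. \<Sum>d\<in>C. LINT z:chart_range d|lborel. rho d d z * ?\<Psi> c d z)"
    by (intro sum.cong refl drho_wedge_change_chart \<eta>)
  also have "\<dots> = (\<Sum>d\<in>C. \<Sum>c\<in>C. LINT z:chart_range d|lborel. rho d d z * ?\<Psi> c d z)"
    by (rule sum.swap)
  also have "\<dots> = 0"
  proof (rule sum.neutral, rule ballI)
    fix d assume d: "d \<in> C"
    have "(\<Sum>c\<in>C. LINT z:chart_range d|lborel. rho d d z * ?\<Psi> c d z) = (LINT z:chart_range d|lborel. \<Sum>c\<in>C. rho d d z * ?\<Psi> c d z)"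
      unfolding set_lebesgue_integral_def scaleR_sum_right
      by (rule Bochner_Integration.integral_sum[symmetric]) (use int d in \<open>auto simp: set_integrable_def\<close>)
    also have "\<dots> = (LINT z:chart_range d|lborel. 0)"
      using open_chart_range[OF C_subset[OF d]] sum_drho_wedge[OF C_subset[OF d]]
      by (intro set_lebesgue_integral_cong) (auto simp: sum_distrib_left[symmetric])
    finally show "(\<Sum>c\<in>C. LINT z:chart_range d|lborel. rho d d z * ?\<Psi> c d z) = 0" by simp
  qed
  finally have "(\<Sum>c\<in>C. LINT z:chart_range c|lborel. ?\<Psi> c c z) = 0" .
  then show ?thesis
    by (simp add: chart_stokes(2)[OF \<eta>(1)] sum_negf)
qed

end

section \<open>The Bott--Chern pairing with exact forms\<close>

text \<open>In the Leibniz rule the term with the derivative of \<open>\<beta>'\<close> drops out,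
  and with it the only sign.\<close>

lemma (in complex_atlas) exact_wedge:
  assumes \<beta>: "gform j \<beta>" and \<beta>': "gform l \<beta>'" "dd \<epsilon> l \<beta>' = 0" and c: "c \<in> A" "z \<in> chart_range c"
  shows "wedge (Suc j) l (dd \<epsilon> j \<beta>) \<beta>' c z v = dloc \<epsilon> (j + l) (wedge j l \<beta> \<beta>' c) z v"
proof -
  have "dloc \<epsilon> l (\<beta>' c) z = 0" using dd_inside[OF c, of \<epsilon> l \<beta>'] \<beta>'(2) by simp
  then have "wedge_covectors j (Suc l) (\<beta> c z) (dloc \<epsilon> l (\<beta>' c) z) v = 0"
    by (simp add: wedge_covectors_def)
  with dloc_wedge[OF open_chart_range[OF c(1)] c(2) gform_locform[OF \<beta> c(1)] gform_locform[OF \<beta>'(1) c(1)], of \<epsilon> v]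
  show ?thesis by (simp add: wedge_def[abs_def] dd_inside[OF c])
qed

lemma wedge_add_left: "wedge k l (\<alpha> + \<beta>) \<gamma> c z v = wedge k l \<alpha> \<gamma> c z v + wedge k l \<beta> \<gamma> c z v"
  by (simp add: wedge_def wedge_covectors_def distrib_left distrib_right sum.distrib add_divide_distrib)

locale compact_manifold = complex_atlas X A
  for X :: "'a topology" and A :: "('a, 'n::finite) chart set" +
  assumes Hausdorff_X: "Hausdorff_space X" and compact_X: "compact_space X"
begin

lemma form_integral_exact:
  assumes \<eta>: "gform k \<eta>1" "gform k \<eta>2" "Suc k = 2 * CARD('n)"
    and \<omega>: "\<And>c z. c \<in> A \<Longrightarrow> z \<in> chart_range c \<Longrightarrow>
      \<omega> c z real_frame = dloc 1 k (\<eta>1 c) z real_frame + dloc (- 1) k (\<eta>2 c) z real_frame"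
  shows "form_integral X A \<omega> = 0"
proof -
  \<comment> \<open>\<open>form_integral\<close> picks a partition of unity by \<open>SOME\<close>.
    Existence makes the choice a genuine partition, and Stokes' theorem holds for whichever was
    picked.\<close>
  obtain C \<rho> where C\<rho>: "(SOME (C, \<rho>). partition_of_unity X A C \<rho>) = (C, \<rho>)" by fastforce
  have "\<exists>p. case p of (C, \<rho>) \<Rightarrow> partition_of_unity X A C \<rho>"
    using exists_partition_of_unity[OF Hausdorff_X compact_X] by auto
  from someI_ex[OF this] have pou: "partition_of_unity X A C \<rho>" by (simp add: C\<rho>)
  interpret partitioned_manifold X A C \<rho> by unfold_locales (use compact_X pou in auto)
  have "form_integral X A \<omega> = (\<Sum>c\<in>C. LINT z:chart_range c|lborel. \<rho> c (chart_inv c z) *\<^sub>R \<omega> c z real_frame)"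
    by (simp add: form_integral_def C\<rho>)
  also have "\<dots> = (\<Sum>c\<in>C. (LINT z:chart_range c|lborel. rho c c z * dloc 1 k (\<eta>1 c) z real_frame) +
      (LINT z:chart_range c|lborel. rho c c z * dloc (- 1) k (\<eta>2 c) z real_frame))"
  proof (rule sum.cong[OF refl])
    fix c assume c: "c \<in> C"
    have "(LINT z:chart_range c|lborel. \<rho> c (chart_inv c z) *\<^sub>R \<omega> c z real_frame) =
       (LINT z:chart_range c|lborel. rho c c z * dloc 1 k (\<eta>1 c) z real_frame + rho c c z * dloc (- 1) k (\<eta>2 c) z real_frame)"
      using open_chart_range[OF C_subset[OF c]] \<omega>[OF C_subset[OF c]]
      by (intro set_lebesgue_integral_cong) (auto simp: rho_def scaleR_conv_of_real distrib_left)
    also have "\<dots> = (LINT z:chart_range c|lborel. rho c c z * dloc 1 k (\<eta>1 c) z real_frame) +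
      (LINT z:chart_range c|lborel. rho c c z * dloc (- 1) k (\<eta>2 c) z real_frame)"
      by (rule set_integral_add(2)[OF chart_stokes(1)[OF \<eta>(1) c] chart_stokes(1)[OF \<eta>(2) c]])
    finally show "(LINT z:chart_range c|lborel. \<rho> c (chart_inv c z) *\<^sub>R \<omega> c z real_frame) = \<dots>" .
  qed
  also have "\<dots> = 0"
    by (simp only: sum.distrib stokes[OF \<eta>(1,3)] stokes[OF \<eta>(2,3)] add_0)
  finally show ?thesis .
qed

end

section \<open>Bott-Chern and Aeppli classes and their representatives\<close>

context complex_atlas
begin

definition bc_cocycles :: "nat \<Rightarrow> nat \<Rightarrow> ('a, 'n) form set" where
  "bc_cocycles p q = {\<alpha> \<in> forms A p q. del A (p + q) \<alpha> = 0 \<and> delbar A (p + q) \<alpha> = 0}"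

lemma bott_chern_eq: "bott_chern A p q = bc_class A p q ` bc_cocycles p q"
  by (simp add: bott_chern_def bc_cocycles_def)

lemma bc_cocycles_diff:
  assumes "\<alpha> \<in> bc_cocycles p q" "\<beta> \<in> bc_cocycles p q"
  shows "\<alpha> - \<beta> \<in> bc_cocycles p q"
proof -
  have g: "gform (p + q) \<alpha>" "gform (p + q) (- \<beta>)" "gform (p + q) \<beta>"
    using assms forms_gform forms_uminus by (auto simp: bc_cocycles_def)
  have "dd \<epsilon> (p + q) (\<alpha> - \<beta>) = dd \<epsilon> (p + q) \<alpha> - dd \<epsilon> (p + q) \<beta>" for \<epsilon>
    using dd_add[OF g(1,2)] dd_uminus[OF g(3)] by simp
  with assms show ?thesis by (auto simp: bc_cocycles_def del_eq delbar_eq intro: forms_diff)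
qed

lemma im_del_cases:
  assumes "\<beta> \<in> im_del A p q"
  obtains "\<beta> = 0" "p = 0" | p' \<eta> where "p = Suc p'" "\<eta> \<in> forms A p' q" "\<beta> = dd 1 (p' + q) \<eta>"
  using assms by (cases p) (auto simp: im_del_def del_eq)

lemma im_delbar_cases:
  assumes "\<beta> \<in> im_delbar A p q"
  obtains "\<beta> = 0" "q = 0" | q' \<eta> where "q = Suc q'" "\<eta> \<in> forms A p q'" "\<beta> = dd (- 1) (p + q') \<eta>"
  using assms by (cases q) (auto simp: im_delbar_def delbar_eq)

lemma im_del_delbar_cases:
  assumes "\<beta> \<in> im_del_delbar A p q"
  obtains "\<beta> = 0" "p = 0 \<or> q = 0"
  | p' q' \<eta> where "p = Suc p'" "q = Suc q'" "\<eta> \<in> forms A p' q'" "\<beta> = dd 1 (p' + q) (dd (- 1) (p' + q') \<eta>)"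
  using assms by (cases p; cases q) (auto simp: im_del_delbar_def del_eq delbar_eq)

lemma dd_zero: "dd \<epsilon> k 0 = 0"
proof (intro ext)
  fix c z v show "dd \<epsilon> k 0 c z v = 0 c z v" by (simp add: dd_def dloc_def Dop_const)
qed

lemma im_del_zero: "0 \<in> im_del A p q" and im_delbar_zero: "0 \<in> im_delbar A p q"
  and im_del_delbar_zero: "0 \<in> im_del_delbar A p q"
  using forms_zero dd_zero
  by (auto simp: im_del_def im_delbar_def im_del_delbar_def del_eq delbar_eq image_iff intro!: bexI[of _ 0])

lemma im_del_add:
  assumes "\<beta> \<in> im_del A p q" "\<gamma> \<in> im_del A p q"
  shows "\<beta> + \<gamma> \<in> im_del A p q"
proof (cases p)
  case (Suc p')
  with assms obtain b g where "b \<in> forms A p' q" "g \<in> forms A p' q" "\<beta> = dd 1 (p' + q) b" "\<gamma> = dd 1 (p' + q) g"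
    by (auto simp: im_del_def del_eq)
  then show ?thesis using Suc forms_add[of b p' q g] dd_add[OF forms_gform forms_gform, of b p' q g 1]
    by (auto simp: im_del_def del_eq image_iff intro!: bexI[of _ "b + g"])
qed (use assms in \<open>simp add: im_del_def\<close>)

lemma im_del_uminus:
  assumes "\<beta> \<in> im_del A p q"
  shows "- \<beta> \<in> im_del A p q"
proof (cases p)
  case (Suc p')
  with assms obtain b where "b \<in> forms A p' q" "\<beta> = dd 1 (p' + q) b"
    by (auto simp: im_del_def del_eq)
  then show ?thesis using Suc forms_uminus[of b p' q] dd_uminus[OF forms_gform, of b p' q 1]
    by (auto simp: im_del_def del_eq image_iff intro!: bexI[of _ "- b"])
qed (use assms in \<open>simp add: im_del_def\<close>)

lemma im_del_delbar_add:
  assumes "\<beta> \<in> im_del_delbar A p q" "\<gamma> \<in> im_del_delbar A p q"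
  shows "\<beta> + \<gamma> \<in> im_del_delbar A p q"
proof (cases "p = 0 \<or> q = 0")
  case False
  then obtain p' q' where pq: "p = Suc p'" "q = Suc q'" by (auto simp: gr0_conv_Suc)
  with assms obtain b g where bg: "b \<in> forms A p' q'" "g \<in> forms A p' q'"
    "\<beta> = dd 1 (p' + q) (dd (- 1) (p' + q') b)" "\<gamma> = dd 1 (p' + q) (dd (- 1) (p' + q') g)"
    by (auto simp: im_del_delbar_def del_eq delbar_eq)
  have "\<beta> + \<gamma> = dd 1 (p' + q) (dd (- 1) (p' + q') (b + g))"
    unfolding bg(3,4) dd_add[OF forms_gform[OF bg(1)] forms_gform[OF bg(2)]]
    using dd_add[OF forms_gform[OF dd_forms(2)[OF bg(1)]] forms_gform[OF dd_forms(2)[OF bg(2)]], of 1] pq by simp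
  then show ?thesis using pq forms_add[OF bg(1,2)]
    by (auto simp: im_del_delbar_def del_eq delbar_eq image_iff intro!: bexI[of _ "b + g"])
qed (use assms in \<open>auto simp: im_del_delbar_def\<close>)

lemma im_del_delbar_uminus:
  assumes "\<beta> \<in> im_del_delbar A p q"
  shows "- \<beta> \<in> im_del_delbar A p q"
proof (cases "p = 0 \<or> q = 0")
  case False
  then obtain p' q' where pq: "p = Suc p'" "q = Suc q'" by (auto simp: gr0_conv_Suc)
  with assms obtain b where b: "b \<in> forms A p' q'" "\<beta> = dd 1 (p' + q) (dd (- 1) (p' + q') b)"
    by (auto simp: im_del_delbar_def del_eq delbar_eq)
  have "- \<beta> = dd 1 (p' + q) (dd (- 1) (p' + q') (- b))"
    unfolding b(2) dd_uminus[OF forms_gform[OF b(1)]]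
    using dd_uminus[OF forms_gform[OF dd_forms(2)[OF b(1)]], of 1] pq by simp
  then show ?thesis using pq forms_uminus[OF b(1)]
    by (auto simp: im_del_delbar_def del_eq delbar_eq image_iff intro!: bexI[of _ "- b"])
qed (use assms in \<open>auto simp: im_del_delbar_def\<close>)

lemma im_del_delbar_subset_im_del: "\<beta> \<in> im_del_delbar A p q \<Longrightarrow> \<beta> \<in> im_del A p q"
proof (erule im_del_delbar_cases)
  fix p' q' \<eta> assume pq: "p = Suc p'" "q = Suc q'" and \<eta>: "\<eta> \<in> forms A p' q'"
    and \<beta>: "\<beta> = dd 1 (p' + q) (dd (- 1) (p' + q') \<eta>)"
  then show ?thesis using dd_forms(2)[OF \<eta>] by (auto simp: im_del_def del_eq)
qed (simp add: im_del_zero)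

lemma im_del_delbar_cocycle: "\<beta> \<in> im_del_delbar A p q \<Longrightarrow> \<beta> \<in> bc_cocycles p q"
proof (erule im_del_delbar_cases)
  fix p' q' \<eta> assume pq: "p = Suc p'" "q = Suc q'" and \<eta>: "\<eta> \<in> forms A p' q'"
    and \<beta>: "\<beta> = dd 1 (p' + q) (dd (- 1) (p' + q') \<eta>)"
  let ?k = "p' + q'"
  have f: "dd (- 1) ?k \<eta> \<in> forms A p' q" using dd_forms(2)[OF \<eta>] pq by simp
  have \<beta>': "\<beta> = dd 1 (Suc ?k) (dd (- 1) ?k \<eta>)" using \<beta> pq by simp
  have "\<beta> \<in> forms A p q" using dd_forms(1)[OF f] pq \<beta> by simp
  moreover have "dd 1 (p + q) \<beta> = 0"
    using dd_square[OF gform_dd[OF forms_gform[OF \<eta>]], of 1 "- 1"] pq by (simp add: \<beta>')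
  moreover have "dd (- 1) (p + q) \<beta> = 0"
  proof -
    \<comment> \<open>The conjugate operator is moved past \<partial>, at the price of a sign, to
      meet its own copy inside.\<close>
    have "dd (- 1) (p + q) \<beta> = - dd 1 (Suc (Suc ?k)) (dd (- 1) (Suc ?k) (dd (- 1) ?k \<eta>))"
      using dd_anticommute[OF gform_dd[OF forms_gform[OF \<eta>]], of "- 1" 1 "- 1"] pq by (simp add: \<beta>')
    then show ?thesis by (simp add: dd_square[OF forms_gform[OF \<eta>]] dd_zero)
  qed
  ultimately show ?thesis by (simp add: bc_cocycles_def del_eq delbar_eq)
next
  assume "\<beta> = 0"
  then show ?thesis using forms_zero dd_zero by (simp add: bc_cocycles_def del_eq delbar_eq)
qed

lemma bc_classE:
  assumes "x \<in> bc_class A p q \<alpha>"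
  obtains \<beta> where "\<beta> \<in> im_del_delbar A p q" "x = \<alpha> + \<beta>"
  using assms by (auto simp: bc_class_def)

lemma bc_class_refl: "\<alpha> \<in> bc_class A p q \<alpha>"
  using im_del_delbar_zero[of p q] by (force simp: bc_class_def)

lemma bc_class_eqI:
  assumes "\<alpha> - \<beta> \<in> im_del_delbar A p q"
  shows "bc_class A p q \<alpha> = bc_class A p q \<beta>"
proof -
  have *: "bc_class A p q \<alpha> \<subseteq> bc_class A p q \<beta>" if "\<alpha> - \<beta> \<in> im_del_delbar A p q" for \<alpha> \<beta>
  proof
    fix x assume "x \<in> bc_class A p q \<alpha>"
    then obtain \<gamma> where "\<gamma> \<in> im_del_delbar A p q" "x = \<alpha> + \<gamma>" by (rule bc_classE)
    moreover from this have "x = \<beta> + ((\<alpha> - \<beta>) + \<gamma>)" by simp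
    ultimately have "x = \<beta> + ((\<alpha> - \<beta>) + \<gamma>)" "(\<alpha> - \<beta>) + \<gamma> \<in> im_del_delbar A p q"
      using im_del_delbar_add[OF that] by blast+
    then show "x \<in> bc_class A p q \<beta>" unfolding bc_class_def by blast
  qed
  show ?thesis using *[OF assms] *[of \<beta> \<alpha>] im_del_delbar_uminus[OF assms] by auto
qed

lemma bc_class_cocycles:
  assumes "\<alpha> \<in> bc_cocycles p q" "x \<in> bc_class A p q \<alpha>"
  shows "x \<in> bc_cocycles p q"
proof -
  obtain \<beta> where \<beta>: "\<beta> \<in> im_del_delbar A p q" "x = \<alpha> + \<beta>" using assms(2) by (rule bc_classE)
  have "\<alpha> - (- \<beta>) \<in> bc_cocycles p q"
    by (intro bc_cocycles_diff assms(1) im_del_delbar_cocycle im_del_delbar_uminus \<beta>(1))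
  then show ?thesis using \<beta>(2) by simp
qed

text \<open>Two representatives of a Bott-Chern class differ by an element of
  \<open>im_del_delbar\<close>, hence of \<open>im_del\<close>. This is what makes the
  \<open>the_elem\<close> in \<open>bc_to_aeppli\<close> a well-defined value.\<close>

lemma aeppli_class_bc:
  assumes "x \<in> bc_class A p q \<alpha>"
  shows "aeppli_class A p q x = aeppli_class A p q \<alpha>"
proof -
  obtain \<beta> where \<beta>: "\<beta> \<in> im_del_delbar A p q" "x = \<alpha> + \<beta>" using assms by (rule bc_classE)
  have sub: "aeppli_class A p q (\<alpha> + \<beta>) \<subseteq> aeppli_class A p q \<alpha>" if "\<beta> \<in> im_del A p q" for \<alpha> \<beta>
  proof
    fix y assume "y \<in> aeppli_class A p q (\<alpha> + \<beta>)"
    then obtain b g where "b \<in> im_del A p q" "g \<in> im_delbar A p q" "y = \<alpha> + \<beta> + (b + g)"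
      by (auto simp: aeppli_class_def)
    then have "y = \<alpha> + ((\<beta> + b) + g)" "\<beta> + b \<in> im_del A p q" "g \<in> im_delbar A p q"
      using im_del_add[OF that] by (auto simp: add.assoc)
    then show "y \<in> aeppli_class A p q \<alpha>" unfolding aeppli_class_def by blast
  qed
  have "\<beta> \<in> im_del A p q" by (rule im_del_delbar_subset_im_del[OF \<beta>(1)])
  then show ?thesis
    using sub[of \<beta> \<alpha>] sub[of "- \<beta>" "\<alpha> + \<beta>"] im_del_uminus \<beta>(2) by auto
qed

lemma bc_to_aeppli_class: "bc_to_aeppli A p q (bc_class A p q \<alpha>) = aeppli_class A p q \<alpha>"
proof -
  have "aeppli_class A p q ` bc_class A p q \<alpha> = {aeppli_class A p q \<alpha>}"
    using aeppli_class_bc bc_class_refl[of \<alpha> p q] by blast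
  then show ?thesis by (simp add: bc_to_aeppli_def)
qed

lemma bc_to_aeppli_in:
  assumes "a \<in> bott_chern A p q"
  shows "bc_to_aeppli A p q a \<in> aeppli A p q"
proof -
  obtain \<alpha> where \<alpha>: "\<alpha> \<in> bc_cocycles p q" "a = bc_class A p q \<alpha>" using assms by (auto simp: bott_chern_eq)
  then have "\<alpha> \<in> forms A p q" "del A (p + q + 1) (delbar A (p + q) \<alpha>) = 0"
    by (auto simp: bc_cocycles_def del_eq dd_zero)
  then show ?thesis unfolding \<alpha>(2) bc_to_aeppli_class aeppli_def by blast
qed

end

section \<open>Vanishing of the pairing on exact classes, and the conclusion\<close>

context compact_manifold
begin

lemma form_integral_wedge_exact:
  assumes pq: "p \<le> CARD('n)" "q \<le> CARD('n)"
    and b: "b \<in> im_del A p q" and g: "g \<in> im_delbar A p q"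
    and \<beta>: "\<beta> \<in> bc_cocycles (CARD('n) - p) (CARD('n) - q)"
  shows "form_integral X A (wedge (p + q) ((CARD('n) - p) + (CARD('n) - q)) (b + g) \<beta>) = 0"
proof -
  let ?l = "(CARD('n) - p) + (CARD('n) - q)"
  \<comment> \<open>The degree of a primitive of a top-degree form; \<open>CARD('n)\<close> is
    positive, so the subtraction is not truncated.\<close>
  define k where "k = 2 * CARD('n) - 1"
  have k: "Suc k = 2 * CARD('n)" "Suc k = p + q + ?l" using pq by (auto simp: k_def)
  have \<beta>': "gform ?l \<beta>" "dd 1 ?l \<beta> = 0" "dd (- 1) ?l \<beta> = 0"
    using \<beta> forms_gform by (auto simp: bc_cocycles_def del_eq delbar_eq)
  \<comment> \<open>For \<open>p = 0\<close> the set \<open>im_del\<close> is \<open>{0}\<close>,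
    and likewise \<open>im_delbar\<close> for \<open>q = 0\<close>. The zero form of degree
    \<open>k\<close> is then taken as the primitive, so that all cases have the same shape.\<close>
  have zero: "gform k 0"
    unfolding gform_def locform_def
    by (auto simp: zero_fun_def pullback_def altform_zero smooth_on_const open_chart_range)
  have zero': "wedge (p + q) ?l 0 \<beta> c z v = dloc \<epsilon> k (0 c) z v" for \<epsilon> c z v
    by (simp add: wedge_def wedge_covectors_def dloc_def Dop_const)
  have 1: "\<exists>\<eta>. gform k \<eta> \<and> (\<forall>c\<in>A. \<forall>z\<in>chart_range c. \<forall>v. wedge (p + q) ?l b \<beta> c z v = dloc 1 k (\<eta> c) z v)"
    using b
  proof (cases rule: im_del_cases)
    case 1
    then show ?thesis using zero zero' by blast
  next
    case (2 p' \<eta>)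
    then have "gform (p' + q) \<eta>" "Suc (p' + q) = p + q" "p' + q + ?l = k"
      using forms_gform k by auto
    then show ?thesis using exact_wedge[OF _ \<beta>'(1,2), of "p' + q" \<eta>] gform_wedge[OF _ \<beta>'(1), of "p' + q" \<eta>] 2(3)
      by (intro exI[of _ "wedge (p' + q) ?l \<eta> \<beta>"]) auto
  qed
  have 2: "\<exists>\<eta>. gform k \<eta> \<and> (\<forall>c\<in>A. \<forall>z\<in>chart_range c. \<forall>v. wedge (p + q) ?l g \<beta> c z v = dloc (- 1) k (\<eta> c) z v)"
    using g
  proof (cases rule: im_delbar_cases)
    case 1
    then show ?thesis using zero zero' by blast
  next
    case (2 q' \<eta>)
    then have "gform (p + q') \<eta>" "Suc (p + q') = p + q" "p + q' + ?l = k"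
      using forms_gform k by auto
    then show ?thesis using exact_wedge[OF _ \<beta>'(1,3), of "p + q'" \<eta>] gform_wedge[OF _ \<beta>'(1), of "p + q'" \<eta>] 2(3)
      by (intro exI[of _ "wedge (p + q') ?l \<eta> \<beta>"]) auto
  qed
  obtain \<eta>1 \<eta>2 where "gform k \<eta>1" "gform k \<eta>2"
    "\<And>c z v. c \<in> A \<Longrightarrow> z \<in> chart_range c \<Longrightarrow> wedge (p + q) ?l b \<beta> c z v = dloc 1 k (\<eta>1 c) z v"
    "\<And>c z v. c \<in> A \<Longrightarrow> z \<in> chart_range c \<Longrightarrow> wedge (p + q) ?l g \<beta> c z v = dloc (- 1) k (\<eta>2 c) z v"
    using 1 2 by metis
  then show ?thesis by (intro form_integral_exact[OF _ _ k(1)]) (auto simp: wedge_add_left)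
qed

text \<open>All pairs of representatives integrate to 0, so the set under \<open>the_elem\<close> is
  \<open>{0}\<close>.\<close>

lemma bc_pairing_exact_zero:
  assumes pq: "p \<le> CARD('n)" "q \<le> CARD('n)"
    and b: "b \<in> im_del A p q" and g: "g \<in> im_delbar A p q"
    and y: "y \<in> bott_chern A (CARD('n) - p) (CARD('n) - q)"
  shows "bc_pairing_pq X A p q (bc_class A p q (b + g)) y = 0"
proof -
  let ?F = "\<lambda>(\<alpha>, \<beta>). form_integral X A (wedge (p + q) ((CARD('n) - p) + (CARD('n) - q)) \<alpha> \<beta>)"
  obtain \<beta> where \<beta>: "\<beta> \<in> bc_cocycles (CARD('n) - p) (CARD('n) - q)" "y = bc_class A (CARD('n) - p) (CARD('n) - q) \<beta>"
    using y by (auto simp: bott_chern_eq)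
  have "?F (\<alpha>', \<beta>') = 0" if \<alpha>': "\<alpha>' \<in> bc_class A p q (b + g)" and \<beta>': "\<beta>' \<in> y" for \<alpha>' \<beta>'
  proof -
    obtain d where d: "d \<in> im_del_delbar A p q" "\<alpha>' = b + g + d" using \<alpha>' by (rule bc_classE)
    \<comment> \<open>Being in the image of \<partial>\<partial>', the correction \<open>d\<close>
      can be counted with the \<partial>-exact part.\<close>
    have "\<alpha>' = (b + d) + g" using d(2) by (simp add: ac_simps)
    moreover have "b + d \<in> im_del A p q" by (rule im_del_add[OF b im_del_delbar_subset_im_del[OF d(1)]])
    moreover have "\<beta>' \<in> bc_cocycles (CARD('n) - p) (CARD('n) - q)"
      using \<beta>' \<beta> bc_class_cocycles by blast
    ultimately show ?thesis using form_integral_wedge_exact[OF pq _ g] by simp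
  qed
  moreover have "b + g \<in> bc_class A p q (b + g)" "\<beta> \<in> y" using bc_class_refl \<beta>(2) by auto
  ultimately have "?F ` (bc_class A p q (b + g) \<times> y) = {0}" by (auto simp: image_iff)
  then show ?thesis by (simp add: bc_pairing_pq_def)
qed

theorem schweitzer_imp_del_delbar_lemma:
  assumes S: "schweitzer_qualitative X A"
  shows "del_delbar_lemma A"
  unfolding del_delbar_lemma_def
proof (intro allI conjI)
  fix p q
  show "bc_to_aeppli A p q \<in> bott_chern A p q \<rightarrow> aeppli A p q" using bc_to_aeppli_in by blast
  show "inj_on (bc_to_aeppli A p q) (bott_chern A p q)"
  proof (rule inj_onI)
    fix x y assume x: "x \<in> bott_chern A p q" and y: "y \<in> bott_chern A p q"
      and eq: "bc_to_aeppli A p q x = bc_to_aeppli A p q y"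
    obtain \<alpha> \<alpha>' where \<alpha>: "\<alpha> \<in> bc_cocycles p q" "x = bc_class A p q \<alpha>" and \<alpha>': "\<alpha>' \<in> bc_cocycles p q" "y = bc_class A p q \<alpha>'"
      using x y by (auto simp: bott_chern_eq)
    have "\<alpha> \<in> aeppli_class A p q \<alpha>"
    proof -
      have "\<alpha> = \<alpha> + (0 + 0)" by simp
      then show ?thesis unfolding aeppli_class_def using im_del_zero[of p q] im_delbar_zero[of p q] by blast
    qed
    then have "\<alpha> \<in> aeppli_class A p q \<alpha>'" using eq by (simp add: \<alpha>(2) \<alpha>'(2) bc_to_aeppli_class)
    then obtain b g where bg: "b \<in> im_del A p q" "g \<in> im_delbar A p q" "\<alpha> = \<alpha>' + (b + g)"
      by (auto simp: aeppli_class_def)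
    have diff: "\<alpha> - \<alpha>' = b + g" using bg(3) by simp
    have cocycle: "b + g \<in> bc_cocycles p q" using bc_cocycles_diff[OF \<alpha>(1) \<alpha>'(1)] diff by simp
    \<comment> \<open>Nondegeneracy can speak only about bidegrees that occur in the pairing; in the
      others there is no nonzero form.\<close>
    have "b + g \<in> im_del_delbar A p q"
    proof (cases "p \<le> CARD('n) \<and> q \<le> CARD('n)")
      case False
      then have "b + g = 0" using cocycle forms_gt_zero[of "b + g" p q] by (auto simp: bc_cocycles_def)
      then show ?thesis using im_del_delbar_zero by simp
    next
      case True
      \<comment> \<open>Nondegeneracy is a statement about the total space, so the class is extended
        by zero to the other bidegrees. The zero is written \<open>0 + 0\<close> to be an instance
        of \<open>b + g\<close> in \<open>bc_pairing_exact_zero\<close>.\<close>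
      define a where "a p' q' = (if p' = p \<and> q' = q then bc_class A p q (b + g) else bc_class A p' q' (0 + 0))" for p' q'
      have "0 \<in> bc_cocycles p' q'" for p' q' using im_del_delbar_cocycle[OF im_del_delbar_zero] .
      then have a: "a \<in> bott_chern_total A" using cocycle by (auto simp: bott_chern_total_def a_def bott_chern_eq)
      have "bc_pairing X A a y = 0" if y: "y \<in> bott_chern_total A" for y
      proof -
        have "bc_pairing_pq X A p' q' (a p' q') (y (CARD('n) - p') (CARD('n) - q')) = 0"
          if "p' \<le> CARD('n)" "q' \<le> CARD('n)" for p' q'
        proof (cases "p' = p \<and> q' = q")
          case True
          then have "a p' q' = bc_class A p q (b + g)" by (simp add: a_def)
          with True that y show ?thesis
            by (auto simp: bott_chern_total_def intro!: bc_pairing_exact_zero[OF _ _ bg(1,2)])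
        next
          case False
          then have "a p' q' = bc_class A p' q' (0 + 0)" by (simp only: a_def if_False)
          with that y show ?thesis
            by (simp only: bott_chern_total_def mem_Collect_eq bc_pairing_exact_zero[OF _ _ im_del_zero im_delbar_zero])
        qed
        then show ?thesis by (simp add: bc_pairing_def)
      qed
      then have "a = bott_chern_zero A" using S a by (auto simp: schweitzer_qualitative_def)
      then have "bc_class A p q (b + g) = bc_class A p q 0"
      proof -
        have "a p q = bott_chern_zero A p q" using \<open>a = bott_chern_zero A\<close> by (simp only:)
        then show ?thesis by (simp add: a_def bott_chern_zero_def)
      qed
      then have "b + g \<in> bc_class A p q 0" using bc_class_refl by metis
      then show ?thesis by (auto elim: bc_classE)
    qed
    then show "x = y" unfolding \<alpha>(2) \<alpha>'(2) by (intro bc_class_eqI) (simp add: diff)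
  qed
qed

end

theorem theorem3p2:
  fixes X :: "'a topology" and A :: "('a, 'n::finite) chart set"
  assumes "compact_complex_manifold X A"
    and "schweitzer_qualitative X A"
  shows "del_delbar_lemma A"
proof -
  interpret compact_manifold X A
    by unfold_locales (use assms(1) in \<open>auto simp: compact_complex_manifold_def\<close>)
  show ?thesis by (rule schweitzer_imp_del_delbar_lemma[OF assms(2)])
qed

end
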